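(* For any $\mu>0$, $\epsilon>0$ and $\eta>0$, define the events $$A_{k,n}=\left\{|X_{k+1}(n)-\overline{u}(k,n)|>\mu k^{-(\frac14-\eta)}\ \text{ or }\ |(X_{k+2}(n)-X_{k+1}(n))-\partial_x \overline{u}(k,n)|>\mu k^{-(\frac34-\eta)}\right\}$$ and $$B_n^{\epsilon}=\bigcup_{n^{\epsilon}\le k\le n}A_{k,n},$$ where the union is over integers $k$. Then $P(\limsup_n B_n^{\epsilon})=0$.
   Context: Fix $\alpha\in(0,1)$, let $\sigma=\sqrt{\alpha(1-\alpha)}$ and $\rho=\sigma/\alpha^{3/2}$. Let $W$ be a standard two-dimensional Brownian motion on $[0,\infty)$, extended by $W(s)=0$ for $s\le 0$. Discrete Conga line (coupled to $W$): $X_1(n)=W(n)$ for integers $n\ge 0$, i.e. $X_1(n)=\sum_{i=1}^n Z_i$ with $Z_i=W(i)-W(i-1)$ i.i.d. standard two-dimensional normal. Inductively, for $j\ge1$, $X_{j+1}(0)=0$ and $X_{j+1}(n)=(1-\alpha)X_{j+1}(n-1)+\alpha X_j(n-1)$ for $n\ge 1$. Smooth approximation: for $x>0$, $t>0$, $$\overline{u}(x,t)=\mathbb{E}_{Z_{\rho^2x}}\,W\left(t-\frac{x}{\alpha}-Z_{\rho^2x}\right),$$ where $Z_{\rho^2 x}$ is a real normal random variable with mean $0$ and variance $\rho^2x$, independent of $W$, and $\mathbb{E}_{Z_{\rho^2x}}$ is expectation over $Z_{\rho^2x}$ only, for a fixed realisation of $W$. $\partial_x\overline u$ is the partial derivative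 in $x$. $|\cdot|$ is the Euclidean norm. *)

theory Defs
  imports "HOL-Probability.Probability"
begin

text \<open>
  Standard Brownian motion on \<open>[0, \<infinity>)\<close> with values in \<open>real ^ 'd\<close>; the values at negative times
  are not constrained. The density below is that of the centred normal law with covariance
  \<open>(t - s) I\<close>.
\<close>

locale standard_brownian_motion = prob_space M
  for M :: "'w measure" +
  fixes W :: "real \<Rightarrow> 'w \<Rightarrow> real ^ 'd"
  assumes measurable_W: "0 \<le> t \<Longrightarrow> W t \<in> borel_measurable M"
    and W_zero: "AE \<omega> in M. W 0 \<omega> = 0"
    and indep_increments:
      "\<lbrakk>0 \<le> \<tau> 0; \<And>i. i < m \<Longrightarrow> \<tau> i \<le> \<tau> (Suc i)\<rbrakk> \<Longrightarrow>
         indep_vars (\<lambda>_. borel) (\<lambda>i \<omega>. W (\<tau> (Suc i)) \<omega> - W (\<tau> i) \<omega>) {..<m}"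
    and normal_increments:
      "\<lbrakk>0 \<le> s; s < t\<rbrakk> \<Longrightarrow>
         distributed M lborel (\<lambda>\<omega>. W t \<omega> - W s \<omega>)
           (\<lambda>x. \<Prod>i\<in>UNIV. normal_density 0 (sqrt (t - s)) (x $ i))"
    and continuous_paths: "AE \<omega> in M. continuous_on {0..} (\<lambda>t. W t \<omega>)"

definition path :: "(real \<Rightarrow> 'w \<Rightarrow> 'v::zero) \<Rightarrow> 'w \<Rightarrow> real \<Rightarrow> 'v" where
  "path W \<omega> s = (if s \<le> 0 then 0 else W s \<omega>)"

text \<open>
  The Conga line driven by a single path \<open>w\<close>. Particles are numbered from 1, the leader;
  the value for index 0 is a dummy that is never used.
\<close>

fun conga :: "real \<Rightarrow> (real \<Rightarrow> 'v::real_vector) \<Rightarrow> nat \<Rightarrow> nat \<Rightarrow> 'v" where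
  "conga \<alpha> w 0 n = 0"
| "conga \<alpha> w (Suc 0) n = w (real n)"
| "conga \<alpha> w (Suc (Suc j)) 0 = 0"
| "conga \<alpha> w (Suc (Suc j)) (Suc n) =
     (1 - \<alpha>) *\<^sub>R conga \<alpha> w (Suc (Suc j)) n + \<alpha> *\<^sub>R conga \<alpha> w (Suc j) n"

definition sigma :: "real \<Rightarrow> real" where
  "sigma \<alpha> = sqrt (\<alpha> * (1 - \<alpha>))"

definition rho :: "real \<Rightarrow> real" where
  "rho \<alpha> = sigma \<alpha> / \<alpha> powr (3/2)"

text \<open>
  Expectation over a normal variable of variance \<open>\<rho>\<^sup>2 x\<close> for a fixed path \<open>w\<close>; the second
  parameter of \<open>normal_density\<close> is the standard deviation.
\<close>

definition ubar ::
    "real \<Rightarrow> (real \<Rightarrow> 'v::{banach, second_countable_topology}) \<Rightarrow> real \<Rightarrow> real \<Rightarrow> 'v" where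
  "ubar \<alpha> w x t =
     (LINT z | density lborel (normal_density 0 (sqrt ((rho \<alpha>)\<^sup>2 * x))). w (t - x / \<alpha> - z))"

definition dx_ubar ::
    "real \<Rightarrow> (real \<Rightarrow> 'v::{banach, second_countable_topology}) \<Rightarrow> real \<Rightarrow> real \<Rightarrow> 'v" where
  "dx_ubar \<alpha> w x t = vector_derivative (\<lambda>y. ubar \<alpha> w y t) (at x)"

definition A_event ::
    "'w measure \<Rightarrow> (real \<Rightarrow> 'w \<Rightarrow> real ^ 2) \<Rightarrow> real \<Rightarrow> real \<Rightarrow> real \<Rightarrow> nat \<Rightarrow> nat \<Rightarrow> 'w set" where
  "A_event M W \<alpha> \<mu> \<eta> k n =
     {\<omega> \<in> space M.
        norm (conga \<alpha> (path W \<omega>) (k + 1) n - ubar \<alpha> (path W \<omega>) (real k) (real n))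
          > \<mu> * real k powr (- (1/4 - \<eta>))
      \<or> norm ((conga \<alpha> (path W \<omega>) (k + 2) n - conga \<alpha> (path W \<omega>) (k + 1) n)
               - dx_ubar \<alpha> (path W \<omega>) (real k) (real n))
          > \<mu> * real k powr (- (3/4 - \<eta>))}"

definition B_event ::
    "'w measure \<Rightarrow> (real \<Rightarrow> 'w \<Rightarrow> real ^ 2) \<Rightarrow> real \<Rightarrow> real \<Rightarrow> real \<Rightarrow> real \<Rightarrow> nat \<Rightarrow> 'w set" where
  "B_event M W \<alpha> \<mu> \<eta> \<epsilon> n =
     (\<Union>k\<in>{k. real n powr \<epsilon> \<le> real k \<and> k \<le> n}. A_event M W \<alpha> \<mu> \<eta> k n)"

end

theory Submission
  imports Defs
begin

text \<open>
A particle of the Conga line follows its predecessor with a geometric delay: unrolling the recursion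
gives \<open>X\<^sub>k\<^sub>+\<^sub>1(n) = E W(n - T\<^sub>k)\<close>, the expectation being over a sum \<open>T\<^sub>k\<close> of \<open>k\<close> independent
geometric variables of parameter \<open>\<alpha>\<close>. This sum has mean \<open>k / \<alpha>\<close> and variance \<open>\<rho>\<^sup>2 k\<close>, and the smooth
approximation replaces it by the normal variable with the same two moments. For fixed \<open>k\<close> and \<open>n\<close>
both errors are therefore linear functionals of the Brownian path, and the point is to show that
their standard deviations are at most of order \<open>k\<^sup>-\<^sup>1\<^sup>/\<^sup>4\<close> and \<open>k\<^sup>-\<^sup>3\<^sup>/\<^sup>4\<close>, up to an arbitrarily small power
of \<open>k\<close> and uniformly in \<open>n\<close>. Gaussian tails then make the probability of \<open>A\<^sub>k\<^sub>,\<^sub>n\<close> at most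
\<open>8 exp (- \<kappa> k powr \<eta>)\<close>; only \<open>k \<ge> n powr \<epsilon>\<close> counts, so the probabilities of \<open>B\<^sub>n\<close> are summable and
the Borel--Cantelli lemma applies.

The analytic input is a local limit theorem with an error term (\<open>lattice_envelopes\<close>). Fourier
inversion of the characteristic functions gives \<open>O(1/k)\<close> for the difference between the law of \<open>T\<^sub>k\<close>
and the Gaussian density, and an exponential Chernoff bound gives decay away from the mean on the
scale \<open>sqrt k\<close>. Interpolating between the two costs a power \<open>k powr d\<close> with \<open>d\<close> as small as desired.

The probabilistic input is a small calculus of sub-Gaussian variables, that is, of variables whose
moment generating function is bounded by that of a centred normal variable. It is stable under sums,
under integration over a parameter (\<open>subgauss_mixture\<close>) and under almost sure limits
(\<open>subgauss_limit\<close>), so that stochastic integrals are not needed. With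
\<open>a = n - k / \<alpha>\<close>, heat kernel \<open>q\<close> and lattice weights \<open>p\<close>, the first error is
\[
  \int (p(\lceil u \rceil) - q(u)) (W(\lceil u \rceil) - W(a)) du
    + \int q(u) (W(\lceil u \rceil) - W(u)) du .
\]
In the first integral the kernel is \<open>O(1/k)\<close> on a window of width \<open>sqrt k\<close>, where the increments have
standard deviation at most \<open>k\<^sup>1\<^sup>/\<^sup>4\<close>, so the triangle inequality suffices. In the second integral the
increments over different unit cells are independent, so it is the \<open>L\<^sup>2\<close> norm of the kernel that
counts, and this is \<open>k\<^sup>-\<^sup>1\<^sup>/\<^sup>4\<close> because \<open>q\<close> is of height \<open>k\<^sup>-\<^sup>1\<^sup>/\<^sup>2\<close> on that window.

For the velocity, \<open>X\<^sub>k\<^sub>+\<^sub>2(n) - X\<^sub>k\<^sub>+\<^sub>1(n)\<close> is a sum of the independent increments \<open>W(j+1) - W(j)\<close>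
with weights \<open>- P(T\<^sub>k\<^sub>+\<^sub>1 = n - j) / \<alpha>\<close>. By the heat equation the \<open>x\<close>-derivative of the Gaussian
kernel is a derivative in the variable of integration, so summation by parts turns the \<open>x\<close>-derivative
of the smooth approximation into a sum of the same increments plus a cell integral. All coefficients are now \<open>O(1/k)\<close> on a window of width \<open>sqrt k\<close>,
and the increments involved are independent: this gives \<open>k\<^sup>-\<^sup>1 k\<^sup>1\<^sup>/\<^sup>4 = k\<^sup>-\<^sup>3\<^sup>/\<^sup>4\<close>.
\<close>

section \<open>The weights of the Conga line\<close>

fun delay_weight :: "real \<Rightarrow> nat \<Rightarrow> nat \<Rightarrow> real" where
  "delay_weight \<alpha> 0 m = (if m = 0 then 1 else 0)"
| "delay_weight \<alpha> (Suc k) 0 = 0"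
| "delay_weight \<alpha> (Suc k) (Suc m) = (1 - \<alpha>) * delay_weight \<alpha> (Suc k) m + \<alpha> * delay_weight \<alpha> k m"

text \<open>
The weights are extended by 0 to negative times. The recursion \<open>delay_prob_Suc\<close> then holds on all of
the integers, which is what the uniqueness argument in the Fourier inversion formula relies on.
\<close>

definition delay_prob :: "real \<Rightarrow> nat \<Rightarrow> int \<Rightarrow> real" where
  "delay_prob \<alpha> k m = (if m < 0 then 0 else delay_weight \<alpha> k (nat m))"

lemma delay_prob_neg: "m < 0 \<Longrightarrow> delay_prob \<alpha> k m = 0"
  by (simp add: delay_prob_def)

lemma delay_prob_0: "delay_prob \<alpha> 0 m = (if m = 0 then 1 else 0)"
  by (auto simp: delay_prob_def)

lemma delay_prob_Suc: "delay_prob \<alpha> (Suc k) m = (1 - \<alpha>) * delay_prob \<alpha> (Suc k) (m - 1) + \<alpha> * delay_prob \<alpha> k (m - 1)"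
proof (cases "m \<le> 0")
  case True
  then show ?thesis by (cases "m = 0") (simp_all add: delay_prob_def)
next
  case False
  then obtain j where "m = int (Suc j)" by (metis gr0_implies_Suc not_le zero_less_imp_eq_int)
  then show ?thesis by (simp add: delay_prob_def nat_add_distrib)
qed

lemma conga_eq_sum_delay_prob:
  fixes w :: "real \<Rightarrow> 'v::real_vector"
  shows "conga \<alpha> w (Suc k) n = (\<Sum>m\<le>n. delay_prob \<alpha> k (int m) *\<^sub>R w (real n - real m))"
proof -
  have "conga \<alpha> w (Suc k) n = (\<Sum>m\<le>n. delay_weight \<alpha> k m *\<^sub>R w (real n - real m))"
  proof (induction k arbitrary: n)
    case 0
    have "(\<Sum>m\<le>n. delay_weight \<alpha> 0 m *\<^sub>R w (real n - real m))
        = (\<Sum>m\<in>{0}. delay_weight \<alpha> 0 m *\<^sub>R w (real n - real m))"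
      by (rule sum.mono_neutral_right) auto
    then show ?case by simp
  next
    case (Suc k)
    show ?case
    proof (induction n)
      case 0
      show ?case by simp
    next
      case (Suc n)
      have "(\<Sum>m\<le>Suc n. delay_weight \<alpha> (Suc k) m *\<^sub>R w (real (Suc n) - real m))
         = (\<Sum>m\<le>n. delay_weight \<alpha> (Suc k) (Suc m) *\<^sub>R w (real n - real m))"
        by (subst sum.atMost_Suc_shift) simp
      also have "\<dots> = (1 - \<alpha>) *\<^sub>R conga \<alpha> w (Suc (Suc k)) n + \<alpha> *\<^sub>R conga \<alpha> w (Suc k) n"
        unfolding Suc.IH \<open>\<And>n. conga \<alpha> w (Suc k) n = _ n\<close>
        by (simp add: scaleR_add_left sum.distrib scaleR_sum_right)
      finally show ?case by simp
    qed
  qed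
  then show ?thesis by (simp add: delay_prob_def)
qed

context
  fixes \<alpha> :: real
  assumes \<alpha>: "0 < \<alpha>" "\<alpha> < 1"
begin

lemma delay_prob_nonneg: "0 \<le> delay_prob \<alpha> k m"
proof -
  have "0 \<le> delay_weight \<alpha> k j" for j
    using \<alpha> by (induction \<alpha> k j rule: delay_weight.induct) auto
  then show ?thesis by (simp add: delay_prob_def)
qed

text \<open>
Markov's inequality for \<open>exp (l T\<^sub>k)\<close>. The base of the power is the moment generating function of one
geometric delay, but it only enters through the fixed point equation that makes the double induction
along the recursion close.
\<close>

lemma delay_prob_exponential_bound:
  assumes l: "(1 - \<alpha>) * exp l < 1"
  shows "delay_prob \<alpha> k m \<le> (\<alpha> * exp l / (1 - (1 - \<alpha>) * exp l)) ^ k * exp (- l * m)"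
proof -
  define B where "B = \<alpha> * exp l / (1 - (1 - \<alpha>) * exp l)"
  have B0: "0 \<le> B" using l \<alpha> by (auto simp: B_def)
  have Beq: "(1 - \<alpha>) * exp l * B + \<alpha> * exp l = B"
    using l by (simp add: B_def field_simps)
  have "delay_weight \<alpha> k j * exp (l * j) \<le> B ^ k" for j
  proof (induction k arbitrary: j)
    case 0
    show ?case by simp
  next
    case (Suc k)
    note IHk = Suc
    show ?case
    proof (induction j)
      case 0
      show ?case using B0 by simp
    next
      case (Suc j)
      have "delay_weight \<alpha> (Suc k) (Suc j) * exp (l * Suc j)
          = (1 - \<alpha>) * exp l * (delay_weight \<alpha> (Suc k) j * exp (l * j))
            + \<alpha> * exp l * (delay_weight \<alpha> k j * exp (l * j))"
        by (simp add: algebra_simps exp_add)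
      also have "\<dots> \<le> (1 - \<alpha>) * exp l * B ^ Suc k + \<alpha> * exp l * B ^ k"
        using \<alpha> Suc IHk by (intro add_mono mult_left_mono) auto
      also have "\<dots> = ((1 - \<alpha>) * exp l * B + \<alpha> * exp l) * B ^ k"
        by (simp add: algebra_simps)
      finally show ?case by (simp add: Beq)
    qed
  qed
  from this[of "nat m"] have "m \<ge> 0 \<Longrightarrow> delay_prob \<alpha> k m * exp (l * m) \<le> B ^ k"
    by (simp add: delay_prob_def)
  moreover have "m < 0 \<Longrightarrow> delay_prob \<alpha> k m * exp (l * m) \<le> B ^ k"
    using B0 by (simp add: delay_prob_def)
  ultimately have "delay_prob \<alpha> k m * exp (l * m) \<le> B ^ k" by linarith
  then have "delay_prob \<alpha> k m * exp (l * m) * exp (- l * m) \<le> B ^ k * exp (- l * m)"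
    by (intro mult_right_mono) auto
  then show ?thesis by (simp add: B_def mult.assoc flip: exp_add)
qed

lemma delay_prob_le_one: "delay_prob \<alpha> k m \<le> 1"
  using delay_prob_exponential_bound[of 0 k m] \<alpha> by simp

text \<open>
The exponential bound at the two values \<open>l = \<plusminus> \<alpha> / (2 sqrt k)\<close>. The logarithm of the moment generating
function is \<open>l / \<alpha> + O(l\<^sup>2)\<close>, so its quadratic part contributes only a constant after \<open>k\<close> steps.
\<close>

lemma delay_prob_chernoff:
  assumes "k \<ge> 1"
  shows "delay_prob \<alpha> k m \<le> exp (1/2) * exp (- (\<alpha> / 2) * \<bar>m - k / \<alpha>\<bar> / sqrt k)"
proof -
  have *: "delay_prob \<alpha> k m \<le> exp (1/2) * exp (- (\<alpha> / 2) * (e * (m - k / \<alpha>)) / sqrt k)"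
    if e: "\<bar>e\<bar> = 1" for e :: real
  proof -
    \<comment> \<open>The factor 2 keeps \<open>x\<close> within the range \<open>\<bar>x\<bar> \<le> 1/2\<close> where \<open>ln (1 - x)\<close> is controlled.\<close>
    define l where "l = e * \<alpha> / (2 * sqrt k)"
    define x where "x = l / \<alpha>"
    have sk: "sqrt k \<ge> 1" using assms by simp
    have xe: "x = e / (2 * sqrt k)" using \<alpha> by (simp add: x_def l_def)
    have xabs: "\<bar>x\<bar> \<le> 1/2"
      using sk e by (simp add: xe field_simps)
    have "e\<^sup>2 = 1" using e by (metis one_power2 power2_abs)
    then have xsq: "x\<^sup>2 = 1 / (4 * k)"
      using assms by (simp add: xe power_divide power_mult_distrib)
    have "exp (-l) \<ge> 1 - l" using exp_ge_add_one_self[of "-l"] by simp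
    then have "(\<alpha> - l) / \<alpha> \<le> (exp (-l) - (1 - \<alpha>)) / \<alpha>"
      using \<alpha> by (intro divide_right_mono) auto
    then have "(exp (-l) - (1 - \<alpha>)) / \<alpha> \<ge> 1 - x"
      using \<alpha> by (simp add: x_def diff_divide_distrib)
    also have "1 - x \<ge> exp (- x - 2 * x\<^sup>2)"
    proof -
      have "\<bar>ln (1 + (-x)) - (-x)\<bar> \<le> 2 * (-x)\<^sup>2"
        by (rule abs_ln_one_plus_x_minus_x_bound) (use xabs in auto)
      then have "ln (1 - x) \<ge> - x - 2 * x\<^sup>2" by auto
      moreover have "1 - x > 0" using xabs by auto
      ultimately show ?thesis by (metis exp_le_cancel_iff exp_ln)
    qed
    finally have inv: "exp (- x - 2 * x\<^sup>2) \<le> (exp (-l) - (1 - \<alpha>)) / \<alpha>" .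
    then have pos: "exp (-l) - (1 - \<alpha>) > 0"
      using \<alpha> by (smt (verit) divide_nonpos_pos exp_gt_zero)
    have l1: "(1 - \<alpha>) * exp l < 1"
      using pos by (simp add: exp_minus field_simps)
    have "\<alpha> * exp l / (1 - (1 - \<alpha>) * exp l) = 1 / ((exp (-l) - (1 - \<alpha>)) / \<alpha>)"
      using pos l1 \<alpha> by (simp add: exp_minus field_simps)
    also have "\<dots> \<le> 1 / exp (- x - 2 * x\<^sup>2)"
      using inv pos \<alpha> by (intro divide_left_mono mult_pos_pos divide_pos_pos) auto
    also have "\<dots> = exp (x + 2 * x\<^sup>2)" by (simp add: exp_minus[symmetric] divide_inverse)
    finally have "(\<alpha> * exp l / (1 - (1 - \<alpha>) * exp l)) ^ k \<le> exp (x + 2 * x\<^sup>2) ^ k"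
      using l1 \<alpha> by (intro power_mono) auto
    also have "\<dots> = exp (k * x + 1/2)"
      using assms by (simp add: exp_of_nat_mult[symmetric] xsq algebra_simps)
    finally have "delay_prob \<alpha> k m \<le> exp (k * x + 1/2) * exp (- l * m)"
      using delay_prob_exponential_bound[OF l1, of k m] by (smt (verit) mult_right_mono exp_ge_zero)
    also have "\<dots> = exp (1/2) * exp (k * x - l * m)"
      by (simp add: exp_add[symmetric])
    also have "k * x - l * m = - (\<alpha> / 2) * (e * (m - k / \<alpha>)) / sqrt k"
      using \<alpha> sk by (simp add: x_def l_def field_simps)
    finally show ?thesis .
  qed
  show ?thesis
    using *[of 1] *[of "-1"] by (cases "m - k / \<alpha> \<ge> 0") auto
qed

lemma delay_prob_sums: "(\<lambda>m. delay_prob \<alpha> k (int m)) sums 1"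
proof (induction k)
  case 0
  show ?case using sums_single[of 0 "\<lambda>_. 1::real"] by (simp add: delay_prob_0 cong: if_cong)
next
  case (Suc k)
  let ?f = "\<lambda>k m. delay_prob \<alpha> k (int m)"
  have rec: "?f (Suc k) (Suc m) = (1 - \<alpha>) * ?f (Suc k) m + \<alpha> * ?f k m" for m
    using delay_prob_Suc[of \<alpha> k "int (Suc m)"] by simp
  have f0: "delay_prob \<alpha> (Suc k) 0 = 0" by (simp add: delay_prob_def)
  have le: "(\<Sum>m<N. ?f (Suc k) m) \<le> 1" for N
  proof (induction N)
    case (Suc N)
    have "(\<Sum>m<Suc N. ?f (Suc k) m) = (\<Sum>m<N. ?f (Suc k) (Suc m))"
      by (subst sum.lessThan_Suc_shift) (simp add: f0)
    also have "\<dots> = (1 - \<alpha>) * (\<Sum>m<N. ?f (Suc k) m) + \<alpha> * (\<Sum>m<N. ?f k m)"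
      by (simp only: rec sum.distrib sum_distrib_left)
    also have "\<dots> \<le> (1 - \<alpha>) * 1 + \<alpha> * 1"
    proof (intro add_mono mult_left_mono Suc)
      have "(\<Sum>m<N. ?f k m) \<le> (\<Sum>m. ?f k m)"
        using \<open>?f k sums 1\<close> by (intro sum_le_suminf) (auto simp: sums_iff delay_prob_nonneg)
      then show "(\<Sum>m<N. ?f k m) \<le> 1" using \<open>?f k sums 1\<close> by (simp add: sums_iff)
    qed (use \<alpha> in auto)
    finally show ?case by simp
  qed simp
  have sm: "summable (?f (Suc k))"
    by (rule summableI_nonneg_bounded[OF delay_prob_nonneg le])
  have "(\<lambda>m. (1 - \<alpha>) * ?f (Suc k) m + \<alpha> * ?f k m) sums ((1 - \<alpha>) * suminf (?f (Suc k)) + \<alpha> * 1)"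
    using sm Suc.IH by (intro sums_add sums_mult summable_sums) auto
  then have "(\<lambda>m. ?f (Suc k) (Suc m)) sums ((1 - \<alpha>) * suminf (?f (Suc k)) + \<alpha>)"
    by (simp only: rec mult_1_right)
  then have "?f (Suc k) sums ((1 - \<alpha>) * suminf (?f (Suc k)) + \<alpha>)"
    using f0 by (subst (asm) sums_Suc_iff) simp
  moreover from this have "suminf (?f (Suc k)) = (1 - \<alpha>) * suminf (?f (Suc k)) + \<alpha>"
    by (simp add: sums_iff)
  then have "suminf (?f (Suc k)) = 1" using \<alpha> by (simp add: algebra_simps)
  ultimately show ?case by simp
qed

end

section \<open>A local limit theorem by Fourier inversion\<close>

lemma LINT_cis:
  "(LINT t:{-pi..pi}|lborel. cis (- (of_int m * t))) = (if m = 0 then 2 * of_real pi else 0)"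
proof (cases "m = 0")
  case True
  have "(LINT t:{-pi..pi}|lborel. cis (- (of_int m * t))) = (LINT t:{-pi..pi}|lborel. 1::complex)"
    using True by simp
  also have "\<dots> = of_real (2 * pi)"
    unfolding set_lebesgue_integral_def by (simp add: scaleR_conv_of_real)
  finally show ?thesis using True by simp
next
  case False
  let ?F = "\<lambda>t. cis (- (of_int m * t)) / (- \<i> * of_int m)"
  have "(LINT t:{-pi..pi}|lborel. cis (- (of_int m * t))) = ?F pi - ?F (- pi)"
    unfolding set_lebesgue_integral_def
  proof (rule integral_FTC_atLeastAtMost)
    fix t :: real
    have "((\<lambda>z. exp (- (\<i> * of_int m * z)) / (- \<i> * of_int m)) has_field_derivative
            exp (- (\<i> * of_int m * of_real t))) (at (complex_of_real t))"
      using False by (auto intro!: derivative_eq_intros)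
    then have "((\<lambda>t. exp (- (\<i> * of_int m * of_real t)) / (- \<i> * of_int m)) has_vector_derivative
            exp (- (\<i> * of_int m * of_real t))) (at t within {-pi..pi})"
      by (rule has_vector_derivative_real_field)
    then show "(?F has_vector_derivative cis (- (of_int m * t))) (at t within {-pi..pi})"
      by (simp add: cis_conv_exp mult_ac)
  qed (auto intro!: continuous_intros)
  also have "\<dots> = 0"
    proof -
    have "sin (of_int m * pi) = 0" by (subst sin_times_pi_eq_0) simp
    then show ?thesis by (simp add: cis.ctr)
  qed
  finally show ?thesis using False by simp
qed

text \<open>
A crude quadratic lower bound: the constant is immaterial, only the order in \<open>t\<close> matters for the decay
of the characteristic function.
\<close>

lemma one_minus_cos_ge:
  fixes t :: real assumes "\<bar>t\<bar> \<le> pi"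
  shows "t\<^sup>2 / 18 \<le> 1 - cos t"
proof -
  define x where "x = \<bar>t\<bar> / 2"
  have x: "0 \<le> x" "x \<le> 2" using assms pi_less_4 by (auto simp: x_def)
  have "\<bar>sin x - (\<Sum>m<3. sin_coeff m * x ^ m)\<bar> \<le> inverse (fact 3) * \<bar>x\<bar> ^ 3"
    by (rule Maclaurin_sin_bound)
  then have "\<bar>sin x - x\<bar> \<le> x ^ 3 / 6"
    using x by (simp add: eval_nat_numeral sin_coeff_def fact_numeral field_simps)
  then have "sin x \<ge> x - x ^ 3 / 6" by linarith
  moreover have "x ^ 3 \<le> 4 * x"
    using x mult_mono[of x 2 x 2] mult_right_mono[of "x*x" 4 x] by (simp add: power3_eq_cube)
  ultimately have "x / 3 \<le> sin x" by simp
  then have "(x / 3)\<^sup>2 \<le> (sin x)\<^sup>2" using x by (intro power_mono) auto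
  moreover have "1 - cos t = 2 * (sin x)\<^sup>2"
    using cos_double_sin[of x] by (cases "t \<ge> 0") (simp_all add: x_def)
  moreover have "t\<^sup>2 / 18 = 2 * (x / 3)\<^sup>2"
    by (simp add: x_def power_divide)
  ultimately show ?thesis by simp
qed

lemma gauss_integral:
  fixes K :: real assumes "K > 0"
  shows "integrable lborel (\<lambda>t. exp (- K * t\<^sup>2 / 2))"
    and "(LINT t|lborel. exp (- K * t\<^sup>2 / 2)) = sqrt (2 * pi / K)"
proof -
  let ?s = "1 / sqrt K"
  have s: "?s > 0" using assms by simp
  have eq: "exp (- K * t\<^sup>2 / 2) = sqrt (2 * pi / K) * normal_density 0 ?s t" for t
    using assms by (simp add: normal_density_def power_divide real_sqrt_divide real_sqrt_mult field_simps)
  show "integrable lborel (\<lambda>t. exp (- K * t\<^sup>2 / 2))"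
    unfolding eq using integrable_normal_density[OF s] by simp
  show "(LINT t|lborel. exp (- K * t\<^sup>2 / 2)) = sqrt (2 * pi / K)"
    unfolding eq using integral_normal_density[OF s] by simp
qed

text \<open>
Polynomial factors are absorbed by half of the Gaussian exponent. Each power of \<open>t\<close> is worth
\<open>1 / sqrt K\<close>, and this is the source of the rate \<open>1 / k\<close> in the local limit theorem.
\<close>

lemma power3_gauss_le:
  fixes K :: real assumes "K > 0"
  shows "\<bar>t\<bar> ^ 3 * exp (- K * t\<^sup>2) \<le> 54 * (1 / sqrt K ^ 3) * exp (- K * t\<^sup>2 / 2)"
    and "\<bar>t\<bar> * exp (- K * t\<^sup>2) \<le> 54 * (1 / sqrt K) * exp (- K * t\<^sup>2 / 2)"
proof -
  define v where "v = sqrt K * \<bar>t\<bar>"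
  have v: "v \<ge> 0" "v\<^sup>2 = K * t\<^sup>2" using assms by (auto simp: v_def power_mult_distrib)
  have ex: "exp v \<le> 2 * exp (v\<^sup>2 / 2)"
  proof -
    have "v \<le> 1/2 + v\<^sup>2 / 2" using sum_squares_bound[of v 1] by simp
    then have "exp v \<le> exp (1/2 + v\<^sup>2 / 2)" by simp
    also have "\<dots> = exp (1/2) * exp (v\<^sup>2/2)" by (simp add: exp_add)
    also have "exp (1/2::real) \<le> 2" using exp_bound_half[of "1/2::real"] by simp
    finally show ?thesis by simp
  qed
  have e3: "v ^ 3 / 27 \<le> exp v"
  proof -
    have "v ^ 3 / 27 = (v / 3) ^ 3" by (simp add: power_divide)
    also have "\<dots> \<le> (1 + v / 3) ^ 3" using v by (intro power_mono) auto
    also have "\<dots> \<le> exp v" using exp_ge_one_plus_x_over_n_power_n[of 3 v] v by simp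
    finally show ?thesis .
  qed
  have e1: "v \<le> exp v" using exp_ge_add_one_self[of v] by linarith
  have ee: "exp (v\<^sup>2 / 2) * exp (- K * t\<^sup>2) = exp (- K * t\<^sup>2 / 2)"
    by (simp add: v(2) flip: exp_add)
  have t3: "\<bar>t\<bar> ^ 3 = (1 / sqrt K ^ 3) * v ^ 3" and t1: "\<bar>t\<bar> = (1 / sqrt K) * v"
    using assms by (simp_all add: v_def power_mult_distrib)
  have "\<bar>t\<bar> ^ 3 * exp (- K * t\<^sup>2) \<le> (1 / sqrt K ^ 3) * (54 * exp (v\<^sup>2/2)) * exp (- K * t\<^sup>2)"
    unfolding t3 using e3 ex assms by (intro mult_left_mono mult_right_mono) auto
  then show "\<bar>t\<bar> ^ 3 * exp (- K * t\<^sup>2) \<le> 54 * (1 / sqrt K ^ 3) * exp (- K * t\<^sup>2 / 2)"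
    unfolding ee[symmetric] by (simp add: mult_ac)
  have "\<bar>t\<bar> * exp (- K * t\<^sup>2) \<le> (1 / sqrt K) * (54 * exp (v\<^sup>2/2)) * exp (- K * t\<^sup>2)"
  proof (subst t1, intro mult_left_mono mult_right_mono)
    show "v \<le> 54 * exp (v\<^sup>2 / 2)" using e1 ex exp_gt_zero[of "v\<^sup>2/2"] by linarith
  qed (use assms in auto)
  then show "\<bar>t\<bar> * exp (- K * t\<^sup>2) \<le> 54 * (1 / sqrt K) * exp (- K * t\<^sup>2 / 2)"
    unfolding ee[symmetric] by (simp add: mult_ac)
qed

text \<open>
Fourier inversion for the normal density, read off from the known characteristic function of the
standard normal law by rescaling.
\<close>

lemma gauss_fourier:
  fixes K y :: real assumes "K > 0"
  shows "integrable lborel (\<lambda>t. exp (- K * t\<^sup>2 / 2) *\<^sub>R cis (- (y * t)))"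
    and "(LINT t|lborel. exp (- K * t\<^sup>2 / 2) *\<^sub>R cis (- (y * t)))
           = of_real (2 * pi * normal_density 0 (sqrt K) y)" (is "?J = _")
proof -
  define J where "J = ?J"
  show int: "integrable lborel (\<lambda>t. exp (- K * t\<^sup>2 / 2) *\<^sub>R cis (- (y * t)))"
    by (rule Bochner_Integration.integrable_bound[OF gauss_integral(1)[OF assms]])
       (auto intro!: borel_measurable_continuous_onI continuous_intros)
  let ?v = "sqrt K"
  have v: "?v > 0" using assms by simp
  have "of_real (exp (- (y / ?v)\<^sup>2 / 2)) = char std_normal_distribution (- y / ?v)"
    by (simp add: char_std_normal_distribution power_divide)
  also have "\<dots> = (LINT x|lborel. std_normal_density x *\<^sub>R cis (- y / ?v * x))"
    unfolding char_def by (subst integral_density) (auto simp: cis_conv_exp mult_ac)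
  also have "\<dots> = \<bar>?v\<bar> *\<^sub>R (LINT t|lborel. std_normal_density (0 + ?v * t) *\<^sub>R cis (- y / ?v * (0 + ?v * t)))"
    using v by (intro lborel_integral_real_affine) auto
  also have "(\<lambda>t. std_normal_density (0 + ?v * t) *\<^sub>R cis (- y / ?v * (0 + ?v * t)))
      = (\<lambda>t. (1 / sqrt (2 * pi)) *\<^sub>R (exp (- K * t\<^sup>2 / 2) *\<^sub>R cis (- (y * t))))"
    using assms by (auto simp: std_normal_density_def power_mult_distrib fun_eq_iff)
  also have "(LINT t|lborel. (1 / sqrt (2 * pi)) *\<^sub>R (exp (- K * t\<^sup>2 / 2) *\<^sub>R cis (- (y * t))))
      = (1 / sqrt (2 * pi)) *\<^sub>R J"
    unfolding J_def by (rule integral_scaleR_right) 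
  finally have E: "of_real (exp (- (y / ?v)\<^sup>2 / 2)) = (?v / sqrt (2 * pi)) *\<^sub>R J"
    using v by simp
  have "J = (sqrt (2 * pi) / ?v) *\<^sub>R ((?v / sqrt (2 * pi)) *\<^sub>R J)"
    using assms by simp
  also have "\<dots> = of_real (sqrt (2 * pi) / ?v * exp (- (y / ?v)\<^sup>2 / 2))"
    unfolding E[symmetric] by (simp add: scaleR_conv_of_real)
  also have "sqrt (2 * pi) / ?v * exp (- (y / ?v)\<^sup>2 / 2) = 2 * pi * normal_density 0 (sqrt K) y"
  proof -
    have "2 * pi = sqrt (2 * pi) * sqrt (2 * pi)" by simp
    then show ?thesis using assms
      by (simp add: normal_density_def real_sqrt_mult power_divide field_simps)
  qed
  finally show "?J = of_real (2 * pi * normal_density 0 (sqrt K) y)"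
    unfolding J_def .
qed

lemma norm_power_diff_le:
  fixes z w :: "'a::{real_normed_field}"
  assumes "norm z \<le> r" "norm w \<le> r" "r > 0"
  shows "norm (z ^ k - w ^ k) * r \<le> k * norm (z - w) * r ^ k"
proof -
  define z' w' where "z' = z / of_real r" and "w' = w / of_real r"
  have "norm (z' ^ k - w' ^ k) \<le> k * norm (z' - w')"
    using assms by (intro norm_power_diff) (auto simp: z'_def w'_def norm_divide)
  moreover have "z' ^ k - w' ^ k = (z ^ k - w ^ k) / of_real (r ^ k)" "z' - w' = (z - w) / of_real r"
    using assms by (simp_all add: z'_def w'_def power_divide diff_divide_distrib)
  ultimately have "norm (z ^ k - w ^ k) / r ^ k \<le> k * (norm (z - w) / r)"
    using assms by (simp only: norm_divide norm_of_real abs_of_pos zero_less_power)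
  then have "norm (z ^ k - w ^ k) / r ^ k * (r ^ k * r) \<le> k * (norm (z - w) / r) * (r ^ k * r)"
    using assms by (intro mult_right_mono) auto
  then show ?thesis using assms by (simp add: mult_ac)
qed

context
  fixes \<alpha> :: real
  assumes \<alpha>: "0 < \<alpha>" "\<alpha> < 1"
begin

lemma rho_sq: "(rho \<alpha>)\<^sup>2 = (1 - \<alpha>) / \<alpha>\<^sup>2"
proof -
  have "(\<alpha> powr (3/2))\<^sup>2 = \<alpha> ^ 3"
    using \<alpha> by (simp add: powr_power)
  then show ?thesis using \<alpha>
    by (simp add: rho_def sigma_def power_divide real_sqrt_pow2 power2_eq_square power3_eq_cube)
qed

lemma rho_sq_pos: "0 < (rho \<alpha>)\<^sup>2" using \<alpha> by (simp add: rho_sq)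

text \<open>
The characteristic function \<open>\<alpha> e / (1 - (1 - \<alpha>) e)\<close>, \<open>e = exp (\<i> t)\<close>, of a geometric variable with values
\<open>1, 2, \<dots>\<close>.
\<close>

definition delay_char :: "real \<Rightarrow> complex" where
  "delay_char t = \<alpha> * cis t / (1 - (1 - \<alpha>) * cis t)"

lemma delay_char_denom: "1 - (1 - \<alpha>) * cis t \<noteq> (0::complex)"
proof
  assume "1 - (1 - \<alpha>) * cis t = (0::complex)"
  then have "complex_of_real (1 - \<alpha>) * cis t = 1" by (simp only: right_minus_eq)
  then have "norm (complex_of_real (1 - \<alpha>) * cis t) = 1" by (simp only: norm_one)
  moreover have "norm (complex_of_real (1 - \<alpha>) * cis t) = 1 - \<alpha>"
    using \<alpha> by (simp only: norm_mult norm_of_real norm_cis) simp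
  ultimately show False using \<alpha> by simp
qed

lemma delay_char_rec: "delay_char t = \<alpha> * cis t + (1 - \<alpha>) * cis t * delay_char t"
  using delay_char_denom[of t] by (simp add: delay_char_def field_simps)

text \<open>
The reciprocal of the characteristic function is an affine function of \<open>cis (- t)\<close>, which makes its
Taylor expansion much simpler than that of the function itself.
\<close>

lemma delay_char_inverse: "1 / delay_char t = 1 + (cis (- t) - 1) / \<alpha>" and delay_char_nz: "delay_char t \<noteq> 0"
proof -
  have "cis (- t) * cis t = 1" by (simp add: cis_mult)
  then show "1 / delay_char t = 1 + (cis (- t) - 1) / \<alpha>" "delay_char t \<noteq> 0"
    using \<alpha> delay_char_denom[of t] by (auto simp: delay_char_def field_simps)
qed

lemma continuous_delay_char [continuous_intros]: "continuous_on A delay_char"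
  unfolding delay_char_def [abs_def] using delay_char_denom
  by (auto intro!: continuous_intros)

text \<open>
For the characteristic function \<open>\<psi>\<close> of one delay, \<open>\<bar>\<psi>(t)\<bar>\<^sup>2 = 1 / (1 + 2 \<rho>\<^sup>2 (1 - cos t))\<close>; on a full period this is dominated by a Gaussian.
\<close>

lemma norm_delay_char_le:
  assumes "\<bar>t\<bar> \<le> pi"
  shows "norm (delay_char t) \<le> exp (- ((rho \<alpha>)\<^sup>2 / (18 * (1 + 4 * (rho \<alpha>)\<^sup>2))) * t\<^sup>2)" (is "_ \<le> exp (- ?c * t\<^sup>2)")
    and "norm (delay_char t) \<le> 1"
proof -
  define r where "r = (rho \<alpha>)\<^sup>2"
  define x where "x = 2 * r * (1 - cos t)"
  have r: "r > 0" using rho_sq_pos by (simp add: r_def)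
  have x0: "x \<ge> 0" "x \<le> 4 * r" 

    using r mult_left_mono[of "1 - cos t" 2 "2 * r"] cos_ge_minus_one[of t] cos_le_one[of t]
    unfolding x_def by (simp, linarith)
  have sc: "(sin t)\<^sup>2 = 1 - (cos t)\<^sup>2" by (simp add: sin_squared_eq)
  have "(norm (1 - (1 - \<alpha>) * cis t :: complex))\<^sup>2 = (1 - (1 - \<alpha>) * cos t)\<^sup>2 + ((1 - \<alpha>) * sin t)\<^sup>2"
    by (simp add: cmod_power2)
  also have "\<dots> = \<alpha>\<^sup>2 * (1 + x)"
    using \<alpha> by (simp add: x_def r_def rho_sq power_mult_distrib sc) (simp add: power2_eq_square field_simps)
  finally have *: "(norm (delay_char t))\<^sup>2 = 1 / (1 + x)"
    using \<alpha> x0 by (simp add: delay_char_def norm_divide norm_mult power_divide power_mult_distrib)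
  have "1 / (1 + x) \<le> 1" using x0 by simp
  with * have "(norm (delay_char t))\<^sup>2 \<le> 1\<^sup>2" by simp
  then show "norm (delay_char t) \<le> 1" by (rule power2_le_imp_le) simp
  have "1 / (1 + x) = 1 - x / (1 + x)" using x0 by (simp add: field_simps)
  also have "\<dots> \<le> exp (- (x / (1 + x)))" using exp_ge_add_one_self[of "- (x / (1 + x))"] by simp
  also have "\<dots> \<le> exp (- (2 * ?c * t\<^sup>2))"
  proof -
    have "2 * ?c * t\<^sup>2 = 2 * r * (t\<^sup>2 / 18) / (1 + 4 * r)"
      unfolding r_def[symmetric] using r by (simp add: divide_simps)
    also have "\<dots> \<le> x / (1 + 4 * r)"
      using one_minus_cos_ge[OF assms] r unfolding x_def by (intro divide_right_mono mult_left_mono) auto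
    also have "\<dots> \<le> x / (1 + x)" using x0 r by (intro divide_left_mono) auto
    finally show ?thesis by simp
  qed
  also have "\<dots> = (exp (- ?c * t\<^sup>2))\<^sup>2" by (simp add: power2_eq_square flip: exp_add)
  finally have "(norm (delay_char t))\<^sup>2 \<le> (exp (- ?c * t\<^sup>2))\<^sup>2" using * by simp
  then show "norm (delay_char t) \<le> exp (- ?c * t\<^sup>2)" by (rule power2_le_imp_le) simp
qed

definition gauss_char :: "real \<Rightarrow> complex" where
  "gauss_char t = exp (of_real (- ((rho \<alpha>)\<^sup>2 * t\<^sup>2 / 2))) * cis (t / \<alpha>)"

lemma norm_gauss_char: "norm (gauss_char t) = exp (- ((rho \<alpha>)\<^sup>2 * t\<^sup>2 / 2))"
  by (simp add: gauss_char_def norm_mult)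

text \<open>
Both functions have modulus at most 1, so it suffices to compare their reciprocals. The reciprocals
have the same Taylor polynomial of degree 2, because the Gaussian has the mean and the variance of a
geometric delay.
\<close>

lemma delay_char_minus_gauss_char:
  obtains C where "C > 0" "\<And>t. \<bar>t\<bar> \<le> pi \<Longrightarrow> norm (delay_char t - gauss_char t) \<le> C * \<bar>t\<bar> ^ 3"
proof -
  define r where "r = (rho \<alpha>)\<^sup>2"
  have r0: "r > 0" using rho_sq_pos by (simp add: r_def)
  define A where "A = 1 / \<alpha> + r * pi / 2"
  have A0: "A > 0" using \<alpha> r0 by (simp add: A_def add_pos_pos)
  define C where "C = exp (pi * A) * A ^ 3 + exp pi / \<alpha> + (r / \<alpha> + r\<^sup>2 * pi)"
  have "norm (delay_char t - gauss_char t) \<le> C * \<bar>t\<bar> ^ 3" if t: "\<bar>t\<bar> \<le> pi" for t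
  proof -
    define z where "z = - \<i> * complex_of_real t"
    define v where "v = z / \<alpha> + of_real (r * t\<^sup>2 / 2)"
    let ?T = "\<lambda>z::complex. 1 + z + z\<^sup>2 / 2"
    have tay: "norm (exp u - ?T u) \<le> exp (norm u) * norm u ^ 3" for u :: complex
    proof -
      have "norm (exp u - (\<Sum>i\<le>2. u ^ i / fact i)) \<le> exp (norm u) * (norm u ^ Suc 2) / fact 2"
        by (rule Taylor_exp_field)
      moreover have "(\<Sum>i\<le>2. u ^ i / fact i) = ?T u"
        by (simp add: eval_nat_numeral fact_numeral)
      ultimately have "norm (exp u - ?T u) \<le> exp (norm u) * norm u ^ 3 / 2"
        by (simp add: eval_nat_numeral fact_numeral)
      moreover have "0 \<le> exp (norm u) * norm u ^ 3" by simp
      ultimately show ?thesis by linarith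
    qed
    have nz: "norm z = \<bar>t\<bar>" by (simp add: z_def norm_mult)
    have "norm v \<le> norm (z / \<alpha>) + norm (of_real (r * t\<^sup>2 / 2) :: complex)"
      unfolding v_def by (rule norm_triangle_ineq)
    also have "\<dots> = \<bar>t\<bar> / \<alpha> + r / 2 * (\<bar>t\<bar> * \<bar>t\<bar>)"
      using \<alpha> r0 by (simp add: norm_divide nz norm_mult power2_eq_square)
    also have "\<dots> \<le> \<bar>t\<bar> / \<alpha> + r / 2 * (\<bar>t\<bar> * pi)"
      using t r0 by (intro add_left_mono mult_left_mono) auto
    also have "\<dots> = \<bar>t\<bar> * A" by (simp add: A_def algebra_simps)
    finally have nv: "norm v \<le> \<bar>t\<bar> * A" .
    have vpi: "norm v \<le> pi * A" using nv t A0 by (smt (verit) mult_right_mono)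
    have gi: "1 / gauss_char t = exp v"
    proof -
      have "exp v * gauss_char t = 1"
        by (simp add: gauss_char_def v_def z_def cis_conv_exp r_def flip: exp_add)
      then show ?thesis by (metis nonzero_eq_divide_eq mult_zero_right zero_neq_one)
    qed
    have hi: "1 / delay_char t = 1 + (exp z - 1) / \<alpha>"
      by (simp add: delay_char_inverse cis_conv_exp z_def)
    have gnz: "gauss_char t \<noteq> 0" by (simp add: gauss_char_def)
    have "delay_char t - gauss_char t = delay_char t * gauss_char t * (1 / gauss_char t - 1 / delay_char t)"
      using delay_char_nz[of t] gnz by (simp add: field_simps)
    then have "norm (delay_char t - gauss_char t) = norm (delay_char t) * norm (gauss_char t) * norm (1 / gauss_char t - 1 / delay_char t)"
      by (simp add: norm_mult)
    also have "\<dots> \<le> 1 * 1 * norm (1 / gauss_char t - 1 / delay_char t)"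
      using norm_delay_char_le(2)[OF t] by (intro mult_mono) (auto simp: norm_gauss_char)
    also have "1 / gauss_char t - 1 / delay_char t
        = (exp v - ?T v) - (exp z - ?T z) / \<alpha> + (?T v - (1 + (?T z - 1) / \<alpha>))"
      using \<alpha> by (simp add: gi hi field_simps)
    also have "?T v - (1 + (?T z - 1) / \<alpha>) = of_real t ^ 3 * (- \<i> * of_real (r / (2 * \<alpha>)) + of_real (r\<^sup>2 * t / 8))"
    proof -
      define a b R T where "a = complex_of_real \<alpha>" and "b = 1 / a" and "R = b\<^sup>2 - b" and "T = complex_of_real t"
      have "r = (1 / \<alpha>)\<^sup>2 - 1 / \<alpha>" using \<alpha>
        unfolding r_def rho_sq by (simp add: field_simps power2_eq_square)
      then have rR: "of_real r = R" unfolding R_def b_def a_def by simp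
      have vR: "v = z * b + R * T\<^sup>2 / 2" and zT: "z = - \<i> * T"
        by (simp_all add: v_def b_def a_def T_def rR z_def)
      have "?T v - (1 + (?T z - 1) * b) = T ^ 3 * (- \<i> * (R * b / 2) + R\<^sup>2 * T / 8)"
      proof -
        have "z\<^sup>2 = - (T\<^sup>2)" unfolding zT by (simp add: power_mult_distrib)
        then have z2: "z * z = - (T * T)" by (simp only: power2_eq_square)
        have "?T v - (1 + (?T z - 1) * b)
          = (z * b + R * T\<^sup>2 / 2) + ((z * z) * b\<^sup>2 + z * b * R * T\<^sup>2 + R\<^sup>2 * T ^ 4 / 4) / 2
            - (z + (z * z) / 2) * b"
          unfolding vR by (simp add: power2_eq_square eval_nat_numeral algebra_simps)
        also have "\<dots> = T\<^sup>2 / 2 * (R - b\<^sup>2 + b) + T ^ 3 * (- \<i> * (R * b / 2) + R\<^sup>2 * T / 8)"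
          unfolding z2 zT
          by (simp add: power2_eq_square eval_nat_numeral algebra_simps add_divide_distrib diff_divide_distrib)
        finally show ?thesis by (simp add: R_def)
      qed
      then show ?thesis by (simp add: rR b_def a_def T_def)
    qed
    also have "norm ((exp v - ?T v) - (exp z - ?T z) / \<alpha> + of_real t ^ 3 * (- \<i> * of_real (r / (2 * \<alpha>)) + of_real (r\<^sup>2 * t / 8)))
       \<le> norm (exp v - ?T v) + norm (exp z - ?T z) / \<alpha> + \<bar>t\<bar> ^ 3 * norm (- \<i> * of_real (r / (2 * \<alpha>)) + of_real (r\<^sup>2 * t / 8) :: complex)"
    proof -
      have tri: "norm (P - Q + S) \<le> norm P + norm Q + norm S" for P Q S :: complex
        using norm_triangle_ineq[of "P - Q" S] norm_triangle_ineq4[of P Q] by linarith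
      have na: "\<bar>\<alpha>\<bar> = \<alpha>" using \<alpha> by simp
      show ?thesis by (rule order_trans[OF tri]) (simp only: norm_divide norm_mult norm_power norm_of_real na order_refl)
    qed
    also have "\<dots> \<le> exp (pi * A) * (\<bar>t\<bar> * A) ^ 3 + exp pi * \<bar>t\<bar> ^ 3 / \<alpha> + \<bar>t\<bar> ^ 3 * (r / \<alpha> + r\<^sup>2 * pi)"
    proof (intro add_mono divide_right_mono mult_left_mono)
      show "norm (exp v - ?T v) \<le> exp (pi * A) * (\<bar>t\<bar> * A) ^ 3"
        using nv vpi by (intro order_trans[OF tay] mult_mono power_mono) auto
      show "norm (exp z - ?T z) \<le> exp pi * \<bar>t\<bar> ^ 3"
        using t nz by (intro order_trans[OF tay] mult_mono power_mono) auto
      have "norm (- \<i> * of_real (r / (2 * \<alpha>)) + of_real (r\<^sup>2 * t / 8) :: complex)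
          \<le> norm (- \<i> * of_real (r / (2 * \<alpha>)) :: complex) + norm (of_real (r\<^sup>2 * t / 8) :: complex)"
        by (rule norm_triangle_ineq)
      also have "\<dots> = \<bar>r / (2 * \<alpha>)\<bar> + \<bar>r\<^sup>2 * t / 8\<bar>" by (simp only: norm_mult norm_of_real norm_minus_cancel norm_ii mult_1_left)
      also have "\<bar>r / (2 * \<alpha>)\<bar> \<le> r / \<alpha>" using r0 \<alpha> by (simp add: field_simps)
      also have "\<bar>r\<^sup>2 * t / 8\<bar> \<le> r\<^sup>2 * pi"
      proof -
        have "\<bar>r\<^sup>2 * t / 8\<bar> = r\<^sup>2 * (\<bar>t\<bar> / 8)" by (simp add: abs_mult)
        also have "\<dots> \<le> r\<^sup>2 * pi" using t by (intro mult_left_mono) auto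
        finally show ?thesis .
      qed
      finally show "norm (- \<i> * of_real (r / (2 * \<alpha>)) + of_real (r\<^sup>2 * t / 8) :: complex) \<le> r / \<alpha> + r\<^sup>2 * pi" by simp
    qed (use \<alpha> in auto)
    also have "\<dots> = C * \<bar>t\<bar> ^ 3" by (simp add: C_def algebra_simps power_mult_distrib)
    finally show ?thesis by simp
  qed
  moreover have "C > 0" using A0 r0 \<alpha> by (simp add: C_def add_pos_pos add_pos_nonneg)
  ultimately show ?thesis using that by blast
qed

end

context
  fixes \<alpha> :: real
  assumes \<alpha>: "0 < \<alpha>" "\<alpha> < 1"
begin

lemmas delay_char_facts = norm_delay_char_le[OF \<alpha>] delay_char_rec[OF \<alpha>] continuous_delay_char[OF \<alpha>]

lemma delay_char_integrable:
  "set_integrable lborel {-pi..pi} (\<lambda>t. delay_char \<alpha> t ^ k * cis (- (real_of_int m * t)))"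
  by (intro borel_integrable_atLeastAtMost' continuous_intros delay_char_facts)

text \<open>
The Fourier coefficients of the powers of \<open>delay_char\<close> satisfy the same recursion as the weights. Hence the
difference \<open>d\<close> satisfies \<open>d m = (1 - \<alpha>) d (m - 1)\<close> for all integers \<open>m\<close>, and a bounded function with
this property vanishes.
\<close>

lemma delay_prob_fourier:
  "(LINT t:{-pi..pi}|lborel. delay_char \<alpha> t ^ k * cis (- (real_of_int m * t))) = of_real (2 * pi * delay_prob \<alpha> k m)"
proof (induction k arbitrary: m)
  case 0
  show ?case using LINT_cis[of m] by (simp add: delay_prob_0)
next
  case (Suc k)
  define I where "I k m = (LINT t:{-pi..pi}|lborel. delay_char \<alpha> t ^ k * cis (- (real_of_int m * t)))" for k m
  define d where "d m = I (Suc k) m - of_real (2 * pi * delay_prob \<alpha> (Suc k) m)" for m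
  have "I (Suc k) m = \<alpha> * I k (m - 1) + (1 - \<alpha>) * I (Suc k) (m - 1)" for m
  proof -
    have "delay_char \<alpha> t ^ Suc k * cis (- (real_of_int m * t))
        = \<alpha> * (delay_char \<alpha> t ^ k * cis (- (real_of_int (m - 1) * t)))
        + (1 - \<alpha>) * (delay_char \<alpha> t ^ Suc k * cis (- (real_of_int (m - 1) * t)))" for t
    proof -
      have c: "cis (- (real_of_int (m - 1) * t)) = cis t * cis (- (real_of_int m * t))"
        by (simp add: cis_mult algebra_simps)
      have "delay_char \<alpha> t ^ Suc k * cis (- (real_of_int m * t))
         = delay_char \<alpha> t ^ k * delay_char \<alpha> t * cis (- (real_of_int m * t))" by simp
      also have "\<dots> = delay_char \<alpha> t ^ k * (\<alpha> * cis t + (1 - \<alpha>) * cis t * delay_char \<alpha> t) * cis (- (real_of_int m * t))"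
        by (subst (2) delay_char_facts(3)) (rule refl)
      finally show ?thesis unfolding c by (simp add: algebra_simps)
    qed
    then show ?thesis unfolding I_def
      by (simp only: set_integral_add set_integral_mult_right set_integrable_mult_right delay_char_integrable)
  qed
  note rec = this
  have IH: "I k m = of_real (2 * pi * delay_prob \<alpha> k m)" for m
    unfolding I_def by (rule Suc.IH)
  have drec: "d m = (1 - \<alpha>) * d (m - 1)" for m
    unfolding d_def rec[of m] IH delay_prob_Suc[of \<alpha> k m] by (simp add: algebra_simps)
  have dpow: "d m = of_real ((1 - \<alpha>) ^ j) * d (m - int j)" for j m
  proof (induction j)
    case (Suc j)
    have "d (m - int j) = (1 - \<alpha>) * d (m - int (Suc j))"
      using drec[of "m - int j"] by (simp add: algebra_simps)
    then show ?case using Suc by (simp add: mult_ac)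
  qed simp
  have Ib: "norm (I (Suc k) m) \<le> 2 * pi" for m
  proof -
    have "norm (I (Suc k) m) \<le> (LINT t:{-pi..pi}|lborel. norm (delay_char \<alpha> t ^ Suc k * cis (- (real_of_int m * t))))"
      unfolding I_def by (intro set_integral_norm_bound delay_char_integrable)
    also have "\<dots> \<le> (LINT t:{-pi..pi}|lborel. 1)"
    proof (intro set_integral_mono set_integrable_norm delay_char_integrable)
      fix t :: real assume "t \<in> {-pi..pi}"
      then have "norm (delay_char \<alpha> t) \<le> 1" by (intro delay_char_facts) auto
      then show "norm (delay_char \<alpha> t ^ Suc k * cis (- (real_of_int m * t))) \<le> 1"
        by (simp add: norm_mult norm_power power_le_one mult_le_one)
    qed (rule borel_integrable_atLeastAtMost', simp)
    also have "\<dots> = 2 * pi" by (simp add: set_lebesgue_integral_def)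
    finally show ?thesis .
  qed
  have db: "norm (d m) \<le> 4 * pi" for m
  proof -
    have "norm (d m) \<le> norm (I (Suc k) m) + norm (complex_of_real (2 * pi * delay_prob \<alpha> (Suc k) m))"
      unfolding d_def by (rule norm_triangle_ineq4)
    also have "norm (complex_of_real (2 * pi * delay_prob \<alpha> (Suc k) m)) = 2 * pi * delay_prob \<alpha> (Suc k) m"
      using delay_prob_nonneg[OF \<alpha>] by (simp only: norm_of_real) (simp add: abs_mult)
    also have "\<dots> \<le> 2 * pi * 1" by (intro mult_left_mono delay_prob_le_one \<alpha>) auto
    finally show ?thesis using Ib[of m] by simp
  qed
  have "d m = 0"
  proof -
    have "norm (d m) \<le> (1 - \<alpha>) ^ j * (4 * pi)" for j
    proof -
      have "norm (d m) = (1 - \<alpha>) ^ j * norm (d (m - int j))"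
        using \<alpha> by (subst dpow[of m j]) (simp only: norm_mult norm_of_real, simp)
      then show ?thesis using db \<alpha> by (simp add: mult_left_mono)
    qed
    note le = this
    have lim: "(\<lambda>j. (1 - \<alpha>) ^ j * (4 * pi)) \<longlonglongrightarrow> 0 * (4 * pi)"
      using \<alpha> by (intro tendsto_mult LIMSEQ_power_zero tendsto_const) auto
    have "norm (d m) \<le> 0 * (4 * pi)"
      by (rule LIMSEQ_le_const[OF lim]) (use le in blast)
    then show ?thesis by simp
  qed
  then show ?case by (simp only: d_def I_def right_minus_eq)
qed

text \<open>
The rate of \<open>norm_delay_char_le\<close>. It is at most \<open>\<rho>\<^sup>2 / 2\<close>, so it also bounds the decay of the Gaussian
characteristic function.
\<close>

definition decay_rate :: real where "decay_rate = (rho \<alpha>)\<^sup>2 / (18 * (1 + 4 * (rho \<alpha>)\<^sup>2))"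

lemma decay_rate: "0 < decay_rate" "decay_rate \<le> (rho \<alpha>)\<^sup>2 / 2"
proof -
  have r: "(rho \<alpha>)\<^sup>2 > 0" by (rule rho_sq_pos[OF \<alpha>])
  then show "0 < decay_rate" unfolding decay_rate_def by (intro divide_pos_pos mult_pos_pos add_pos_pos) auto
  have p: "0 < 18 * (1 + 4 * (rho \<alpha>)\<^sup>2)" using r by (intro mult_pos_pos add_pos_pos) auto
  show "decay_rate \<le> (rho \<alpha>)\<^sup>2 / 2"
    unfolding decay_rate_def by (rule divide_left_mono) (use r p in auto)
qed

lemma norm_LINT_le_gauss:
  assumes "K > 0" "F \<in> borel_measurable borel" "\<And>t. norm (F t) \<le> B * exp (- K * t\<^sup>2 / 2)"
  shows "norm (LINT t|lborel. F t :: complex) \<le> B * sqrt (2 * pi / K)"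
proof -
  let ?g = "\<lambda>t. B * exp (- K * t\<^sup>2 / 2)"
  have int: "integrable lborel ?g"
    by (intro integrable_mult_right gauss_integral assms)
  have intF: "integrable lborel F"
  proof (rule Bochner_Integration.integrable_bound[OF int])
    show "AE t in lborel. norm (F t) \<le> norm (?g t)"
      unfolding real_norm_def by (intro AE_I2 order_trans[OF assms(3) abs_ge_self])
  qed (use assms(2) in simp)
  have "norm (LINT t|lborel. F t) \<le> (LINT t|lborel. norm (F t))" by (rule integral_norm_bound)
  also have "\<dots> \<le> (LINT t|lborel. ?g t)"
    by (intro integral_mono integrable_norm intF int assms(3))
  also have "\<dots> = B * sqrt (2 * pi / K)"
    using gauss_integral(2)[OF assms(1)] by simp
  finally show ?thesis .
qed

lemma norm_LINT_le_cubic_gauss: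
  assumes "K > 0" "F \<in> borel_measurable borel" "\<And>t. norm (F t) \<le> B * (\<bar>t\<bar> ^ 3 * exp (- K * t\<^sup>2))" "B \<ge> 0"
  shows "norm (LINT t|lborel. F t :: complex) \<le> B * (54 * sqrt (2 * pi) / K\<^sup>2)"
proof -
  have "norm (LINT t|lborel. F t) \<le> B * (54 * (1 / sqrt K ^ 3)) * sqrt (2 * pi / K)"
    using order_trans[OF assms(3) mult_left_mono[OF power3_gauss_le(1)[OF assms(1)] assms(4)]]
    by (intro norm_LINT_le_gauss assms(1,2)) (simp only: mult.assoc)
  also have "\<dots> = B * (54 * (1 / sqrt K ^ 3 * sqrt (2 * pi / K)))" by simp
  also have "1 / sqrt K ^ 3 * sqrt (2 * pi / K) = sqrt (2 * pi) / K\<^sup>2"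
  proof -
    have "sqrt K ^ 3 * sqrt K = (sqrt K * sqrt K) * (sqrt K * sqrt K)"
      by (simp only: power3_eq_cube mult_ac)
    also have "\<dots> = K\<^sup>2" using assms(1) by (simp add: power2_eq_square)
    finally show ?thesis by (simp only: real_sqrt_divide times_divide_times_eq mult_1_left)
  qed
  finally show ?thesis by simp
qed

lemma norm_LINT_le_linear_gauss:
  assumes "K > 0" "F \<in> borel_measurable borel" "\<And>t. norm (F t) \<le> B * (\<bar>t\<bar> * exp (- K * t\<^sup>2))" "B \<ge> 0"
  shows "norm (LINT t|lborel. F t :: complex) \<le> B * (54 * sqrt (2 * pi) / K)"
proof -
  have "norm (LINT t|lborel. F t) \<le> B * (54 * (1 / sqrt K)) * sqrt (2 * pi / K)"
    using order_trans[OF assms(3) mult_left_mono[OF power3_gauss_le(2)[OF assms(1)] assms(4)]]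
    by (intro norm_LINT_le_gauss assms(1,2)) (simp only: mult.assoc)
  also have "\<dots> = B * (54 * sqrt (2 * pi) / K)"
    using assms(1) by (simp add: real_sqrt_divide)
  finally show ?thesis .
qed

lemma gauss_char_power:
  "gauss_char \<alpha> t ^ k * cis (- (real_of_int m * t))
   = exp (- ((rho \<alpha>)\<^sup>2 * k) * t\<^sup>2 / 2) *\<^sub>R cis (- ((m - k / \<alpha>) * t))"
proof -
  have "gauss_char \<alpha> t ^ k = of_real (exp (- ((rho \<alpha>)\<^sup>2 * t\<^sup>2 / 2)) ^ k) * cis (t / \<alpha>) ^ k"
    by (simp only: gauss_char_def[OF \<alpha>] power_mult_distrib exp_of_real of_real_power)
  also have "exp (- ((rho \<alpha>)\<^sup>2 * t\<^sup>2 / 2)) ^ k = exp (- ((rho \<alpha>)\<^sup>2 * k) * t\<^sup>2 / 2)"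
    by (simp add: exp_of_nat_mult[symmetric] mult_ac)
  also have "cis (t / \<alpha>) ^ k = cis (k * (t / \<alpha>))" by (rule Complex.DeMoivre)
  finally show ?thesis
    by (simp add: scaleR_conv_of_real cis_mult mult.assoc) (simp add: algebra_simps diff_divide_distrib)
qed

text \<open>
With \<open>\<psi>\<close> and \<open>g\<close> the two characteristic functions, the difference of the \<open>k\<close>-th powers is at most \<open>k \<bar>\<psi> - g\<bar>\<close> times a \<open>(k - 1)\<close>-st power, that is, of order
\<open>k \<bar>t\<bar>\<^sup>3 exp (- c k t\<^sup>2)\<close>, and the integral of this is \<open>O(1 / k)\<close>. Outside \<open>[-\<pi>, \<pi>]\<close>, where only the
Gaussian is present, the same bound holds because \<open>\<bar>t\<bar> \<ge> 1\<close>.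
\<close>

lemma delay_prob_near_gauss:
  obtains C where "C > 0"
    "\<And>k m. k \<ge> 1 \<Longrightarrow> \<bar>delay_prob \<alpha> k m - normal_density 0 (sqrt ((rho \<alpha>)\<^sup>2 * k)) (m - k / \<alpha>)\<bar> \<le> C / k"
proof -
  obtain C0 where C0: "C0 > 0" "\<And>t. \<bar>t\<bar> \<le> pi \<Longrightarrow> norm (delay_char \<alpha> t - gauss_char \<alpha> t) \<le> C0 * \<bar>t\<bar> ^ 3"
    using delay_char_minus_gauss_char[OF \<alpha>] by blast
  define c where "c = decay_rate"
  have c: "c > 0" "c \<le> (rho \<alpha>)\<^sup>2 / 2" using decay_rate by (auto simp: c_def)
  \<comment> \<open>The factor \<open>exp (c pi\<^sup>2)\<close> pays for replacing the exponent \<open>k - 1\<close> by \<open>k\<close>; the summand 1 serves \<open>\<bar>t\<bar> > pi\<close>.\<close>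
  define C1 where "C1 = C0 * exp (c * pi\<^sup>2) + 1"
  have C1: "C1 > 0" using C0 by (simp add: C1_def add_pos_pos)
  define C where "C = C1 * (54 * sqrt (2 * pi) / c\<^sup>2)"
  have "\<bar>delay_prob \<alpha> k m - normal_density 0 (sqrt ((rho \<alpha>)\<^sup>2 * k)) (m - k / \<alpha>)\<bar> \<le> C / k" if k: "k \<ge> 1" for k m
  proof -
    define F where "F t = (indicator {-pi..pi} t *\<^sub>R delay_char \<alpha> t ^ k - gauss_char \<alpha> t ^ k) * cis (- (real_of_int m * t))" for t
    let ?K = "(rho \<alpha>)\<^sup>2 * k"
    have K: "?K > 0" using rho_sq_pos[OF \<alpha>] k by simp
    have Feq: "F t = indicator {-pi..pi} t *\<^sub>R (delay_char \<alpha> t ^ k * cis (- (real_of_int m * t)))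
         - exp (- ?K * t\<^sup>2 / 2) *\<^sub>R cis (- ((m - k / \<alpha>) * t))" for t
      unfolding gauss_char_power[symmetric] F_def by (simp add: algebra_simps)
    have i1: "integrable lborel (\<lambda>t. indicator {-pi..pi} t *\<^sub>R (delay_char \<alpha> t ^ k * cis (- (real_of_int m * t))))"
      using delay_char_integrable[of k m] by (simp add: set_integrable_def)
    have "(LINT t|lborel. F t) = of_real (2 * pi * delay_prob \<alpha> k m) - of_real (2 * pi * normal_density 0 (sqrt ?K) (m - k / \<alpha>))"
      unfolding Feq
      by (subst Bochner_Integration.integral_diff[OF i1 gauss_fourier(1)[OF K]])
         (simp only: gauss_fourier(2)[OF K] delay_prob_fourier[unfolded set_lebesgue_integral_def])
    also have "\<dots> = of_real (2 * pi * (delay_prob \<alpha> k m - normal_density 0 (sqrt ?K) (m - k / \<alpha>)))"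
      by (simp only: of_real_diff[symmetric] right_diff_distrib)
    finally have "norm (LINT t|lborel. F t) = 2 * pi * \<bar>delay_prob \<alpha> k m - normal_density 0 (sqrt ?K) (m - k / \<alpha>)\<bar>"
      by (simp only: norm_of_real abs_mult) simp
    moreover have "norm (LINT t|lborel. F t) \<le> (C1 * k) * (54 * sqrt (2 * pi) / (c * k)\<^sup>2)"
    proof (rule norm_LINT_le_cubic_gauss)
      show "c * k > 0" using c k by simp
      have "integrable lborel F"
        unfolding Feq by (intro Bochner_Integration.integrable_diff i1 gauss_fourier K)
      then show "F \<in> borel_measurable borel" by (simp add: borel_measurable_integrable)
      fix t :: real
      have nF: "norm (F t) = norm (indicator {-pi..pi} t *\<^sub>R delay_char \<alpha> t ^ k - gauss_char \<alpha> t ^ k)"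
        by (simp add: F_def norm_mult)
      have gle: "norm (gauss_char \<alpha> t) \<le> exp (- c * t\<^sup>2)"
        using mult_right_mono[OF c(2), of "t\<^sup>2"] by (simp add: norm_gauss_char[OF \<alpha>])
      have pk: "exp (- c * t\<^sup>2) ^ k = exp (- (c * k) * t\<^sup>2)"
        by (simp add: exp_of_nat_mult[symmetric] mult_ac)
      show "norm (F t) \<le> C1 * k * (\<bar>t\<bar> ^ 3 * exp (- (c * k) * t\<^sup>2))"
      proof (cases "\<bar>t\<bar> \<le> pi")
        case True
        let ?r = "exp (- c * t\<^sup>2)"
        have "norm (delay_char \<alpha> t ^ k - gauss_char \<alpha> t ^ k) * ?r \<le> k * norm (delay_char \<alpha> t - gauss_char \<alpha> t) * ?r ^ k"
          using delay_char_facts(1)[OF True] gle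
          by (intro norm_power_diff_le) (auto simp: c_def decay_rate_def)
        also have "\<dots> \<le> k * (C0 * \<bar>t\<bar> ^ 3) * ?r ^ k"
          using C0(2)[OF True] by (intro mult_left_mono mult_right_mono) auto
        finally have "norm (delay_char \<alpha> t ^ k - gauss_char \<alpha> t ^ k) * ?r * exp (c * t\<^sup>2)
            \<le> k * (C0 * \<bar>t\<bar> ^ 3) * ?r ^ k * exp (c * t\<^sup>2)"
          by (intro mult_right_mono) auto
        also have "\<dots> \<le> k * (C0 * \<bar>t\<bar> ^ 3) * ?r ^ k * exp (c * pi\<^sup>2)"
          using C0(1) c True by (intro mult_left_mono) (auto simp: abs_le_square_iff[symmetric])
        also have "\<dots> \<le> C1 * k * (\<bar>t\<bar> ^ 3 * ?r ^ k)"
          by (simp add: C1_def algebra_simps)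
        also have "norm (delay_char \<alpha> t ^ k - gauss_char \<alpha> t ^ k) * ?r * exp (c * t\<^sup>2) = norm (delay_char \<alpha> t ^ k - gauss_char \<alpha> t ^ k)"
          by (simp add: mult.assoc flip: exp_add)
        finally show ?thesis using True unfolding nF pk by (simp add: abs_le_iff)
      next
        case False
        then have "indicator {-pi..pi} t = (0::real)" by (auto simp: indicator_def)
        then have "norm (F t) = norm (gauss_char \<alpha> t) ^ k" by (simp add: nF norm_power)
        also have "\<dots> \<le> exp (- c * t\<^sup>2) ^ k" using gle by (intro power_mono) auto
        also have "\<dots> \<le> C1 * k * \<bar>t\<bar> ^ 3 * exp (- c * t\<^sup>2) ^ k"
        proof -
          have "1 \<le> \<bar>t\<bar>" using False pi_gt3 by linarith
          then have "1 * 1 * 1 \<le> C1 * real k * \<bar>t\<bar> ^ 3"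
            using C0 k by (intro mult_mono one_le_power) (auto simp: C1_def)
          then show ?thesis by (simp add: mult_right_mono)
        qed
        finally show ?thesis unfolding pk by (simp add: mult_ac)
      qed
    qed (use C1 in auto)
    moreover have "(C1 * k) * (54 * sqrt (2 * pi) / (c * k)\<^sup>2) = C / k"
      using k c by (simp add: C_def power_mult_distrib power2_eq_square)
    moreover have "\<bar>delay_prob \<alpha> k m - normal_density 0 (sqrt ?K) (m - k / \<alpha>)\<bar>
       \<le> 2 * pi * \<bar>delay_prob \<alpha> k m - normal_density 0 (sqrt ?K) (m - k / \<alpha>)\<bar>"
      using pi_gt3 by (intro mult_le_cancel_right1[THEN iffD2]) auto
    ultimately show ?thesis by linarith
  qed
  moreover have "C > 0" using C1 c by (simp add: C_def)
  ultimately show ?thesis using that by blast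
qed

text \<open>
One more factor \<open>\<psi> = delay_char\<close> changes the integrand by \<open>\<psi> - 1 = O(t)\<close>, and one power of \<open>t\<close> is worth \<open>k\<^sup>-\<^sup>1\<^sup>/\<^sup>2\<close>
relative to the height \<open>k\<^sup>-\<^sup>1\<^sup>/\<^sup>2\<close> of the weights.
\<close>

lemma delay_prob_Suc_near:
  obtains C where "C > 0" "\<And>k m. k \<ge> 1 \<Longrightarrow> \<bar>delay_prob \<alpha> (Suc k) m - delay_prob \<alpha> k m\<bar> \<le> C / k"
proof -
  define c where "c = decay_rate"
  have c: "c > 0" using decay_rate by (auto simp: c_def)
  define C where "C = 1 / \<alpha> * (54 * sqrt (2 * pi) / c)"
  have "\<bar>delay_prob \<alpha> (Suc k) m - delay_prob \<alpha> k m\<bar> \<le> C / k" if k: "k \<ge> 1" for k m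
  proof -
    define F where "F t = indicator {-pi..pi} t *\<^sub>R (delay_char \<alpha> t ^ k * (delay_char \<alpha> t - 1) * cis (- (real_of_int m * t)))" for t
    have Feq: "F t = indicator {-pi..pi} t *\<^sub>R (delay_char \<alpha> t ^ Suc k * cis (- (real_of_int m * t)))
         - indicator {-pi..pi} t *\<^sub>R (delay_char \<alpha> t ^ k * cis (- (real_of_int m * t)))" for t
      unfolding F_def by (simp add: algebra_simps)
    have i1: "integrable lborel (\<lambda>t. indicator {-pi..pi} t *\<^sub>R (delay_char \<alpha> t ^ k * cis (- (real_of_int m * t))))" for k
      using delay_char_integrable[of k m] by (simp add: set_integrable_def)
    have "(LINT t|lborel. F t) = of_real (2 * pi * delay_prob \<alpha> (Suc k) m) - of_real (2 * pi * delay_prob \<alpha> k m)"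
      unfolding Feq
      by (subst Bochner_Integration.integral_diff[OF i1 i1])
         (simp only: delay_prob_fourier[unfolded set_lebesgue_integral_def])
    also have "\<dots> = of_real (2 * pi * (delay_prob \<alpha> (Suc k) m - delay_prob \<alpha> k m))"
      by (simp only: of_real_diff[symmetric] right_diff_distrib)
    finally have "norm (LINT t|lborel. F t) = 2 * pi * \<bar>delay_prob \<alpha> (Suc k) m - delay_prob \<alpha> k m\<bar>"
      by (simp only: norm_of_real abs_mult) simp
    moreover have "norm (LINT t|lborel. F t) \<le> (1 / \<alpha>) * (54 * sqrt (2 * pi) / (c * k))"
    proof (rule norm_LINT_le_linear_gauss)
      show "c * k > 0" using c k by simp
      have "integrable lborel F"
        unfolding Feq by (intro Bochner_Integration.integrable_diff i1)
      then show "F \<in> borel_measurable borel" by (simp add: borel_measurable_integrable)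
      fix t :: real
      show "norm (F t) \<le> 1 / \<alpha> * (\<bar>t\<bar> * exp (- (c * k) * t\<^sup>2))"
      proof (cases "\<bar>t\<bar> \<le> pi")
        case True
        have "delay_char \<alpha> t - 1 = delay_char \<alpha> t * (1 - 1 / delay_char \<alpha> t)"
          using delay_char_nz[OF \<alpha>, of t] by (simp add: field_simps)
        then have "norm (delay_char \<alpha> t - 1) = norm (delay_char \<alpha> t) * norm (1 - 1 / delay_char \<alpha> t)"
          by (simp only: norm_mult)
        also have "\<dots> \<le> 1 * norm (1 - 1 / delay_char \<alpha> t)"
          using delay_char_facts(2)[OF True] by (intro mult_right_mono) auto
        also have "1 - 1 / delay_char \<alpha> t = - ((cis (- t) - 1) / \<alpha>)"
          unfolding delay_char_inverse[OF \<alpha>] by simp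
        also have "norm \<dots> = norm (exp (\<i> * of_real (- t)) - 1) / \<alpha>"
          using \<alpha> by (simp only: norm_minus_cancel norm_divide norm_of_real cis_conv_exp)
        also have "norm (exp (\<i> * of_real (- t)) - 1) \<le> \<bar>t\<bar>"
          unfolding dist_exp_i_1 using abs_sin_x_le_abs_x[of "t/2"] by simp
        finally have n1: "norm (delay_char \<alpha> t - 1) \<le> \<bar>t\<bar> / \<alpha>"
          using \<alpha> by (simp add: divide_right_mono)
        have "norm (F t) = norm (delay_char \<alpha> t) ^ k * norm (delay_char \<alpha> t - 1)"
          using True by (simp add: F_def norm_mult norm_power abs_le_iff)
        also have "\<dots> \<le> exp (- c * t\<^sup>2) ^ k * (\<bar>t\<bar> / \<alpha>)"
          using delay_char_facts(1)[OF True] n1 by (intro mult_mono power_mono) (auto simp: c_def decay_rate_def)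
        also have "exp (- c * t\<^sup>2) ^ k = exp (- (c * k) * t\<^sup>2)"
          by (simp add: exp_of_nat_mult[symmetric] mult_ac)
        finally show ?thesis by (simp add: mult_ac)
      next
        case False
        then have "indicator {-pi..pi} t = (0::real)" by (auto simp: indicator_def)
        then have "F t = 0" by (simp add: F_def)
        then show ?thesis using \<alpha> by simp
      qed
    qed (use \<alpha> in auto)
    moreover have "(1 / \<alpha>) * (54 * sqrt (2 * pi) / (c * k)) = C / k"
      using k c by (simp add: C_def)
    moreover have "\<bar>delay_prob \<alpha> (Suc k) m - delay_prob \<alpha> k m\<bar> \<le> 2 * pi * \<bar>delay_prob \<alpha> (Suc k) m - delay_prob \<alpha> k m\<bar>"
      using pi_gt3 by (intro mult_le_cancel_right1[THEN iffD2]) auto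
    ultimately show ?thesis by linarith
  qed
  moreover have "C > 0" using \<alpha> c by (simp add: C_def)
  ultimately show ?thesis using that by blast
qed

end

section \<open>The Gaussian kernels and their envelopes\<close>

text \<open>
A quantity bounded both by \<open>a\<close> and by \<open>b\<close> is bounded by their geometric means. With \<open>a = 1 / k\<close> and
\<open>b\<close> exponentially decaying, this trades a small power of \<open>k\<close> for decay.
\<close>

lemma powr_interpolate:
  fixes z :: real
  assumes "0 \<le> z" "z \<le> A * a" "z \<le> A * b" "0 < A" "0 < a" "0 < b" "0 < d" "d < 1"
  shows "z \<le> A * (a powr (1 - d) * b powr d)"
proof (cases "z = 0")
  case False
  then have "z = z powr (1 - d) * z powr d" using assms by (simp flip: powr_add)
  also have "\<dots> \<le> (A * a) powr (1 - d) * (A * b) powr d"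
    using assms by (intro mult_mono powr_mono2) auto
  also have "\<dots> = (A powr (1 - d) * A powr d) * (a powr (1 - d) * b powr d)"
    using assms by (simp add: powr_mult mult_ac)
  also have "A powr (1 - d) * A powr d = A" using assms by (simp flip: powr_add)
  finally show ?thesis .
qed (use assms in simp)

text \<open>
The kernel of the smooth approximation is \<open>heat_kernel \<alpha> x (t - x / \<alpha> - u)\<close>. Both \<open>flux_kernel\<close>
and \<open>drift_kernel\<close> come from differentiating it in \<open>x\<close>: by the heat equation this derivative is a
derivative in \<open>u\<close>, namely that of \<open>flux_kernel\<close>, and \<open>drift_kernel\<close> is its explicit value.
\<close>

definition heat_kernel :: "real \<Rightarrow> real \<Rightarrow> real \<Rightarrow> real" where
  "heat_kernel \<alpha> x y = normal_density 0 (sqrt ((rho \<alpha>)\<^sup>2 * x)) y"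

definition flux_kernel :: "real \<Rightarrow> real \<Rightarrow> real \<Rightarrow> real" where
  "flux_kernel \<alpha> x y = heat_kernel \<alpha> x y * (1 / \<alpha> + y / (2 * x))"

definition drift_kernel :: "real \<Rightarrow> real \<Rightarrow> real \<Rightarrow> real" where
  "drift_kernel \<alpha> x y = heat_kernel \<alpha> x y *
     (y / (\<alpha> * (rho \<alpha>)\<^sup>2 * x) + y\<^sup>2 / (2 * (rho \<alpha>)\<^sup>2 * x\<^sup>2) - 1 / (2 * x))"

context
  fixes \<alpha> :: real
  assumes \<alpha>: "0 < \<alpha>" "\<alpha> < 1"
begin

lemma heat_kernel_eq:
  assumes "x > 0"
  shows "heat_kernel \<alpha> x y = 1 / sqrt (2 * pi * ((rho \<alpha>)\<^sup>2 * x)) * exp (- y\<^sup>2 / (2 * ((rho \<alpha>)\<^sup>2 * x)))"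
  using assms rho_sq_pos[OF \<alpha>] by (simp add: heat_kernel_def normal_density_def)

lemma heat_kernel_nonneg: "0 \<le> heat_kernel \<alpha> x y"
  by (simp add: heat_kernel_def)

lemma heat_kernel_DERIV_y:
  assumes "x > 0"
  shows "(heat_kernel \<alpha> x has_real_derivative - (heat_kernel \<alpha> x y * y / ((rho \<alpha>)\<^sup>2 * x))) (at y)"
proof -
  define r where "r = (rho \<alpha>)\<^sup>2 * x"
  have r: "r > 0" using rho_sq_pos[OF \<alpha>] assms by (simp add: r_def)
  have "((\<lambda>y. 1 / sqrt (2 * pi * r) * exp (- y\<^sup>2 / (2 * r))) has_real_derivative
       - (1 / sqrt (2 * pi * r) * exp (- y\<^sup>2 / (2 * r)) * y / r)) (at y)"
    using r by (auto intro!: derivative_eq_intros simp: field_simps power2_eq_square)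
  then show ?thesis
    unfolding heat_kernel_eq[OF assms, abs_def] r_def[symmetric] .
qed

lemma flux_kernel_DERIV:
  assumes "x > 0"
  shows "(flux_kernel \<alpha> x has_real_derivative - drift_kernel \<alpha> x y) (at y)"
proof -
  have lin: "((\<lambda>y. 1 / \<alpha> + y / (2 * x)) has_real_derivative 1 / (2 * x)) (at y)"
    using assms by (auto intro!: derivative_eq_intros)
  have "((\<lambda>y. heat_kernel \<alpha> x y * (1 / \<alpha> + y / (2 * x))) has_real_derivative
     - (heat_kernel \<alpha> x y * y / ((rho \<alpha>)\<^sup>2 * x)) * (1 / \<alpha> + y / (2 * x)) + heat_kernel \<alpha> x y * (1 / (2 * x))) (at y)"
    using DERIV_mult[OF heat_kernel_DERIV_y[OF assms] lin] by (simp only: mult.commute[of "1 / (2 * x)"])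
  also have "- (heat_kernel \<alpha> x y * y / ((rho \<alpha>)\<^sup>2 * x)) * (1 / \<alpha> + y / (2 * x)) + heat_kernel \<alpha> x y * (1 / (2 * x))
    = - drift_kernel \<alpha> x y"
    unfolding drift_kernel_def by (simp add: algebra_simps power2_eq_square add_divide_distrib)
  finally show ?thesis unfolding flux_kernel_def [abs_def] .
qed

lemma heat_kernel_DERIV_x:
  assumes "x > 0"
  shows "((\<lambda>x. heat_kernel \<alpha> x (t - x / \<alpha>)) has_real_derivative drift_kernel \<alpha> x (t - x / \<alpha>)) (at x)"
proof -
  define r where "r = (rho \<alpha>)\<^sup>2"
  have r: "r > 0" using rho_sq_pos[OF \<alpha>] by (simp add: r_def)
  define G where "G x = 1 / sqrt (2 * pi * (r * x)) * exp (- (t - x / \<alpha>)\<^sup>2 / (2 * (r * x)))" for x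
  have eq: "heat_kernel \<alpha> x (t - x / \<alpha>) = G x" if "x > 0" for x
    using heat_kernel_eq[OF that] by (simp add: G_def r_def)
  have e: "((\<lambda>x. - (t - x / \<alpha>)\<^sup>2 / (2 * (r * x))) has_real_derivative
      (t - x / \<alpha>) / (\<alpha> * r * x) + (t - x / \<alpha>)\<^sup>2 / (2 * r * x\<^sup>2)) (at x)"
    using assms r \<alpha>
    by (auto intro!: derivative_eq_intros) (simp add: field_simps power2_eq_square)
  have s: "((\<lambda>x. 1 / sqrt (2 * pi * (r * x))) has_real_derivative
      1 / sqrt (2 * pi * (r * x)) * (- 1 / (2 * x))) (at x)"
  proof -
    have p: "2 * pi * (r * x) > 0" using assms r by simp
    have "((\<lambda>x. inverse (sqrt (2 * pi * (r * x)))) has_real_derivative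
       - (inverse (sqrt (2 * pi * (r * x))) * (2 * pi * r * (inverse (sqrt (2 * pi * (r * x))) / 2)) * inverse (sqrt (2 * pi * (r * x))))) (at x)"
      using p by (auto intro!: derivative_eq_intros)
    also have "- (inverse (sqrt (2 * pi * (r * x))) * (2 * pi * r * (inverse (sqrt (2 * pi * (r * x))) / 2)) * inverse (sqrt (2 * pi * (r * x))))
       = inverse (sqrt (2 * pi * (r * x))) * (- (2 * pi * r) / (2 * (sqrt (2 * pi * (r * x)))\<^sup>2))"
      using p by (simp add: field_simps power2_eq_square)
    also have "(sqrt (2 * pi * (r * x)))\<^sup>2 = 2 * pi * (r * x)" using p by (simp only: real_sqrt_pow2 less_imp_le)
    also have "- (2 * pi * r) / (2 * (2 * pi * (r * x))) = - 1 / (2 * x)"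
      using r assms by (simp add: field_simps)
    finally show ?thesis by (simp only: inverse_eq_divide)
  qed
  have "(G has_real_derivative drift_kernel \<alpha> x (t - x / \<alpha>)) (at x)"
  proof -
    have "(G has_real_derivative
      1 / sqrt (2 * pi * (r * x)) * (- 1 / (2 * x)) * exp (- (t - x / \<alpha>)\<^sup>2 / (2 * (r * x))) +
      exp (- (t - x / \<alpha>)\<^sup>2 / (2 * (r * x))) * ((t - x / \<alpha>) / (\<alpha> * r * x) + (t - x / \<alpha>)\<^sup>2 / (2 * r * x\<^sup>2)) * (1 / sqrt (2 * pi * (r * x)))) (at x)"
      unfolding G_def by (rule DERIV_mult[OF s DERIV_fun_exp[OF e]])
    also have "1 / sqrt (2 * pi * (r * x)) * (- 1 / (2 * x)) * exp (- (t - x / \<alpha>)\<^sup>2 / (2 * (r * x))) +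
      exp (- (t - x / \<alpha>)\<^sup>2 / (2 * (r * x))) * ((t - x / \<alpha>) / (\<alpha> * r * x) + (t - x / \<alpha>)\<^sup>2 / (2 * r * x\<^sup>2)) * (1 / sqrt (2 * pi * (r * x)))
      = G x * ((t - x / \<alpha>) / (\<alpha> * r * x) + (t - x / \<alpha>)\<^sup>2 / (2 * r * x\<^sup>2) - 1 / (2 * x))"
    proof -
      have "P * (- 1 / (2 * x)) * Q + Q * (A + B) * P = P * Q * (A + B - 1 / (2 * x))" for P Q A B :: real
        by (simp add: algebra_simps)
      then show ?thesis unfolding G_def .
    qed
    also have "\<dots> = drift_kernel \<alpha> x (t - x / \<alpha>)"
      unfolding drift_kernel_def eq[OF assms] r_def by simp
    finally show ?thesis .
  qed
  then show ?thesis
  proof (rule has_field_derivative_transform_within_open)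
    show "open {0::real<..}" "x \<in> {0<..}" using assms by auto
  qed (simp_all add: eq)
qed

text \<open>
In the variable \<open>v = \<bar>y\<bar> / sqrt x\<close>, a quadratic polynomial times \<open>exp (- v\<^sup>2 / (2 \<rho>\<^sup>2))\<close> is bounded by
a multiple of \<open>exp (- v)\<close>. The exponential envelope, although not optimal, is the one that the lattice
weights satisfy as well.
\<close>

lemma heat_kernel_envelope:
  obtains C where "C > 0" "\<And>x y. x > 0 \<Longrightarrow>
    heat_kernel \<alpha> x y * (1 + (\<bar>y\<bar> / sqrt x)\<^sup>2) \<le> C / sqrt x * exp (- \<bar>y\<bar> / sqrt x)"
proof -
  define r where "r = (rho \<alpha>)\<^sup>2"
  have r: "r > 0" using rho_sq_pos[OF \<alpha>] by (simp add: r_def)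
  define C where "C = 2 * exp (2 * r) / sqrt (2 * pi * r)"
  have "heat_kernel \<alpha> x y * (1 + (\<bar>y\<bar> / sqrt x)\<^sup>2) \<le> C / sqrt x * exp (- \<bar>y\<bar> / sqrt x)" if x: "x > 0" for x y
  proof -
    define v where "v = \<bar>y\<bar> / sqrt x"
    have v: "v \<ge> 0" using x by (simp add: v_def)
    have "1 + v\<^sup>2 \<le> 2 * exp v" using exp_lower_Taylor_quadratic[OF v] v by simp
    then have "(1 + v\<^sup>2) * exp (- v\<^sup>2 / (2 * r)) \<le> (2 * exp v) * exp (- v\<^sup>2 / (2 * r))"
      by (rule mult_right_mono) simp
    also have "\<dots> = 2 * (exp v * exp (- v\<^sup>2 / (2 * r)))" by (rule mult.assoc)
    also have "\<dots> \<le> 2 * (exp (2 * r) * exp (- v))"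
    proof (rule mult_left_mono)
      have "0 \<le> (v - 2 * r)\<^sup>2 / (2 * r)" using r by simp
      also have "(v - 2 * r)\<^sup>2 / (2 * r) = v\<^sup>2 / (2 * r) - 2 * v + 2 * r"
        using r by (simp add: power2_eq_square field_simps)
      finally show "exp v * exp (- v\<^sup>2 / (2 * r)) \<le> exp (2 * r) * exp (- v)"
        by (simp flip: exp_add)
    qed simp
    finally have "(1 + v\<^sup>2) * exp (- v\<^sup>2 / (2 * r)) \<le> 2 * exp (2 * r) * exp (- v)"
      by (simp only: mult.assoc)
    then have "1 / sqrt (2 * pi * r) / sqrt x * ((1 + v\<^sup>2) * exp (- v\<^sup>2 / (2 * r)))
        \<le> 1 / sqrt (2 * pi * r) / sqrt x * (2 * exp (2 * r) * exp (- v))"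
      using r x by (intro mult_left_mono) auto
    moreover have "heat_kernel \<alpha> x y = 1 / sqrt (2 * pi * r) / sqrt x * exp (- v\<^sup>2 / (2 * r))"
      using x r unfolding heat_kernel_eq[OF x] r_def[symmetric] v_def
      by (simp add: real_sqrt_mult power_divide mult_ac)
    ultimately show ?thesis unfolding C_def v_def by (simp add: mult_ac)
  qed
  moreover have "C > 0" using r by (simp add: C_def)
  ultimately show ?thesis using that by blast
qed

lemma kernel_envelopes:
  obtains C where "C > 0"
    "\<And>x y. x \<ge> 1/2 \<Longrightarrow> heat_kernel \<alpha> x y \<le> C / sqrt x * exp (- \<bar>y\<bar> / sqrt x)"
    "\<And>x y. x \<ge> 1/2 \<Longrightarrow> heat_kernel \<alpha> x y * \<bar>y\<bar> / x \<le> C / x * exp (- \<bar>y\<bar> / sqrt x)"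
    "\<And>x y. x \<ge> 1/2 \<Longrightarrow> \<bar>drift_kernel \<alpha> x y\<bar> \<le> C / x * exp (- \<bar>y\<bar> / sqrt x)"
proof -
  obtain C0 where C0: "C0 > 0" and env: "\<And>x y. x > 0 \<Longrightarrow>
    heat_kernel \<alpha> x y * (1 + (\<bar>y\<bar> / sqrt x)\<^sup>2) \<le> C0 / sqrt x * exp (- \<bar>y\<bar> / sqrt x)"
    using heat_kernel_envelope by blast
  define r where "r = (rho \<alpha>)\<^sup>2"
  have r: "r > 0" using rho_sq_pos[OF \<alpha>] by (simp add: r_def)
  define D where "D = 1 / (\<alpha> * r) + 1 / r + 1"
  have D1: "D \<ge> 1" and D0: "D > 0" using r \<alpha> by (auto simp: D_def add_pos_pos)
  have 1: "heat_kernel \<alpha> x y \<le> C0 / sqrt x * exp (- \<bar>y\<bar> / sqrt x)" if "x \<ge> 1/2" for x y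
  proof -
    have "heat_kernel \<alpha> x y * 1 \<le> heat_kernel \<alpha> x y * (1 + (\<bar>y\<bar> / sqrt x)\<^sup>2)"
      by (intro mult_left_mono heat_kernel_nonneg) auto
    also have "\<dots> \<le> C0 / sqrt x * exp (- \<bar>y\<bar> / sqrt x)" using that by (intro env) auto
    finally show ?thesis by simp
  qed
  have 2: "heat_kernel \<alpha> x y * \<bar>y\<bar> / x \<le> C0 / x * exp (- \<bar>y\<bar> / sqrt x)" if "x \<ge> 1/2" for x y
  proof -
    have x: "x > 0" "sqrt x * sqrt x = x" using that by auto
    define v where "v = \<bar>y\<bar> / sqrt x"
    have "v \<le> 1 + v\<^sup>2" using sum_squares_bound[of v 1] by simp (smt (verit) zero_le_power2)
    then have "heat_kernel \<alpha> x y * v \<le> heat_kernel \<alpha> x y * (1 + v\<^sup>2)"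
      by (intro mult_left_mono heat_kernel_nonneg) auto
    also have "\<dots> \<le> C0 / sqrt x * exp (- \<bar>y\<bar> / sqrt x)" unfolding v_def using x by (intro env) auto
    finally have "heat_kernel \<alpha> x y * v / sqrt x \<le> C0 / sqrt x * exp (- \<bar>y\<bar> / sqrt x) / sqrt x"
      using x by (intro divide_right_mono) auto
    moreover have "heat_kernel \<alpha> x y * v / sqrt x = heat_kernel \<alpha> x y * \<bar>y\<bar> / x"
      using x by (simp add: v_def mult.assoc)
    moreover have "C0 / sqrt x * exp (- \<bar>y\<bar> / sqrt x) / sqrt x = C0 / x * exp (- \<bar>y\<bar> / sqrt x)"
      by (simp only: times_divide_eq_left divide_divide_eq_left x(2))
    ultimately show ?thesis by (simp only:)
  qed
  have 3: "\<bar>drift_kernel \<alpha> x y\<bar> \<le> 2 * D * C0 / x * exp (- \<bar>y\<bar> / sqrt x)" if "x \<ge> 1/2" for x y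
  proof -
    have x: "x > 0" using that by auto
    define v where "v = \<bar>y\<bar> / sqrt x"
    have v0: "v \<ge> 0" using x by (simp add: v_def)
    have sx: "1 / sqrt x \<le> 2"
    proof -
      have "(1/2::real) \<le> sqrt x" using that by (intro real_le_rsqrt) (auto simp: power2_eq_square)
      then show ?thesis using x by (simp add: field_simps)
    qed
    have xx: "sqrt x * sqrt x = x" using x by simp
    have y2: "y\<^sup>2 = v\<^sup>2 * x" using x by (simp add: v_def power_divide)
    have ya: "\<bar>y\<bar> = v * sqrt x" using x by (simp add: v_def)
    have sxx: "sqrt x / x = 1 / sqrt x" using x by (simp add: frac_eq_eq)
    have b1: "\<bar>y / (\<alpha> * r * x)\<bar> = 1 / (\<alpha> * r) * v * (1 / sqrt x)"
    proof -
      have "\<bar>y / (\<alpha> * r * x)\<bar> = v * sqrt x / (\<alpha> * r * x)"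
        using x r \<alpha> by (simp add: abs_mult ya)
      also have "\<dots> = 1 / (\<alpha> * r) * v * (sqrt x / x)" by simp
      finally show ?thesis unfolding sxx .
    qed
    have b2: "\<bar>y\<^sup>2 / (2 * r * x\<^sup>2)\<bar> = 1 / (2 * r) * v\<^sup>2 * (1 / x)"
      unfolding y2 using x r by (simp add: abs_mult power2_eq_square)
    have ix: "1 / x = 1 / sqrt x * (1 / sqrt x)" using xx by simp
    have ixle: "1 / x \<le> 2 * (1 / sqrt x)" unfolding ix using sx x by (intro mult_right_mono) auto
    have vle: "v \<le> 1 + v\<^sup>2" "v\<^sup>2 \<le> 1 + v\<^sup>2" "1 \<le> 1 + v\<^sup>2"
      using sum_squares_bound[of v 1] by simp_all (smt (verit) zero_le_power2)
    have "\<bar>y / (\<alpha> * r * x) + y\<^sup>2 / (2 * r * x\<^sup>2) - 1 / (2 * x)\<bar>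
       \<le> 1 / (\<alpha> * r) * v * (1 / sqrt x) + 1 / (2 * r) * v\<^sup>2 * (1 / x) + 1 / 2 * (1 / x)"
    proof -
      have "\<bar>1 / (2 * x)\<bar> = 1 / 2 * (1 / x)" using x by simp
      then show ?thesis unfolding b1[symmetric] b2[symmetric] by linarith
    qed
    also have "\<dots> \<le> 1 / (\<alpha> * r) * (1 + v\<^sup>2) * (2 * (1 / sqrt x)) + 1 / (2 * r) * (1 + v\<^sup>2) * (2 * (1 / sqrt x))
        + 1 / 2 * (1 + v\<^sup>2) * (2 * (1 / sqrt x))"
    proof -
      have t: "a * w * q \<le> a * (1 + v\<^sup>2) * (2 * (1 / sqrt x))"
        if "0 \<le> a" "w \<le> 1 + v\<^sup>2" "0 \<le> q" "q \<le> 2 * (1 / sqrt x)" for a w q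
        using that x by (intro mult_mono mult_left_mono) auto
      have q1: "1 / sqrt x \<le> 2 * (1 / sqrt x)" "0 \<le> 1 / sqrt x" "0 \<le> 1 / x"
        using x by (simp_all add: divide_right_mono)
      from t[of "1 / 2" 1 "1 / x", OF _ vle(3) q1(3) ixle]
      have "1 / 2 * (1 / x) \<le> 1 / 2 * (1 + v\<^sup>2) * (2 * (1 / sqrt x))"
        by (simp only: mult_1_right)
      then show ?thesis
        by (intro add_mono t q1 ixle vle) (use r \<alpha> in auto)
    qed
    also have "\<dots> \<le> 2 * D * ((1 + v\<^sup>2) / sqrt x)"
    proof -
      have "1 / (\<alpha> * r) + 1 / (2 * r) + 1 / 2 \<le> D" using r by (simp add: D_def field_simps)
      then have "(1 / (\<alpha> * r) + 1 / (2 * r) + 1 / 2) * (2 * ((1 + v\<^sup>2) * (1 / sqrt x))) \<le> D * (2 * ((1 + v\<^sup>2) * (1 / sqrt x)))"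
        using x by (intro mult_right_mono) auto
      moreover have "a * w * (2 * q) + b * w * (2 * q) + e * w * (2 * q) = (a + b + e) * (2 * (w * q))" for a b e w q :: real
        by (simp add: algebra_simps)
      moreover have "D * (2 * ((1 + v\<^sup>2) * (1 / sqrt x))) = 2 * D * ((1 + v\<^sup>2) / sqrt x)" by simp
      ultimately show ?thesis by (simp only:)
    qed
    finally have poly: "\<bar>y / (\<alpha> * r * x) + y\<^sup>2 / (2 * r * x\<^sup>2) - 1 / (2 * x)\<bar> \<le> 2 * D * ((1 + v\<^sup>2) / sqrt x)" .
    have "\<bar>drift_kernel \<alpha> x y\<bar> = heat_kernel \<alpha> x y * \<bar>y / (\<alpha> * r * x) + y\<^sup>2 / (2 * r * x\<^sup>2) - 1 / (2 * x)\<bar>"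
      unfolding drift_kernel_def r_def abs_mult by (simp only: abs_of_nonneg[OF heat_kernel_nonneg])
    also have "\<dots> \<le> heat_kernel \<alpha> x y * (2 * D * ((1 + v\<^sup>2) / sqrt x))"
      by (rule mult_left_mono[OF poly heat_kernel_nonneg])
    also have "\<dots> = 2 * D / sqrt x * (heat_kernel \<alpha> x y * (1 + v\<^sup>2))" by simp
    also have "\<dots> \<le> 2 * D / sqrt x * (C0 / sqrt x * exp (- \<bar>y\<bar> / sqrt x))"
      unfolding v_def using x D0 by (intro mult_left_mono env) auto
    also have "\<dots> = 2 * D * C0 / (sqrt x * sqrt x) * exp (- \<bar>y\<bar> / sqrt x)" by simp
    finally show ?thesis unfolding xx .
  qed
  define C where "C = 2 * D * C0"
  have "C0 * 1 \<le> C" unfolding C_def using D1 C0 by simp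
  then have C: "C0 \<le> C" "C > 0" using C0 by auto
  have C': "C0 / sqrt x * e \<le> C / sqrt x * e" "C0 / x * e \<le> C / x * e" if "e \<ge> 0" "x \<ge> 1/2" for e x :: real
    using that C by (auto intro!: mult_right_mono divide_right_mono)
  show ?thesis
  proof (rule that[OF C(2)])
    fix x y :: real assume x: "x \<ge> 1/2"
    show "heat_kernel \<alpha> x y \<le> C / sqrt x * exp (- \<bar>y\<bar> / sqrt x)"
      by (rule order_trans[OF 1[OF x] C'(1)]) (use x in auto)
    show "heat_kernel \<alpha> x y * \<bar>y\<bar> / x \<le> C / x * exp (- \<bar>y\<bar> / sqrt x)"
      by (rule order_trans[OF 2[OF x] C'(2)]) (use x in auto)
    show "\<bar>drift_kernel \<alpha> x y\<bar> \<le> C / x * exp (- \<bar>y\<bar> / sqrt x)"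
      using 3[OF x] by (simp add: C_def)
  qed
qed

end

context
  fixes \<alpha> :: real
  assumes \<alpha>: "0 < \<alpha>" "\<alpha> < 1"
begin

lemma heat_kernel_near:
  obtains C where "C > 0" "\<And>(k::nat) y y'. k \<ge> 1 \<Longrightarrow> \<bar>y - y'\<bar> \<le> 1 \<Longrightarrow>
     \<bar>heat_kernel \<alpha> k y - heat_kernel \<alpha> k y'\<bar> \<le> C / k * exp (- \<bar>y\<bar> / sqrt k)"
proof -
  obtain C0 where C0: "C0 > 0" and env: "\<And>x y. x \<ge> 1/2 \<Longrightarrow> heat_kernel \<alpha> x y * \<bar>y\<bar> / x \<le> C0 / x * exp (- \<bar>y\<bar> / sqrt x)"
    using kernel_envelopes[OF \<alpha>] by metis
  define r where "r = (rho \<alpha>)\<^sup>2"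
  have r: "r > 0" using rho_sq_pos[OF \<alpha>] by (simp add: r_def)
  have bnd: "\<bar>heat_kernel \<alpha> k y - heat_kernel \<alpha> k y'\<bar> \<le> (C0 / r * exp 1) / k * exp (- \<bar>y\<bar> / sqrt k)"
    if k: "k \<ge> 1" and d: "\<bar>y - y'\<bar> \<le> 1" for k :: nat and y y'
  proof -
    have kx: "real k > 0" "real k \<ge> 1/2" "sqrt k \<ge> 1" using k by auto
    let ?B = "(C0 / r * exp 1) / k * exp (- \<bar>y\<bar> / sqrt k)"
    have "norm (heat_kernel \<alpha> k y - heat_kernel \<alpha> k y') \<le> ?B * norm (y - y')"
    proof (rule field_differentiable_bound)
      show "convex (cball y 1)" by (rule convex_cball)
      show "(heat_kernel \<alpha> k has_field_derivative - (heat_kernel \<alpha> k z * z / (r * k))) (at z within cball y 1)" for z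
        unfolding r_def by (rule has_field_derivative_at_within[OF heat_kernel_DERIV_y[OF \<alpha> kx(1)]])
      fix z assume "z \<in> cball y 1"
      then have z: "\<bar>y\<bar> \<le> \<bar>z\<bar> + 1" by (auto simp: dist_real_def)
      have "norm (- (heat_kernel \<alpha> k z * z / (r * k))) = (heat_kernel \<alpha> k z * \<bar>z\<bar> / k) / r"
        using r kx heat_kernel_nonneg[OF \<alpha>, of k z] by (simp add: abs_mult mult_ac)
      also have "\<dots> \<le> (C0 / k * exp (- \<bar>z\<bar> / sqrt k)) / r"
        using r kx by (intro divide_right_mono env) auto
      also have "\<dots> \<le> (C0 / k * (exp 1 * exp (- \<bar>y\<bar> / sqrt k))) / r"
      proof (intro divide_right_mono mult_left_mono)
        have "\<bar>y\<bar> / sqrt k \<le> (\<bar>z\<bar> + 1) / sqrt k" using z kx by (intro divide_right_mono) auto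
        also have "\<dots> \<le> \<bar>z\<bar> / sqrt k + 1" using kx by (simp add: add_divide_distrib)
        finally show "exp (- \<bar>z\<bar> / sqrt k) \<le> exp 1 * exp (- \<bar>y\<bar> / sqrt k)" by (simp flip: exp_add)
      qed (use r C0 in auto)
      finally show "norm (- (heat_kernel \<alpha> k z * z / (r * k))) \<le> ?B" by (simp add: mult_ac)
    qed (use d in \<open>auto simp: dist_real_def\<close>)
    also have "\<dots> \<le> ?B * 1" using d C0 r by (intro mult_left_mono) auto
    finally show ?thesis by simp
  qed
  have "C0 / r * exp 1 > 0" using C0 r by simp
  then show ?thesis by (rule that) (use bnd in auto)
qed

text \<open>
The deterministic result on which everything rests. The \<open>O(1/k)\<close> bounds of the local limit theorem
carry no decay, the Chernoff bounds decay but lack the factor \<open>1 / k\<close>; interpolation combines them.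
In the third bound \<open>y\<close> may differ from the lattice point by 1, so that the kernel can be evaluated
anywhere in a unit cell. The fourth bound compares the weights of the increments in
\<open>X\<^sub>k\<^sub>+\<^sub>2 - X\<^sub>k\<^sub>+\<^sub>1\<close> with \<open>flux_kernel\<close>, whose leading term is \<open>heat_kernel / \<alpha>\<close>.
\<close>

lemma lattice_envelopes:
  assumes d: "0 < d" "d < 1"
  obtains C c where "C > 0" "0 < c" "c \<le> 1"
    "\<And>(k::nat) y. k \<ge> 1 \<Longrightarrow> heat_kernel \<alpha> k y \<le> C / sqrt k * exp (- (c / sqrt k) * \<bar>y\<bar>)"
    "\<And>(k::nat) y. k \<ge> 1 \<Longrightarrow> \<bar>drift_kernel \<alpha> k y\<bar> \<le> C * k powr (d - 1) * exp (- (c / sqrt k) * \<bar>y\<bar>)"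
    "\<And>(k::nat) m y. k \<ge> 1 \<Longrightarrow> \<bar>m - k / \<alpha> - y\<bar> \<le> 1 \<Longrightarrow>
       \<bar>delay_prob \<alpha> k m - heat_kernel \<alpha> k y\<bar> \<le> C * k powr (d - 1) * exp (- (c / sqrt k) * \<bar>y\<bar>)"
    "\<And>(k::nat) m. k \<ge> 1 \<Longrightarrow>
       \<bar>delay_prob \<alpha> (Suc k) m / \<alpha> - flux_kernel \<alpha> k (m - k / \<alpha>)\<bar>
          \<le> C * k powr (d - 1) * exp (- (c / sqrt k) * \<bar>m - k / \<alpha>\<bar>)"
proof -
  obtain C1 where C1: "C1 > 0"
    and heat: "\<And>x y. x \<ge> 1/2 \<Longrightarrow> heat_kernel \<alpha> x y \<le> C1 / sqrt x * exp (- \<bar>y\<bar> / sqrt x)"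
    and heaty: "\<And>x y. x \<ge> 1/2 \<Longrightarrow> heat_kernel \<alpha> x y * \<bar>y\<bar> / x \<le> C1 / x * exp (- \<bar>y\<bar> / sqrt x)"
    and drift: "\<And>x y. x \<ge> 1/2 \<Longrightarrow> \<bar>drift_kernel \<alpha> x y\<bar> \<le> C1 / x * exp (- \<bar>y\<bar> / sqrt x)"
    using kernel_envelopes[OF \<alpha>] by metis
  obtain C2 where C2: "C2 > 0" and near: "\<And>(k::nat) y y'. k \<ge> 1 \<Longrightarrow> \<bar>y - y'\<bar> \<le> 1 \<Longrightarrow>
     \<bar>heat_kernel \<alpha> k y - heat_kernel \<alpha> k y'\<bar> \<le> C2 / k * exp (- \<bar>y\<bar> / sqrt k)"
    using heat_kernel_near by metis
  obtain C3 where C3: "C3 > 0" and llt: "\<And>k m. k \<ge> 1 \<Longrightarrow> \<bar>delay_prob \<alpha> k m - heat_kernel \<alpha> k (m - k / \<alpha>)\<bar> \<le> C3 / k"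
    using delay_prob_near_gauss[OF \<alpha>] unfolding heat_kernel_def by metis
  obtain C4 where C4: "C4 > 0" and lltS: "\<And>k m. k \<ge> 1 \<Longrightarrow> \<bar>delay_prob \<alpha> (Suc k) m - delay_prob \<alpha> k m\<bar> \<le> C4 / k"
    using delay_prob_Suc_near[OF \<alpha>] by metis
  \<comment> \<open>Half the Chernoff rate: the other half absorbs the passage from \<open>k + 1\<close> to \<open>k\<close> in \<open>chernS\<close>.\<close>
  define c0 where "c0 = \<alpha> / 4"
  define c where "c = d * c0"
  have c0: "0 < c0" "c0 \<le> 1" using \<alpha> by (auto simp: c0_def)
  have c: "0 < c" "c \<le> 1" "c \<le> c0" using c0 d mult_mono[of d 1 c0 1] mult_right_mono[of d 1 c0] by (auto simp: c_def)
  define E where "E k y = exp (- (c0 / sqrt (real k)) * \<bar>y\<bar>)" for k :: nat and y :: real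
  define F where "F k y = exp (- (c / sqrt (real k)) * \<bar>y\<bar>)" for k :: nat and y :: real
  have E0: "E k y > 0" "F k y > 0" for k y by (auto simp: E_def F_def)
  have EF: "E k y powr d = F k y" for k y by (simp add: E_def F_def c_def powr_def)
  have expE: "exp (- \<bar>y\<bar> / sqrt k) \<le> E k y" for k :: nat and y
  proof -
    have "c0 * (\<bar>y\<bar> / sqrt k) \<le> 1 * (\<bar>y\<bar> / sqrt k)" using c0 by (intro mult_right_mono) auto
    then show ?thesis by (simp add: E_def)
  qed
  have expF: "exp (- \<bar>y\<bar> / sqrt k) \<le> F k y" for k :: nat and y
  proof -
    have "c * (\<bar>y\<bar> / sqrt k) \<le> 1 * (\<bar>y\<bar> / sqrt k)" using c by (intro mult_right_mono) auto
    then show ?thesis by (simp add: F_def)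
  qed
  have kd: "1 / k \<le> k powr (d - 1)" if "k \<ge> 1" for k :: nat
  proof -
    have "1 / k = k powr (-1)" using that by (simp add: powr_minus divide_inverse)
    also have "\<dots> \<le> k powr (d - 1)" using that d by (intro powr_mono) auto
    finally show ?thesis .
  qed
  have chern: "delay_prob \<alpha> k m \<le> exp 1 * E k (m - k / \<alpha>)" if "k \<ge> 1" for k m
  proof -
    have "delay_prob \<alpha> k m \<le> exp (1/2) * exp (- (\<alpha> / 2) * \<bar>m - k / \<alpha>\<bar> / sqrt k)"
      by (rule delay_prob_chernoff[OF \<alpha> that])
    also have "\<dots> \<le> exp 1 * E k (m - k / \<alpha>)"
    proof (intro mult_mono)
      have "c0 * (\<bar>m - k / \<alpha>\<bar> / sqrt k) \<le> (\<alpha> / 2) * (\<bar>m - k / \<alpha>\<bar> / sqrt k)"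
        using \<alpha> by (intro mult_right_mono) (auto simp: c0_def)
      then show "exp (- (\<alpha> / 2) * \<bar>m - k / \<alpha>\<bar> / sqrt k) \<le> E k (m - k / \<alpha>)" by (simp add: E_def)
    qed auto
    finally show ?thesis .
  qed
  have chernS: "delay_prob \<alpha> (Suc k) m \<le> exp 1 * E k (m - k / \<alpha>)" if k: "k \<ge> 1" for k m
  proof -
    have "delay_prob \<alpha> (Suc k) m \<le> exp (1/2) * exp (- (\<alpha> / 2) * \<bar>m - Suc k / \<alpha>\<bar> / sqrt (Suc k))"
      by (rule delay_prob_chernoff[OF \<alpha>]) simp
    also have "\<dots> \<le> exp (1/2) * (exp (1/2) * E k (m - k / \<alpha>))"
    proof (intro mult_left_mono)
      have s1: "sqrt (Suc k) \<ge> 1" by simp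
      have s2: "sqrt (Suc k) \<le> 2 * sqrt k"
      proof -
        have "sqrt (Suc k) \<le> sqrt (4 * k)" using k by (intro real_sqrt_le_mono) simp
        then show ?thesis by (simp add: real_sqrt_mult)
      qed
      have "\<bar>m - k / \<alpha>\<bar> \<le> \<bar>m - Suc k / \<alpha>\<bar> + 1 / \<alpha>"
      proof -
        have "m - k / \<alpha> = (m - Suc k / \<alpha>) + 1 / \<alpha>" by (simp add: add_divide_distrib)
        then show ?thesis using abs_triangle_ineq[of "m - Suc k / \<alpha>" "1 / \<alpha>"] \<alpha> by simp
      qed
      then have "c0 * (\<bar>m - k / \<alpha>\<bar> / sqrt k) \<le> c0 * ((\<bar>m - Suc k / \<alpha>\<bar> + 1 / \<alpha>) / sqrt k)"
        using c0 by (intro mult_left_mono divide_right_mono) auto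
      also have "\<dots> \<le> c0 * ((\<bar>m - Suc k / \<alpha>\<bar> + 1 / \<alpha>) / (sqrt (Suc k) / 2))"
        using c0 s1 s2 k \<alpha> by (intro mult_left_mono divide_left_mono mult_pos_pos) auto
      also have "\<dots> = (\<alpha> / 2) * \<bar>m - Suc k / \<alpha>\<bar> / sqrt (Suc k) + 1 / 2 / sqrt (Suc k)"
        using \<alpha> s1 by (simp add: c0_def field_simps)
      also have "1 / 2 / sqrt (Suc k) \<le> 1 / 2" using s1 by (simp add: field_simps)
      finally show "exp (- (\<alpha> / 2) * \<bar>m - Suc k / \<alpha>\<bar> / sqrt (Suc k)) \<le> exp (1/2) * E k (m - k / \<alpha>)"
        by (simp add: E_def flip: exp_add)
    qed auto
    also have "\<dots> = exp 1 * E k (m - k / \<alpha>)" by (simp add: mult.assoc[symmetric] flip: exp_add)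
    finally show ?thesis .
  qed
  have heatE: "heat_kernel \<alpha> k y \<le> C1 * E k y" if "k \<ge> 1" for k :: nat and y
  proof -
    have "heat_kernel \<alpha> k y \<le> C1 / sqrt k * exp (- \<bar>y\<bar> / sqrt k)" using that by (intro heat) auto
    also have "\<dots> \<le> C1 * E k y"
      using that C1 expE by (intro mult_mono) (auto simp: field_simps)
    finally show ?thesis .
  qed
  have interp: "z \<le> A * k powr (d - 1) * F k y"
    if "0 \<le> z" "z \<le> A * (1 / k)" "z \<le> A * E k y" "A > 0" "k \<ge> 1" for z A y and k :: nat
  proof -
    have "z \<le> A * ((1 / k) powr (1 - d) * E k y powr d)"
      using that E0 d by (intro powr_interpolate) auto
    moreover have "(1 / k) powr (1 - d) = k powr (d - 1)"
      using that powr_minus_divide[of "real k" "1 - d"] by (simp add: powr_divide)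
    ultimately show ?thesis by (simp add: EF mult_ac)
  qed
  define A3 where "A3 = C3 + exp 1 + C1"
  have A3: "A3 > 0" using C1 C3 by (simp add: A3_def add_pos_pos)
  have lat0: "\<bar>delay_prob \<alpha> k m - heat_kernel \<alpha> k (m - k / \<alpha>)\<bar> \<le> A3 * k powr (d - 1) * F k (m - k / \<alpha>)" if k: "k \<ge> 1" for k m
  proof (rule interp)
    have "C3 * (1 / k) \<le> A3 * (1 / k)" using C1 by (intro mult_right_mono) (auto simp: A3_def)
    then show "\<bar>delay_prob \<alpha> k m - heat_kernel \<alpha> k (m - k / \<alpha>)\<bar> \<le> A3 * (1 / k)"
      using llt[OF k, of m] by simp
    have "\<bar>delay_prob \<alpha> k m - heat_kernel \<alpha> k (m - k / \<alpha>)\<bar> \<le> delay_prob \<alpha> k m + heat_kernel \<alpha> k (m - k / \<alpha>)"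
      using delay_prob_nonneg[OF \<alpha>, of k m] heat_kernel_nonneg[OF \<alpha>, of k "m - k / \<alpha>"] by linarith
    also have "\<dots> \<le> exp 1 * E k (m - k / \<alpha>) + C1 * E k (m - k / \<alpha>)"
      by (intro add_mono chern heatE k)
    also have "\<dots> \<le> A3 * E k (m - k / \<alpha>)"
      using C3 E0[of k "m - k / \<alpha>"] by (simp add: A3_def algebra_simps)
    finally show "\<bar>delay_prob \<alpha> k m - heat_kernel \<alpha> k (m - k / \<alpha>)\<bar> \<le> A3 * E k (m - k / \<alpha>)" .
  qed (use A3 k in auto)
  define A4 where "A4 = C4 + 2 * exp 1"
  have A4: "A4 > 0" using C4 by (simp add: A4_def add_pos_pos)
  have lat1: "\<bar>delay_prob \<alpha> (Suc k) m - delay_prob \<alpha> k m\<bar> \<le> A4 * k powr (d - 1) * F k (m - k / \<alpha>)" if k: "k \<ge> 1" for k m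
  proof (rule interp)
    have "C4 * (1 / k) \<le> A4 * (1 / k)" by (intro mult_right_mono) (auto simp: A4_def)
    then show "\<bar>delay_prob \<alpha> (Suc k) m - delay_prob \<alpha> k m\<bar> \<le> A4 * (1 / k)"
      using lltS[OF k, of m] by simp
    have "\<bar>delay_prob \<alpha> (Suc k) m - delay_prob \<alpha> k m\<bar> \<le> delay_prob \<alpha> (Suc k) m + delay_prob \<alpha> k m"
      using delay_prob_nonneg[OF \<alpha>, of k m] delay_prob_nonneg[OF \<alpha>, of "Suc k" m] by linarith
    also have "\<dots> \<le> exp 1 * E k (m - k / \<alpha>) + exp 1 * E k (m - k / \<alpha>)"
      by (intro add_mono chern chernS k)
    also have "\<dots> \<le> A4 * E k (m - k / \<alpha>)"
      using C4 E0[of k "m - k / \<alpha>"] by (simp add: A4_def algebra_simps)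
    finally show "\<bar>delay_prob \<alpha> (Suc k) m - delay_prob \<alpha> k m\<bar> \<le> A4 * E k (m - k / \<alpha>)" .
  qed (use A4 k in auto)
  have small: "B / k * exp (- \<bar>y\<bar> / sqrt k) \<le> B * k powr (d - 1) * F k y" if "k \<ge> 1" "B > 0" for k :: nat and B y
    using mult_mono[OF kd[OF that(1)] expF[of y k]] that
    by (simp add: mult.assoc mult_left_mono flip: times_divide_eq_right)
  define C where "C = exp 1 * A3 + C2 + (A4 + A3) / \<alpha> + C1"
  have Cle: "C1 \<le> C" "exp 1 * A3 + C2 \<le> C" "(A4 + A3) / \<alpha> + C1 \<le> C" "C > 0"
    using A3 A4 C1 C2 \<alpha> by (auto simp: C_def add_pos_pos intro!: add_nonneg_nonneg divide_nonneg_pos)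
  have up: "B * k powr (d - 1) * F k y \<le> C * k powr (d - 1) * F k y" if "B \<le> C" for B k y
    using that E0[of k y] by (intro mult_right_mono) auto
  show ?thesis
  proof (rule that[OF Cle(4) c(1,2)])
    fix k :: nat and y :: real assume k: "k \<ge> 1"
    have "heat_kernel \<alpha> k y \<le> C1 / sqrt k * exp (- \<bar>y\<bar> / sqrt k)" using k by (intro heat) auto
    also have "\<dots> \<le> C / sqrt k * F k y"
      using k C1 Cle expF by (intro mult_mono divide_right_mono) auto
    finally show "heat_kernel \<alpha> k y \<le> C / sqrt k * exp (- (c / sqrt k) * \<bar>y\<bar>)" unfolding F_def .
    have "\<bar>drift_kernel \<alpha> k y\<bar> \<le> C1 / k * exp (- \<bar>y\<bar> / sqrt k)" using k by (intro drift) auto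
    also have "\<dots> \<le> C1 * k powr (d - 1) * F k y" by (rule small[OF k C1])
    also have "\<dots> \<le> C * k powr (d - 1) * F k y" by (rule up) (rule Cle)
    finally show "\<bar>drift_kernel \<alpha> k y\<bar> \<le> C * k powr (d - 1) * exp (- (c / sqrt k) * \<bar>y\<bar>)" unfolding F_def .
  next
    fix k :: nat and m :: int and y :: real assume k: "k \<ge> 1" and my: "\<bar>m - k / \<alpha> - y\<bar> \<le> 1"
    have sk: "sqrt k \<ge> 1" using k by simp
    have Fm: "F k (m - k / \<alpha>) \<le> exp 1 * F k y"
    proof -
      have c1: "c / sqrt k \<le> 1"
        using order_trans[OF c(2) sk] k by (subst divide_le_eq_1_pos) auto
      have "c / sqrt k * \<bar>y\<bar> \<le> c / sqrt k * (\<bar>m - k / \<alpha>\<bar> + 1)"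
        using my c by (intro mult_left_mono) auto
      then have "c / sqrt k * \<bar>y\<bar> \<le> c / sqrt k * \<bar>m - k / \<alpha>\<bar> + 1"
        using c1 by (simp only: distrib_left mult_1_right)
      then show ?thesis by (simp add: F_def flip: exp_add)
    qed
    have "\<bar>delay_prob \<alpha> k m - heat_kernel \<alpha> k y\<bar> \<le> \<bar>delay_prob \<alpha> k m - heat_kernel \<alpha> k (m - k / \<alpha>)\<bar> + \<bar>heat_kernel \<alpha> k y - heat_kernel \<alpha> k (m - k / \<alpha>)\<bar>"
      by linarith
    also have "\<dots> \<le> A3 * k powr (d - 1) * F k (m - k / \<alpha>) + C2 / k * exp (- \<bar>y\<bar> / sqrt k)"
      using my k by (intro add_mono lat0 near k) auto
    also have "\<dots> \<le> A3 * k powr (d - 1) * (exp 1 * F k y) + C2 * k powr (d - 1) * F k y"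
      using A3 by (intro add_mono mult_left_mono Fm small k C2) auto
    also have "\<dots> = (exp 1 * A3 + C2) * k powr (d - 1) * F k y" by (simp add: algebra_simps)
    also have "\<dots> \<le> C * k powr (d - 1) * F k y" by (rule up) (rule Cle)
    finally show "\<bar>delay_prob \<alpha> k m - heat_kernel \<alpha> k y\<bar> \<le> C * k powr (d - 1) * exp (- (c / sqrt k) * \<bar>y\<bar>)" unfolding F_def .
  next
    fix k :: nat and m :: int assume k: "k \<ge> 1"
    let ?y = "m - k / \<alpha>"
    have "delay_prob \<alpha> (Suc k) m / \<alpha> - flux_kernel \<alpha> k ?y
      = (delay_prob \<alpha> (Suc k) m - delay_prob \<alpha> k m) / \<alpha> + (delay_prob \<alpha> k m - heat_kernel \<alpha> k ?y) / \<alpha> - heat_kernel \<alpha> k ?y * ?y / k / 2"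
    proof -
      have "A / \<alpha> - g * (1 / \<alpha> + y / (2 * real k)) = (A - B) / \<alpha> + (B - g) / \<alpha> - g * y / k / 2" for A B g y :: real
        by (simp add: diff_divide_distrib distrib_left)
      then show ?thesis unfolding flux_kernel_def .
    qed
    then have "\<bar>delay_prob \<alpha> (Suc k) m / \<alpha> - flux_kernel \<alpha> k ?y\<bar>
      \<le> \<bar>(delay_prob \<alpha> (Suc k) m - delay_prob \<alpha> k m) / \<alpha>\<bar> + \<bar>(delay_prob \<alpha> k m - heat_kernel \<alpha> k ?y) / \<alpha>\<bar> + \<bar>heat_kernel \<alpha> k ?y * ?y / k / 2\<bar>"
      by linarith
    also have "\<dots> = \<bar>delay_prob \<alpha> (Suc k) m - delay_prob \<alpha> k m\<bar> / \<alpha> + \<bar>delay_prob \<alpha> k m - heat_kernel \<alpha> k ?y\<bar> / \<alpha> + heat_kernel \<alpha> k ?y * \<bar>?y\<bar> / k / 2"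
      using \<alpha> heat_kernel_nonneg[OF \<alpha>, of k ?y] by (simp add: abs_mult)
    also have "\<dots> \<le> (A4 * k powr (d - 1) * F k ?y) / \<alpha> + (A3 * k powr (d - 1) * F k ?y) / \<alpha> + C1 * k powr (d - 1) * F k ?y"
    proof (intro add_mono divide_right_mono lat0 lat1 k)
      have "heat_kernel \<alpha> k ?y * \<bar>?y\<bar> / k / 2 \<le> heat_kernel \<alpha> k ?y * \<bar>?y\<bar> / k"
      proof -
        have "0 \<le> heat_kernel \<alpha> k ?y * \<bar>?y\<bar> / k"
          by (intro divide_nonneg_nonneg mult_nonneg_nonneg heat_kernel_nonneg[OF \<alpha>]) auto
        moreover have "z / 2 \<le> z" if "0 \<le> z" for z :: real using that by simp
        ultimately show ?thesis by blast
      qed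
      also have "\<dots> \<le> C1 / k * exp (- \<bar>?y\<bar> / sqrt k)" using k by (intro heaty) auto
      also have "\<dots> \<le> C1 * k powr (d - 1) * F k ?y" by (rule small[OF k C1])
      finally show "heat_kernel \<alpha> k ?y * \<bar>?y\<bar> / k / 2 \<le> C1 * k powr (d - 1) * F k ?y" .
    qed (use \<alpha> in auto)
    also have "\<dots> = ((A4 + A3) / \<alpha> + C1) * k powr (d - 1) * F k ?y"
      by (simp add: algebra_simps add_divide_distrib)
    also have "\<dots> \<le> C * k powr (d - 1) * F k ?y" by (rule up) (rule Cle)
    finally show "\<bar>delay_prob \<alpha> (Suc k) m / \<alpha> - flux_kernel \<alpha> k ?y\<bar>
       \<le> C * k powr (d - 1) * exp (- (c / sqrt k) * \<bar>?y\<bar>)" unfolding F_def .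
  qed
qed

end

section \<open>Sub-Gaussian random variables\<close>

text \<open>
The moment generating function is a Lebesgue integral in \<open>ennreal\<close>, so that neither its finiteness nor
the integrability of \<open>Y\<close> has to be discussed separately.
\<close>

definition subgauss :: "'a measure \<Rightarrow> real \<Rightarrow> ('a \<Rightarrow> real) \<Rightarrow> bool" where
  "subgauss M s Y \<longleftrightarrow> Y \<in> borel_measurable M \<and>
     (\<forall>l. (\<integral>\<^sup>+\<omega>. ennreal (exp (l * Y \<omega>)) \<partial>M) \<le> ennreal (exp (l\<^sup>2 * s\<^sup>2 / 2)))"

lemma subgauss_measurable: "subgauss M s Y \<Longrightarrow> Y \<in> borel_measurable M"
  by (simp add: subgauss_def)

lemma subgaussD: "subgauss M s Y \<Longrightarrow> (\<integral>\<^sup>+\<omega>. ennreal (exp (l * Y \<omega>)) \<partial>M) \<le> ennreal (exp (l\<^sup>2 * s\<^sup>2 / 2))"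
  by (simp add: subgauss_def)

lemma subgauss_scale:
  assumes "subgauss M s Y"
  shows "subgauss M (c * s) (\<lambda>\<omega>. c * Y \<omega>)"
  unfolding subgauss_def
proof (intro conjI allI)
  show "(\<lambda>\<omega>. c * Y \<omega>) \<in> borel_measurable M" using subgauss_measurable[OF assms] by simp
  show "(\<integral>\<^sup>+\<omega>. ennreal (exp (l * (c * Y \<omega>))) \<partial>M) \<le> ennreal (exp (l\<^sup>2 * (c * s)\<^sup>2 / 2))" for l
    using subgaussD[OF assms, of "l * c"] by (simp add: mult.assoc power_mult_distrib)
qed

lemma subgauss_mono:
  assumes "subgauss M s Y" "\<bar>s\<bar> \<le> t"
  shows "subgauss M t Y"
  unfolding subgauss_def
proof (intro conjI allI)
  fix l
  have "s\<^sup>2 \<le> t\<^sup>2" using assms(2) by (metis abs_ge_zero order_trans power2_abs power_mono)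
  then have "l\<^sup>2 * s\<^sup>2 / 2 \<le> l\<^sup>2 * t\<^sup>2 / 2" by (simp add: mult_left_mono)
  then show "(\<integral>\<^sup>+\<omega>. ennreal (exp (l * Y \<omega>)) \<partial>M) \<le> ennreal (exp (l\<^sup>2 * t\<^sup>2 / 2))"
    by (intro order_trans[OF subgaussD[OF assms(1)]]) (simp add: ennreal_leI)
qed (rule subgauss_measurable[OF assms(1)])

lemma subgauss_uminus: "subgauss M s Y \<Longrightarrow> subgauss M s (\<lambda>\<omega>. - Y \<omega>)"
  using subgauss_mono[OF subgauss_scale[of M s Y "-1"], of "\<bar>s\<bar>"]
  by (simp add: subgauss_def)

lemma subgauss_cong_AE:
  assumes "subgauss M s Y" "AE \<omega> in M. Y \<omega> = Z \<omega>" "Z \<in> borel_measurable M"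
  shows "subgauss M s Z"
  unfolding subgauss_def
proof (intro conjI allI)
  fix l
  have "(\<integral>\<^sup>+\<omega>. ennreal (exp (l * Z \<omega>)) \<partial>M) = (\<integral>\<^sup>+\<omega>. ennreal (exp (l * Y \<omega>)) \<partial>M)"
  proof (rule nn_integral_cong_AE)
    show "AE \<omega> in M. ennreal (exp (l * Z \<omega>)) = ennreal (exp (l * Y \<omega>))"
      using assms(2) by eventually_elim simp
  qed
  then show "(\<integral>\<^sup>+\<omega>. ennreal (exp (l * Z \<omega>)) \<partial>M) \<le> ennreal (exp (l\<^sup>2 * s\<^sup>2 / 2))"
    using subgaussD[OF assms(1)] by simp
qed (rule assms)

text \<open>
The graph of \<open>exp\<close> lies above its tangent at \<open>m\<close>. Integrating this inequality proves Jensen's inequality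
for \<open>exp\<close>; it is used in this form twice below.
\<close>

lemma exp_tangent_le: "exp (m::real) * (1 + (z - m)) \<le> exp z"
proof -
  have "exp m * (1 + (z - m)) \<le> exp m * exp (z - m)"
    using exp_ge_add_one_self[of "z - m"] by (intro mult_left_mono) auto
  then show ?thesis by (simp flip: exp_add)
qed

text \<open>
The standard deviations add because the exponential is convex: \<open>Y + Z\<close> is the convex combination of
\<open>(s + t) Y / s\<close> and \<open>(s + t) Z / t\<close>. The two variables may be dependent.
\<close>

lemma subgauss_add:
  assumes Y: "subgauss M s Y" and Z: "subgauss M t Z" and st: "0 < s" "0 < t"
  shows "subgauss M (s + t) (\<lambda>\<omega>. Y \<omega> + Z \<omega>)"
  unfolding subgauss_def
proof (intro conjI allI)
  note [measurable] = subgauss_measurable[OF Y] subgauss_measurable[OF Z]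
  show "(\<lambda>\<omega>. Y \<omega> + Z \<omega>) \<in> borel_measurable M" by simp
  fix l :: real
  define p q where "p = s / (s + t)" and "q = t / (s + t)"
  have pq: "p > 0" "q > 0" "p + q = 1" using st by (auto simp: p_def q_def add_divide_distrib[symmetric])
  have conv: "exp (l * (y + z)) \<le> p * exp (l / p * y) + q * exp (l / q * z)" for y z
  proof -
    let ?m = "l * (y + z)"
    have "exp ?m * (p * (1 + (l / p * y - ?m)) + q * (1 + (l / q * z - ?m)))
       \<le> p * exp (l / p * y) + q * exp (l / q * z)"
    proof -
      have "p * (exp ?m * (1 + (l / p * y - ?m))) + q * (exp ?m * (1 + (l / q * z - ?m)))
         \<le> p * exp (l / p * y) + q * exp (l / q * z)"
        using pq by (intro add_mono mult_left_mono exp_tangent_le) auto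
      then show ?thesis
        by (subst distrib_left) (simp only: mult.left_commute[of "exp ?m" p] mult.left_commute[of "exp ?m" q])
    qed
    also have "p * (1 + (l / p * y - ?m)) + q * (1 + (l / q * z - ?m)) = (p + q) * (1 - ?m) + ?m"
      using pq(1,2) by (simp add: field_simps)
    also have "\<dots> = 1" using pq(3) by simp
    finally show ?thesis by simp
  qed
  have "(\<integral>\<^sup>+\<omega>. ennreal (exp (l * (Y \<omega> + Z \<omega>))) \<partial>M)
     \<le> (\<integral>\<^sup>+\<omega>. ennreal p * ennreal (exp (l / p * Y \<omega>)) + ennreal q * ennreal (exp (l / q * Z \<omega>)) \<partial>M)"
    using pq conv by (intro nn_integral_mono) (simp flip: ennreal_mult' ennreal_plus add: ennreal_leI)
  also have "\<dots> = ennreal p * (\<integral>\<^sup>+\<omega>. ennreal (exp (l / p * Y \<omega>)) \<partial>M) + ennreal q * (\<integral>\<^sup>+\<omega>. ennreal (exp (l / q * Z \<omega>)) \<partial>M)"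
    by (simp add: nn_integral_add nn_integral_cmult)
  also have "\<dots> \<le> ennreal p * ennreal (exp ((l / p)\<^sup>2 * s\<^sup>2 / 2)) + ennreal q * ennreal (exp ((l / q)\<^sup>2 * t\<^sup>2 / 2))"
    by (intro add_mono mult_left_mono subgaussD Y Z) auto
  also have "(l / p)\<^sup>2 * s\<^sup>2 / 2 = l\<^sup>2 * (s + t)\<^sup>2 / 2"
    using st by (simp add: p_def power_divide power_mult_distrib)
  also have "(l / q)\<^sup>2 * t\<^sup>2 / 2 = l\<^sup>2 * (s + t)\<^sup>2 / 2"
    using st by (simp add: q_def power_divide power_mult_distrib)
  also have "ennreal p * ennreal (exp (l\<^sup>2 * (s + t)\<^sup>2 / 2)) + ennreal q * ennreal (exp (l\<^sup>2 * (s + t)\<^sup>2 / 2))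
     = (ennreal p + ennreal q) * ennreal (exp (l\<^sup>2 * (s + t)\<^sup>2 / 2))"
    by (simp add: distrib_right)
  also have "ennreal p + ennreal q = 1" using pq by (simp flip: ennreal_plus)
  finally show "(\<integral>\<^sup>+\<omega>. ennreal (exp (l * (Y \<omega> + Z \<omega>))) \<partial>M) \<le> ennreal (exp (l\<^sup>2 * (s + t)\<^sup>2 / 2))"
    by simp
qed

text \<open>
Fatou's lemma.
\<close>

lemma subgauss_limit:
  assumes Y: "\<And>J::nat. subgauss M (s J) (Y J)" and s: "s \<longlonglongrightarrow> t"
    and lim: "AE \<omega> in M. (\<lambda>J. Y J \<omega>) \<longlonglongrightarrow> Z \<omega>" and Z: "Z \<in> borel_measurable M"
  shows "subgauss M t Z"
  unfolding subgauss_def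
proof (intro conjI allI)
  note [measurable] = subgauss_measurable[OF Y] Z
  fix l :: real
  have "(\<integral>\<^sup>+\<omega>. ennreal (exp (l * Z \<omega>)) \<partial>M) = (\<integral>\<^sup>+\<omega>. liminf (\<lambda>J. ennreal (exp (l * Y J \<omega>))) \<partial>M)"
  proof (intro nn_integral_cong_AE)
    show "AE \<omega> in M. ennreal (exp (l * Z \<omega>)) = liminf (\<lambda>J. ennreal (exp (l * Y J \<omega>)))"
      using lim
    proof eventually_elim
      case (elim \<omega>)
      then have "(\<lambda>J. ennreal (exp (l * Y J \<omega>))) \<longlonglongrightarrow> ennreal (exp (l * Z \<omega>))"
        by (intro tendsto_ennrealI tendsto_exp tendsto_mult tendsto_const)
      then show ?case by (rule lim_imp_Liminf[OF sequentially_bot, symmetric])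
    qed
  qed
  also have "\<dots> \<le> liminf (\<lambda>J. \<integral>\<^sup>+\<omega>. ennreal (exp (l * Y J \<omega>)) \<partial>M)"
    by (rule nn_integral_liminf) simp
  also have "\<dots> \<le> liminf (\<lambda>J. ennreal (exp (l\<^sup>2 * (s J)\<^sup>2 / 2)))"
    by (intro Liminf_mono always_eventually allI subgaussD Y)
  also have "\<dots> = ennreal (exp (l\<^sup>2 * t\<^sup>2 / 2))"
    by (intro lim_imp_Liminf tendsto_ennrealI tendsto_intros s) simp_all
  finally show "(\<integral>\<^sup>+\<omega>. ennreal (exp (l * Z \<omega>)) \<partial>M) \<le> ennreal (exp (l\<^sup>2 * t\<^sup>2 / 2))" .
qed (rule Z)

lemma (in prob_space) subgauss_tail:
  assumes Y: "subgauss M s Y" and s: "s > 0" and a: "a \<ge> 0"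
  shows "prob {\<omega> \<in> space M. \<bar>Y \<omega>\<bar> > a} \<le> 2 * exp (- a\<^sup>2 / (2 * s\<^sup>2))"
proof -
  have one: "prob {\<omega> \<in> space M. Y \<omega> > a} \<le> exp (- a\<^sup>2 / (2 * s\<^sup>2))" if Y: "subgauss M s Y" for Y
  proof -
    note [measurable] = subgauss_measurable[OF Y]
    define l where "l = a / s\<^sup>2"
    have l: "l \<ge> 0" using a by (simp add: l_def)
    have "emeasure M {\<omega> \<in> space M. Y \<omega> > a} = (\<integral>\<^sup>+\<omega>. indicator {\<omega> \<in> space M. Y \<omega> > a} \<omega> \<partial>M)"
      by simp
    also have "\<dots> \<le> (\<integral>\<^sup>+\<omega>. ennreal (exp (- l * a)) * ennreal (exp (l * Y \<omega>)) \<partial>M)"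
    proof (intro nn_integral_mono)
      fix \<omega> assume "\<omega> \<in> space M"
      show "indicator {\<omega> \<in> space M. Y \<omega> > a} \<omega> \<le> ennreal (exp (- l * a)) * ennreal (exp (l * Y \<omega>))"
      proof (cases "Y \<omega> > a")
        case True
        then have "1 \<le> exp (l * (Y \<omega> - a))" using l by simp
        also have "\<dots> = exp (- l * a) * exp (l * Y \<omega>)" by (simp add: algebra_simps flip: exp_add)
        finally show ?thesis using True \<open>\<omega> \<in> space M\<close>
          by (simp flip: ennreal_mult' ennreal_1 add: ennreal_leI)
      qed simp
    qed
    also have "\<dots> = ennreal (exp (- l * a)) * (\<integral>\<^sup>+\<omega>. ennreal (exp (l * Y \<omega>)) \<partial>M)"
      by (simp add: nn_integral_cmult)
    also have "\<dots> \<le> ennreal (exp (- l * a)) * ennreal (exp (l\<^sup>2 * s\<^sup>2 / 2))"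
      by (intro mult_left_mono subgaussD Y) simp
    also have "\<dots> = ennreal (exp (- l * a) * exp (l\<^sup>2 * s\<^sup>2 / 2))"
      by (simp add: ennreal_mult')
    also have "exp (- l * a) * exp (l\<^sup>2 * s\<^sup>2 / 2) = exp (- a\<^sup>2 / (2 * s\<^sup>2))"
    proof -
      have "- l * a + l\<^sup>2 * s\<^sup>2 / 2 = - a\<^sup>2 / (2 * s\<^sup>2)"
        using s by (simp add: l_def field_simps power2_eq_square)
      then show ?thesis by (simp only: exp_add[symmetric])
    qed
    finally show ?thesis by (simp add: emeasure_eq_measure)
  qed
  note [measurable] = subgauss_measurable[OF Y]
  have "{\<omega> \<in> space M. \<bar>Y \<omega>\<bar> > a} = {\<omega> \<in> space M. Y \<omega> > a} \<union> {\<omega> \<in> space M. - Y \<omega> > a}"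
    by auto
  then have "prob {\<omega> \<in> space M. \<bar>Y \<omega>\<bar> > a} \<le> prob {\<omega> \<in> space M. Y \<omega> > a} + prob {\<omega> \<in> space M. - Y \<omega> > a}"
    by (simp add: measure_Un_le)
  then show ?thesis using one[OF Y] one[OF subgauss_uminus[OF Y]] by simp
qed

text \<open>
The continuous version of \<open>subgauss_add\<close>, by Jensen's inequality for the measure with density \<open>\<sigma> / s\<close>.
Almost sure integrability is part of the conclusion: it follows from Tonelli's theorem because a
sub-Gaussian variable has a first moment of the order of its parameter.
\<close>

lemma (in prob_space) subgauss_mixture:
  assumes N: "sigma_finite_measure N"
    and Ym [measurable]: "(\<lambda>(x, \<omega>). Y x \<omega>) \<in> borel_measurable (N \<Otimes>\<^sub>M M)"
    and int: "integrable N \<sigma>" and pos: "\<And>x. x \<in> space N \<Longrightarrow> 0 < \<sigma> x"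
    and Y: "\<And>x. x \<in> space N \<Longrightarrow> subgauss M (\<sigma> x) (Y x)"
    and le: "(LINT x|N. \<sigma> x) \<le> s" and s: "0 < s"
  shows "AE \<omega> in M. integrable N (\<lambda>x. Y x \<omega>)"
    and "subgauss M s (\<lambda>\<omega>. LINT x|N. Y x \<omega>)"
proof -
  interpret N: sigma_finite_measure N by (rule N)
  interpret NM: pair_sigma_finite N M ..
  note [measurable] = borel_measurable_integrable[OF int]
  have Ysec [measurable]: "Y x \<in> borel_measurable M" if "x \<in> space N" for x
    using subgauss_measurable[OF Y[OF that]] .
  have "(\<integral>\<^sup>+\<omega>. (\<integral>\<^sup>+x. ennreal \<bar>Y x \<omega>\<bar> \<partial>N) \<partial>M) = (\<integral>\<^sup>+x. (\<integral>\<^sup>+\<omega>. ennreal \<bar>Y x \<omega>\<bar> \<partial>M) \<partial>N)"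
    by (rule NM.Fubini') simp
  also have "\<dots> \<le> (\<integral>\<^sup>+x. ennreal (\<sigma> x) * ennreal (2 * exp (1/2)) \<partial>N)"
  proof (intro nn_integral_mono)
    fix x assume x: "x \<in> space N"
    note [measurable] = Ysec[OF x]
    have bound: "\<bar>y\<bar> \<le> \<sigma> x * (exp (1 / \<sigma> x * y) + exp (- 1 / \<sigma> x * y))" for y
    proof -
      have "\<bar>y / \<sigma> x\<bar> \<le> exp (y / \<sigma> x) + exp (- (y / \<sigma> x))"
        using exp_ge_add_one_self[of "y / \<sigma> x"] exp_ge_add_one_self[of "- (y / \<sigma> x)"]
              exp_gt_zero[of "y / \<sigma> x"] exp_gt_zero[of "- (y / \<sigma> x)"] by linarith
      then have "\<sigma> x * \<bar>y / \<sigma> x\<bar> \<le> \<sigma> x * (exp (y / \<sigma> x) + exp (- (y / \<sigma> x)))"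
        using pos[OF x] by (intro mult_left_mono) auto
      then show ?thesis using pos[OF x] by (simp add: abs_divide)
    qed
    have ee: "(\<integral>\<^sup>+\<omega>. ennreal (exp (e / \<sigma> x * Y x \<omega>)) \<partial>M) \<le> ennreal (exp (1/2))" if "e\<^sup>2 = 1" for e
      using subgaussD[OF Y[OF x], of "e / \<sigma> x"] pos[OF x] that by (simp add: power_divide)
    have "(\<integral>\<^sup>+\<omega>. ennreal \<bar>Y x \<omega>\<bar> \<partial>M)
      \<le> (\<integral>\<^sup>+\<omega>. ennreal (\<sigma> x) * (ennreal (exp (1 / \<sigma> x * Y x \<omega>)) + ennreal (exp (- 1 / \<sigma> x * Y x \<omega>))) \<partial>M)"
      using pos[OF x] bound
      by (intro nn_integral_mono) (simp flip: ennreal_mult' ennreal_plus add: ennreal_leI)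
    also have "\<dots> = ennreal (\<sigma> x) * ((\<integral>\<^sup>+\<omega>. ennreal (exp (1 / \<sigma> x * Y x \<omega>)) \<partial>M) + (\<integral>\<^sup>+\<omega>. ennreal (exp (- 1 / \<sigma> x * Y x \<omega>)) \<partial>M))"
      by (simp add: nn_integral_cmult nn_integral_add)
    also have "\<dots> \<le> ennreal (\<sigma> x) * (ennreal (exp (1/2)) + ennreal (exp (1/2)))"
      by (intro mult_left_mono add_mono ee) auto
    also have "ennreal (exp (1/2)) + ennreal (exp (1/2)) = ennreal (2 * exp (1/2))"
      by (simp flip: ennreal_plus)
    finally show "(\<integral>\<^sup>+\<omega>. ennreal \<bar>Y x \<omega>\<bar> \<partial>M) \<le> ennreal (\<sigma> x) * ennreal (2 * exp (1/2))" .
  qed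
  also have "\<dots> = (\<integral>\<^sup>+x. ennreal (\<sigma> x) \<partial>N) * ennreal (2 * exp (1/2))"
    by (simp add: nn_integral_multc)
  also have "(\<integral>\<^sup>+x. ennreal (\<sigma> x) \<partial>N) = ennreal (LINT x|N. \<sigma> x)"
    using pos by (intro nn_integral_eq_integral int AE_I2) (auto intro: less_imp_le)
  also have "ennreal (LINT x|N. \<sigma> x) * ennreal (2 * exp (1/2)) < \<infinity>"
    by (simp add: ennreal_mult_less_top)
  finally have "(\<integral>\<^sup>+\<omega>. (\<integral>\<^sup>+x. ennreal \<bar>Y x \<omega>\<bar> \<partial>N) \<partial>M) \<noteq> \<infinity>" by simp
  then have "AE \<omega> in M. (\<integral>\<^sup>+x. ennreal \<bar>Y x \<omega>\<bar> \<partial>N) \<noteq> \<infinity>"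
    by (intro nn_integral_PInf_AE) simp_all
  then show AEi: "AE \<omega> in M. integrable N (\<lambda>x. Y x \<omega>)"
    using AE_space
  proof eventually_elim
    case (elim \<omega>)
    note [measurable] = elim(2)
    show ?case
      by (rule integrableI_bounded) (use elim(1) in \<open>auto simp: less_top\<close>)
  qed
  have Im [measurable]: "(\<lambda>\<omega>. LINT x|N. Y x \<omega>) \<in> borel_measurable M"
    by (rule N.borel_measurable_lebesgue_integral) simp
  define s' where "s' = (LINT x|N. \<sigma> x)"
  have "s' \<ge> 0" unfolding s'_def using pos by (intro integral_nonneg_AE AE_I2) (auto intro: less_imp_le)
  have "subgauss M s' (\<lambda>\<omega>. LINT x|N. Y x \<omega>)"
  proof (cases "s' = 0")
    case True
    have "AE x in N. \<sigma> x = 0"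
      using True pos unfolding s'_def
      by (subst (asm) integral_nonneg_eq_0_iff_AE[OF int]) (auto intro!: AE_I2 less_imp_le)
    then have F: "AE x in N. False"
      using AE_space by eventually_elim (use pos in force)
    have "(LINT x|N. Y x \<omega>) = 0" for \<omega>
      by (intro integral_eq_zero_AE) (use F in auto)
    then show ?thesis by (simp add: subgauss_def True emeasure_space_1)
  next
    case False
    with \<open>s' \<ge> 0\<close> have s': "s' > 0" by simp
    show ?thesis unfolding subgauss_def
    proof (intro conjI allI)
      fix l :: real
      have "(\<integral>\<^sup>+\<omega>. ennreal (exp (l * (LINT x|N. Y x \<omega>))) \<partial>M)
         \<le> (\<integral>\<^sup>+\<omega>. (\<integral>\<^sup>+x. ennreal (\<sigma> x / s' * exp (l * s' / \<sigma> x * Y x \<omega>)) \<partial>N) \<partial>M)"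
      proof (intro nn_integral_mono_AE)
        show "AE \<omega> in M. ennreal (exp (l * (LINT x|N. Y x \<omega>)))
           \<le> (\<integral>\<^sup>+x. ennreal (\<sigma> x / s' * exp (l * s' / \<sigma> x * Y x \<omega>)) \<partial>N)"
          using AEi
        proof (eventually_elim)
          case (elim \<omega>)
          define m where "m = l * (LINT x|N. Y x \<omega>)"
          define g where "g x = exp m * (\<sigma> x / s' * (1 - m) + l * Y x \<omega>)" for x
          have gi: "integrable N g" unfolding g_def using elim int by simp
          have "(LINT x|N. g x) = exp m * ((LINT x|N. \<sigma> x) / s' * (1 - m) + l * (LINT x|N. Y x \<omega>))"
            unfolding g_def using elim int by simp
          also have "\<dots> = exp m" using s' by (simp add: s'_def[symmetric] m_def)
          finally have "ennreal (exp m) = ennreal (LINT x|N. g x)" by simp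
          also have "\<dots> \<le> ennreal (LINT x|N. max 0 (g x))"
            using gi by (intro ennreal_leI integral_mono) auto
          also have "\<dots> = (\<integral>\<^sup>+x. ennreal (max 0 (g x)) \<partial>N)"
            using gi by (subst nn_integral_eq_integral) auto
          also have "\<dots> \<le> (\<integral>\<^sup>+x. ennreal (\<sigma> x / s' * exp (l * s' / \<sigma> x * Y x \<omega>)) \<partial>N)"
          proof (intro nn_integral_mono ennreal_leI)
            fix x assume x: "x \<in> space N"
            have "\<sigma> x / s' * (exp m * (1 + (l * s' / \<sigma> x * Y x \<omega> - m))) \<le> \<sigma> x / s' * exp (l * s' / \<sigma> x * Y x \<omega>)"
              using pos[OF x] s' by (intro mult_left_mono exp_tangent_le) auto
            also have "\<sigma> x / s' * (exp m * (1 + (l * s' / \<sigma> x * Y x \<omega> - m))) = g x"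
              using pos[OF x] s' by (simp add: g_def field_simps)
            finally show "max 0 (g x) \<le> \<sigma> x / s' * exp (l * s' / \<sigma> x * Y x \<omega>)"
              using pos[OF x] s' by simp
          qed
          finally show ?case unfolding m_def .
        qed
      qed
      also have "\<dots> = (\<integral>\<^sup>+x. (\<integral>\<^sup>+\<omega>. ennreal (\<sigma> x / s' * exp (l * s' / \<sigma> x * Y x \<omega>)) \<partial>M) \<partial>N)"
        by (rule NM.Fubini') simp
      also have "\<dots> \<le> (\<integral>\<^sup>+x. ennreal (\<sigma> x / s') * ennreal (exp (l\<^sup>2 * s'\<^sup>2 / 2)) \<partial>N)"
      proof (intro nn_integral_mono)
        fix x assume x: "x \<in> space N"
        note [measurable] = Ysec[OF x]
        have "(\<integral>\<^sup>+\<omega>. ennreal (\<sigma> x / s' * exp (l * s' / \<sigma> x * Y x \<omega>)) \<partial>M)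
           = ennreal (\<sigma> x / s') * (\<integral>\<^sup>+\<omega>. ennreal (exp (l * s' / \<sigma> x * Y x \<omega>)) \<partial>M)"
        proof -
          have nn: "0 \<le> \<sigma> x / s'" using pos[OF x] s' by simp
          show ?thesis unfolding ennreal_mult'[OF nn] by (rule nn_integral_cmult) simp
        qed
        also have "\<dots> \<le> ennreal (\<sigma> x / s') * ennreal (exp ((l * s' / \<sigma> x)\<^sup>2 * (\<sigma> x)\<^sup>2 / 2))"
          by (intro mult_left_mono subgaussD Y x) simp
        also have "(l * s' / \<sigma> x)\<^sup>2 * (\<sigma> x)\<^sup>2 / 2 = l\<^sup>2 * s'\<^sup>2 / 2"
          using pos[OF x] by (simp add: power_divide power_mult_distrib)
        finally show "(\<integral>\<^sup>+\<omega>. ennreal (\<sigma> x / s' * exp (l * s' / \<sigma> x * Y x \<omega>)) \<partial>M)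
           \<le> ennreal (\<sigma> x / s') * ennreal (exp (l\<^sup>2 * s'\<^sup>2 / 2))" .
      qed
      also have "\<dots> = (\<integral>\<^sup>+x. ennreal (\<sigma> x / s') \<partial>N) * ennreal (exp (l\<^sup>2 * s'\<^sup>2 / 2))"
        by (simp add: nn_integral_multc)
      also have "(\<integral>\<^sup>+x. ennreal (\<sigma> x / s') \<partial>N) = ennreal (LINT x|N. \<sigma> x / s')"
        using pos s' int by (intro nn_integral_eq_integral AE_I2) (auto intro: less_imp_le divide_nonneg_pos)
      also have "(LINT x|N. \<sigma> x / s') = 1" using s' by (simp add: s'_def)
      finally show "(\<integral>\<^sup>+\<omega>. ennreal (exp (l * (LINT x|N. Y x \<omega>))) \<partial>M) \<le> ennreal (exp (l\<^sup>2 * s'\<^sup>2 / 2))"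
        by simp
    qed (rule Im)
  qed
  then show "subgauss M s (\<lambda>\<omega>. LINT x|N. Y x \<omega>)"
    by (rule subgauss_mono) (use \<open>s' \<ge> 0\<close> le in \<open>auto simp: s'_def\<close>)
qed

section \<open>Linear functionals of a path with Gaussian increments\<close>

lemma one_minus_exp_ge:
  fixes c :: real assumes "0 < c" "c \<le> 1"
  shows "c / 2 \<le> 1 - exp (- c)"
proof -
  have "exp (- c) \<le> 1 / (1 + c)"
    using exp_ge_add_one_self[of c] assms by (simp add: exp_minus divide_inverse le_imp_inverse_le)
  moreover have "1 / (1 + c) = 1 - c / (1 + c)" using assms by (simp add: field_simps)
  moreover have "c / 2 \<le> c / (1 + c)" using assms by (intro divide_left_mono) auto
  ultimately show ?thesis by linarith
qed

text \<open>
The sum is split at \<open>a\<close>; each half is a geometric series, bounded by induction on the number of terms.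
What matters is that the bound does not depend on \<open>a\<close> or \<open>J\<close>.
\<close>

lemma sum_exp_dist_le:
  fixes c a :: real assumes c: "0 < c" "c \<le> 1"
  shows "(\<Sum>j<J. exp (- c * \<bar>real j - a\<bar>)) \<le> 5 / c"
proof -
  define K where "K = 1 / (1 - exp (- c))"
  have e1: "0 < 1 - exp (- c)" using c by simp
  have K0: "K > 0" using e1 by (simp add: K_def)
  have K1: "K * exp (- c) + 1 = K" using e1 by (simp add: K_def field_simps)
  have K2: "K + 1 \<le> K * exp c"
  proof -
    have "K + 1 \<le> K + exp c" using c by simp
    also have "\<dots> = (K * exp (- c) + 1) * exp c" by (simp add: distrib_right mult.assoc flip: exp_add)
    finally show ?thesis by (simp only: K1)
  qed
  define f where "f j = (if real j \<ge> a then exp (- c * (real j - a)) else 0)" for j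
  define g where "g j = (if real j < a then exp (- c * (a - real j)) else 0)" for j
  have fg: "exp (- c * \<bar>real j - a\<bar>) = f j + g j" for j
    by (auto simp: f_def g_def)
  have F: "(\<Sum>j<J. f j) \<le> (if real J \<ge> a then K - K * exp (- c * (real J - a)) else 0)"
  proof (induction J)
    case 0
    show ?case using c K0 by (auto simp: mult_le_0_iff)
  next
    case (Suc J)
    consider "real J \<ge> a" | "real J < a" "real (Suc J) \<ge> a" | "real (Suc J) < a" by linarith
    then show ?case
    proof cases
      case 1
      have e: "exp (- c * (real (Suc J) - a)) = exp (- c * (real J - a)) * exp (- c)"
        by (simp add: algebra_simps flip: exp_add)
      have "(\<Sum>j<Suc J. f j) \<le> K - K * exp (- c * (real J - a)) + exp (- c * (real J - a))"
        using Suc 1 by (simp add: f_def)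
      also have "\<dots> = K - exp (- c * (real J - a)) * ((K * exp (- c) + 1) - 1)"
        unfolding K1 by (simp add: algebra_simps)
      finally show ?thesis using 1 unfolding e by (simp add: algebra_simps)
    next
      case 2
      have "K * exp (- c * (real (Suc J) - a)) \<le> K * 1" using 2 c K0 by (intro mult_left_mono) auto
      then show ?thesis using Suc 2 by (simp add: f_def)
    next
      case 3
      then show ?thesis using Suc by (simp add: f_def)
    qed
  qed
  have "(\<Sum>j<J. f j) \<le> K" using F K0 by (auto intro: order_trans split: if_splits)
  moreover have G: "(\<Sum>j<J. g j) \<le> (if real J \<le> a then K * exp (- c * (a - real J)) else K + 1)"
  proof (induction J)
    case 0
    show ?case using K0 by simp
  next
    case (Suc J)
    consider "real (Suc J) \<le> a" | "real J \<le> a" "real (Suc J) > a" | "real J > a" by linarith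
    then show ?case
    proof cases
      case 1
      have e: "exp (- c * (a - real (Suc J))) = exp (- c * (a - real J)) * exp c"
        by (simp add: algebra_simps flip: exp_add)
      have "(\<Sum>j<Suc J. g j) \<le> exp (- c * (a - real J)) * (K + 1)"
        using Suc 1 by (simp add: g_def algebra_simps)
      also have "\<dots> \<le> exp (- c * (a - real J)) * (K * exp c)"
        by (intro mult_left_mono K2) auto
      finally show ?thesis using 1 unfolding e by (simp add: algebra_simps)
    next
      case 2
      have "K * exp (- c * (a - real J)) \<le> K * 1" using 2 c K0 by (intro mult_left_mono) auto
      moreover have "g J \<le> 1" using c by (auto simp: g_def)
      ultimately show ?thesis using Suc 2 by simp
    next
      case 3
      then show ?thesis using Suc by (simp add: g_def)
    qed
  qed
  have "(\<Sum>j<J. g j) \<le> K + 1"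
  proof (cases "real J \<le> a")
    case True
    have "K * exp (- c * (a - real J)) \<le> K * 1" using True c K0 by (intro mult_left_mono) auto
    then show ?thesis using G True by simp
  qed (use G in auto)
  moreover have "2 * K + 1 \<le> 5 / c"
  proof -
    have "K \<le> 1 / (c / 2)" unfolding K_def using one_minus_exp_ge[OF c] c e1 by (intro divide_left_mono) auto
    moreover have "1 \<le> 1 / c" using c by simp
    ultimately show ?thesis by simp
  qed
  ultimately show ?thesis unfolding fg by (simp add: sum.distrib)
qed

lemma exp_dist_integral:
  fixes c a :: real assumes c: "0 < c"
  shows "integrable lborel (\<lambda>u. exp (- c * \<bar>u - a\<bar>))"
    and "(LINT u|lborel. exp (- c * \<bar>u - a\<bar>)) \<le> 2 / c"
proof -
  have half: "(\<integral>\<^sup>+u. ennreal (exp (- c * u)) * indicator {0..} u \<partial>lborel) = ennreal (1 / c)"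
  proof -
    have "(\<integral>\<^sup>+u. ennreal (exp (- c * u)) * indicator {0..} u \<partial>lborel) = ennreal (0 - (- exp (- c * 0) / c))"
    proof (rule nn_integral_FTC_atLeast)
      show "((\<lambda>u. - exp (- c * u) / c) \<longlongrightarrow> 0) at_top"
        using c by real_asymp
      show "((\<lambda>u. - exp (- c * u) / c) has_real_derivative exp (- c * u)) (at u)" if "0 \<le> u" for u
        using c by (auto intro!: derivative_eq_intros)
    qed auto
    then show ?thesis by simp
  qed
  have "(\<integral>\<^sup>+u. ennreal (exp (- c * \<bar>u - a\<bar>)) \<partial>lborel) = (\<integral>\<^sup>+u. ennreal (exp (- c * \<bar>u\<bar>)) \<partial>lborel)"
    by (subst nn_integral_real_affine[where c = 1 and t = a]) auto
  also have "\<dots> \<le> (\<integral>\<^sup>+u. ennreal (exp (- c * u)) * indicator {0..} u + ennreal (exp (- c * (- u))) * indicator {0..} (- u) \<partial>lborel)"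
    by (intro nn_integral_mono) (auto simp: indicator_def)
  also have "\<dots> = (\<integral>\<^sup>+u. ennreal (exp (- c * u)) * indicator {0..} u \<partial>lborel) + (\<integral>\<^sup>+u. ennreal (exp (- c * (- u))) * indicator {0..} (- u) \<partial>lborel)"
    by (rule nn_integral_add) auto
  also have "(\<integral>\<^sup>+u. ennreal (exp (- c * (- u))) * indicator {0..} (- u) \<partial>lborel) = (\<integral>\<^sup>+u. ennreal (exp (- c * u)) * indicator {0..} u \<partial>lborel)"
    by (subst nn_integral_real_affine[where c = "-1" and t = 0]) auto
  also have "(\<integral>\<^sup>+u. ennreal (exp (- c * u)) * indicator {0..} u \<partial>lborel) + (\<integral>\<^sup>+u. ennreal (exp (- c * u)) * indicator {0..} u \<partial>lborel) = ennreal (2 / c)"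
    unfolding half using c by (simp flip: ennreal_plus)
  finally have nn: "(\<integral>\<^sup>+u. ennreal (exp (- c * \<bar>u - a\<bar>)) \<partial>lborel) \<le> ennreal (2 / c)" .
  show int: "integrable lborel (\<lambda>u. exp (- c * \<bar>u - a\<bar>))"
    by (rule integrableI_bounded) (use nn in \<open>auto intro: le_less_trans\<close>)
  have "ennreal (LINT u|lborel. exp (- c * \<bar>u - a\<bar>)) = (\<integral>\<^sup>+u. ennreal (exp (- c * \<bar>u - a\<bar>)) \<partial>lborel)"
    by (rule nn_integral_eq_integral[symmetric, OF int]) simp
  then have "ennreal (LINT u|lborel. exp (- c * \<bar>u - a\<bar>)) \<le> ennreal (2 / c)"
    using nn by (simp only:)
  then show "(LINT u|lborel. exp (- c * \<bar>u - a\<bar>)) \<le> 2 / c"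
    using c by (subst (asm) ennreal_le_iff) auto
qed

lemma exp_dist_sqrt_le:
  fixes c v :: real assumes c: "0 < c" "c \<le> 1" and v: "0 \<le> v"
  shows "exp (- c * v) * sqrt (v + 1) \<le> 1 / sqrt c * exp (- (c / 2) * v)"
proof -
  have "c * (v + 1) \<le> exp (c * v)"
  proof -
    have "c * (v + 1) = c * v + c" by (simp add: algebra_simps)
    then show ?thesis using exp_ge_add_one_self[of "c * v"] c by linarith
  qed
  then have "sqrt c * sqrt (v + 1) \<le> sqrt (exp (c * v))"
    by (simp flip: real_sqrt_mult)
  also have "sqrt (exp (c * v)) = exp (c * v / 2)"
    by (rule real_sqrt_unique) (simp_all add: power2_eq_square flip: exp_add)
  finally have "exp (- c * v) * (sqrt c * sqrt (v + 1)) \<le> exp (- c * v) * exp (c * v / 2)"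
    by (intro mult_left_mono) auto
  also have "\<dots> = exp (- (c / 2) * v)" by (simp add: algebra_simps flip: exp_add)
  finally show ?thesis using c by (simp add: field_simps)
qed

text \<open>
A real-valued process that vanishes up to time 0, whose paths are all continuous and whose increments
have, jointly, moment generating functions bounded by those of independent normal variables. A
coordinate of Brownian motion is such a process after modification on a null set.
\<close>

locale gaussian_path = prob_space M for M :: "'w measure" +
  fixes b :: "real \<Rightarrow> 'w \<Rightarrow> real"
  assumes b_measurable: "b t \<in> borel_measurable M"
    and b_nonpos: "t \<le> 0 \<Longrightarrow> b t \<omega> = 0"
    and b_continuous: "continuous_on UNIV (\<lambda>t. b t \<omega>)"
    and b_increments: "\<lbrakk>0 \<le> \<tau> 0; \<And>i. i < m \<Longrightarrow> \<tau> i \<le> \<tau> (Suc i)\<rbrakk> \<Longrightarrow>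
      (\<integral>\<^sup>+\<omega>. ennreal (exp (\<Sum>i<m. c i * (b (\<tau> (Suc i)) \<omega> - b (\<tau> i) \<omega>))) \<partial>M)
        \<le> ennreal (exp ((\<Sum>i<m. (c i)\<^sup>2 * (\<tau> (Suc i) - \<tau> i)) / 2))"
begin

lemma b_measurable_path [measurable]: "(\<lambda>t. b t \<omega>) \<in> borel_measurable borel"
  by (rule borel_measurable_continuous_onI) (rule b_continuous)

text \<open>
A continuous process is the limit of its step function approximations, each of which is jointly
measurable.
\<close>

lemma b_joint_measurable: "(\<lambda>(t, \<omega>). b t \<omega>) \<in> borel_measurable (lborel \<Otimes>\<^sub>M M)"
proof (rule borel_measurable_LIMSEQ_real)
  fix N :: nat
  note [measurable] = b_measurable
  have "(\<lambda>p. (\<lambda>j::int. \<lambda>p. b (real_of_int j / real (Suc N)) (snd p)) \<lfloor>fst p * real (Suc N)\<rfloor> p) \<in> borel_measurable (lborel \<Otimes>\<^sub>M M)"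
    by (rule measurable_compose_countable) measurable
  then show "(\<lambda>p. b (real_of_int \<lfloor>fst p * real (Suc N)\<rfloor> / real (Suc N)) (snd p)) \<in> borel_measurable (lborel \<Otimes>\<^sub>M M)"
    by simp
next
  fix p :: "real \<times> 'w" assume "p \<in> space (lborel \<Otimes>\<^sub>M M)"
  have "(\<lambda>N. real_of_int \<lfloor>fst p * real (Suc N)\<rfloor> / real (Suc N)) \<longlonglongrightarrow> fst p"
    by real_asymp
  then have "(\<lambda>N. b (real_of_int \<lfloor>fst p * real (Suc N)\<rfloor> / real (Suc N)) (snd p)) \<longlonglongrightarrow> b (fst p) (snd p)"
    by (rule continuous_on_tendsto_compose[OF b_continuous]) auto
  then show "(\<lambda>N. b (real_of_int \<lfloor>fst p * real (Suc N)\<rfloor> / real (Suc N)) (snd p)) \<longlonglongrightarrow> (case p of (t, \<omega>) \<Rightarrow> b t \<omega>)"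
    by (simp add: case_prod_beta)
qed

lemma b_measurable_pair [measurable (raw)]:
  assumes "f \<in> borel_measurable K" "g \<in> measurable K M"
  shows "(\<lambda>x. b (f x) (g x)) \<in> borel_measurable K"
proof -
  have "(\<lambda>x. (f x, g x)) \<in> K \<rightarrow>\<^sub>M lborel \<Otimes>\<^sub>M M" using assms by simp
  from measurable_compose[OF this b_joint_measurable] show ?thesis by simp
qed

lemma subgauss_increments:
  assumes "0 \<le> \<tau> 0" "\<And>i. i < m \<Longrightarrow> \<tau> i \<le> \<tau> (Suc i)"
  shows "subgauss M (sqrt (\<Sum>i<m. (c i)\<^sup>2 * (\<tau> (Suc i) - \<tau> i)))
           (\<lambda>\<omega>. \<Sum>i<m. c i * (b (\<tau> (Suc i)) \<omega> - b (\<tau> i) \<omega>))"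
  unfolding subgauss_def
proof (intro conjI allI)
  fix l
  have nn: "0 \<le> (\<Sum>i<m. (c i)\<^sup>2 * (\<tau> (Suc i) - \<tau> i))"
    using assms by (intro sum_nonneg mult_nonneg_nonneg) auto
  have "(\<integral>\<^sup>+\<omega>. ennreal (exp (\<Sum>i<m. (l * c i) * (b (\<tau> (Suc i)) \<omega> - b (\<tau> i) \<omega>))) \<partial>M)
     \<le> ennreal (exp ((\<Sum>i<m. (l * c i)\<^sup>2 * (\<tau> (Suc i) - \<tau> i)) / 2))"
    by (rule b_increments) (use assms in auto)
  then show "(\<integral>\<^sup>+\<omega>. ennreal (exp (l * (\<Sum>i<m. c i * (b (\<tau> (Suc i)) \<omega> - b (\<tau> i) \<omega>)))) \<partial>M)
     \<le> ennreal (exp (l\<^sup>2 * (sqrt (\<Sum>i<m. (c i)\<^sup>2 * (\<tau> (Suc i) - \<tau> i)))\<^sup>2 / 2))"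
    using nn by (simp add: sum_distrib_left mult.assoc power_mult_distrib)
qed measurable

lemma subgauss_increment: "subgauss M (sqrt \<bar>t - u\<bar>) (\<lambda>\<omega>. b t \<omega> - b u \<omega>)"
proof -
  have *: "subgauss M (sqrt \<bar>t - u\<bar>) (\<lambda>\<omega>. b t \<omega> - b u \<omega>)" if "u \<le> t" for t u
  proof -
    define \<tau> where "\<tau> i = (if i = 0 then max u 0 else max t 0)" for i :: nat
    have bt: "b (max r 0) \<omega> = b r \<omega>" for r \<omega>
      using b_nonpos[of r \<omega>] b_nonpos[of 0 \<omega>] by (simp add: max_def)
    have "subgauss M (sqrt (\<Sum>i<1. 1\<^sup>2 * (\<tau> (Suc i) - \<tau> i))) (\<lambda>\<omega>. \<Sum>i<1. 1 * (b (\<tau> (Suc i)) \<omega> - b (\<tau> i) \<omega>))"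
      by (rule subgauss_increments) (use that in \<open>auto simp: \<tau>_def\<close>)
    then have "subgauss M (sqrt (max t 0 - max u 0)) (\<lambda>\<omega>. b t \<omega> - b u \<omega>)"
      by (simp add: \<tau>_def bt)
    then show ?thesis by (rule subgauss_mono) (use that in auto)
  qed
  show ?thesis
  proof (cases "u \<le> t")
    case False
    then show ?thesis using subgauss_uminus[OF *[of t u]] by (simp add: abs_minus_commute)
  qed (rule *)
qed

text \<open>
The triangle inequality in the form of \<open>subgauss_mixture\<close>: each displacement \<open>b (f u) - b a\<close> has standard deviation at most
\<open>sqrt (\<bar>u - a\<bar> + 1)\<close>, and these are integrated against the kernel. For \<open>c\<close> of order \<open>k\<^sup>-\<^sup>1\<^sup>/\<^sup>2\<close> and \<open>B\<close>
of order \<open>1 / k\<close> the result is of order \<open>k\<^sup>-\<^sup>1\<^sup>/\<^sup>4\<close>.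
\<close>

lemma subgauss_displacement:
  assumes P [measurable]: "P \<in> borel_measurable borel" and PB: "\<And>u. \<bar>P u\<bar> \<le> B * exp (- c * \<bar>u - a\<bar>)"
    and f [measurable]: "f \<in> borel_measurable borel" and fu: "\<And>u. \<bar>f u - a\<bar> \<le> \<bar>u - a\<bar> + 1"
    and c: "0 < c" "c \<le> 1" and B: "0 < B"
  shows "AE \<omega> in M. integrable lborel (\<lambda>u. P u * (b (f u) \<omega> - b a \<omega>))"
    and "subgauss M (4 * B / (c * sqrt c)) (\<lambda>\<omega>. LINT u|lborel. P u * (b (f u) \<omega> - b a \<omega>))"
proof -
  \<comment> \<open>Half of the decay of the kernel absorbs the growth of the displacement.\<close>
  define s where "s u = B / sqrt c * exp (- (c / 2) * \<bar>u - a\<bar>)" for u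
  have s1: "integrable lborel s" unfolding s_def using exp_dist_integral(1)[of "c / 2" a] c by simp
  have s2: "(LINT u|lborel. s u) \<le> 4 * B / (c * sqrt c)"
  proof -
    have "(LINT u|lborel. s u) = B / sqrt c * (LINT u|lborel. exp (- (c / 2) * \<bar>u - a\<bar>))"
      unfolding s_def by simp
    also have "\<dots> \<le> B / sqrt c * (2 / (c / 2))"
      using B c by (intro mult_left_mono exp_dist_integral) auto
    finally show ?thesis by (simp add: mult_ac)
  qed
  have s3: "subgauss M (s u) (\<lambda>\<omega>. P u * (b (f u) \<omega> - b a \<omega>))" for u
  proof (rule subgauss_mono[OF subgauss_scale[OF subgauss_increment]])
    have "\<bar>P u * sqrt \<bar>f u - a\<bar>\<bar> = \<bar>P u\<bar> * sqrt \<bar>f u - a\<bar>" by (simp add: abs_mult)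
    also have "\<dots> \<le> (B * exp (- c * \<bar>u - a\<bar>)) * sqrt (\<bar>u - a\<bar> + 1)"
      using fu[of u] B by (intro mult_mono PB) auto
    also have "\<dots> = B * (exp (- c * \<bar>u - a\<bar>) * sqrt (\<bar>u - a\<bar> + 1))" by simp
    also have "\<dots> \<le> B * (1 / sqrt c * exp (- (c / 2) * \<bar>u - a\<bar>))"
      using B c by (intro mult_left_mono exp_dist_sqrt_le) auto
    finally show "\<bar>P u * sqrt \<bar>f u - a\<bar>\<bar> \<le> s u" by (simp add: s_def)
  qed
  have s0: "0 < s u" for u using B c by (simp add: s_def)
  have t: "0 < 4 * B / (c * sqrt c)" using B c by simp
  have "(\<lambda>(u, \<omega>). P u * (b (f u) \<omega> - b a \<omega>)) \<in> borel_measurable (lborel \<Otimes>\<^sub>M M)" by measurable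
  note mix = subgauss_mixture[OF lborel.sigma_finite_measure_axioms this s1 s0 s3 s2 t]
  show "AE \<omega> in M. integrable lborel (\<lambda>u. P u * (b (f u) \<omega> - b a \<omega>))"
    and "subgauss M (4 * B / (c * sqrt c)) (\<lambda>\<omega>. LINT u|lborel. P u * (b (f u) \<omega> - b a \<omega>))"
    by (rule mix)+
qed

text \<open>
This is what makes the smooth approximation meaningful: Brownian paths grow slowly enough to be
integrated against exponentially decaying kernels.
\<close>

lemma AE_integrable_exp_weight:
  assumes "0 < c" "c \<le> 1"
  shows "AE \<omega> in M. integrable lborel (\<lambda>u. exp (- c * \<bar>u\<bar>) * b u \<omega>)"
proof -
  have "AE \<omega> in M. integrable lborel (\<lambda>u. exp (- c * \<bar>u\<bar>) * (b u \<omega> - b 0 \<omega>))"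
    by (rule subgauss_displacement(1)[where B = 1 and c = c]) (use assms in auto)
  then show ?thesis by (simp add: b_nonpos)
qed

end

text \<open>
Sums over the lattice become integrals of functions of \<open>\<lceil>u\<rceil>\<close>, so that they can be compared with the
integral that defines the smooth approximation.
\<close>

lemma has_bochner_integral_ceiling_step:
  fixes p :: "int \<Rightarrow> real"
  shows "has_bochner_integral lborel (\<lambda>u. indicator {0<..real J} u * p \<lceil>u\<rceil>) (\<Sum>j<J. p (int (Suc j)))"
proof (induction J)
  case 0
  then show ?case by (simp add: has_bochner_integral_zero)
next
  case (Suc J)
  have "has_bochner_integral lborel (\<lambda>u. indicator {real J<..real (Suc J)} u *\<^sub>R p (int (Suc J)))
     (measure lborel {real J<..real (Suc J)} *\<^sub>R p (int (Suc J)))"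
    by (rule has_bochner_integral_indicator) auto
  then have "has_bochner_integral lborel (\<lambda>u. indicator {real J<..real (Suc J)} u * p (int (Suc J))) (p (int (Suc J)))"
    by simp
  from has_bochner_integral_add[OF Suc this]
  have "has_bochner_integral lborel (\<lambda>u. indicator {0<..real J} u * p \<lceil>u\<rceil> + indicator {real J<..real (Suc J)} u * p (int (Suc J)))
      (\<Sum>j<Suc J. p (int (Suc j)))" by simp
  moreover have "indicator {0<..real J} u * p \<lceil>u\<rceil> + indicator {real J<..real (Suc J)} u * p (int (Suc J))
      = indicator {0<..real (Suc J)} u * p \<lceil>u\<rceil>" for u
  proof -
    have "\<lceil>u\<rceil> = int (Suc J)" if "real J < u" "u \<le> real (Suc J)"
      using that by (simp add: ceiling_eq_iff)
    then show ?thesis by (auto simp: indicator_def)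
  qed
  ultimately show ?case by simp
qed

text \<open>
Integrating over a sequence of unit cells amounts to averaging, over the position inside the cell, the
sum over all cells.
\<close>

lemma integral_over_cells:
  fixes g :: "real \<Rightarrow> real"
  assumes g: "integrable lborel g"
  shows "(LINT x|lborel. indicator {0..<1} x * (\<Sum>j<J. g (real (Suc j) - x)))
       = (LINT u|lborel. indicator {0<..real J} u * g u)"
proof -
  define F where "F j u = indicator {real j<..real (Suc j)} u * g u" for j u
  have F: "integrable lborel (F j)" for j
    unfolding F_def using integrable_mult_indicator[OF _ g, of "{real j<..real (Suc j)}"] by simp
  have Fx: "F j (real (Suc j) + (-1) * x) = indicator {0..<1} x * g (real (Suc j) - x)" for j x
    by (auto simp: F_def indicator_def)
  have i: "integrable lborel (\<lambda>x. indicator {0..<1} x * g (real (Suc j) - x))" for j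
    using lborel_integrable_real_affine[OF F[of j], of "-1" "real (Suc j)"] unfolding Fx by simp
  have e: "(LINT x|lborel. indicator {0..<1} x * g (real (Suc j) - x)) = (LINT u|lborel. F j u)" for j
    using lborel_integral_real_affine[of "-1" "F j" "real (Suc j)"] unfolding Fx by simp
  have "(LINT x|lborel. indicator {0..<1} x * (\<Sum>j<J. g (real (Suc j) - x))) = (\<Sum>j<J. LINT u|lborel. F j u)"
    unfolding sum_distrib_left by (subst Bochner_Integration.integral_sum[OF i]) (simp only: e)
  also have "\<dots> = (LINT u|lborel. (\<Sum>j<J. F j u))"
    by (rule Bochner_Integration.integral_sum[OF F, symmetric])
  also have "(\<lambda>u. (\<Sum>j<J. F j u)) = (\<lambda>u. indicator {0<..real J} u * g u)"
  proof
    fix u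
    have "(\<Sum>j<J. indicator {real j<..real (Suc j)} u) = (indicator {0<..real J} u :: real)"
      by (induction J) (auto simp: indicator_def)
    then show "(\<Sum>j<J. F j u) = indicator {0<..real J} u * g u"
      by (simp add: F_def flip: sum_distrib_right)
  qed
  finally show ?thesis .
qed

lemma LINT_truncated_tendsto:
  fixes g :: "real \<Rightarrow> real"
  assumes g: "integrable lborel g" and "\<And>u. u \<le> 0 \<Longrightarrow> g u = 0"
  shows "(\<lambda>J. LINT u|lborel. indicator {0<..real J} u * g u) \<longlonglongrightarrow> (LINT u|lborel. g u)"
proof (rule integral_dominated_convergence[where w = "\<lambda>u. \<bar>g u\<bar>"])
  show "AE u in lborel. (\<lambda>J. indicator {0<..real J} u * g u) \<longlonglongrightarrow> g u"
  proof (rule AE_I2, rule tendsto_eventually)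
    fix u :: real
    obtain J0 :: nat where J0: "u \<le> real J0" using real_arch_simple by blast
    show "\<forall>\<^sub>F J in sequentially. indicator {0<..real J} u * g u = g u"
      using J0 assms(2)[of u] by (intro eventually_sequentiallyI[of J0]) (auto simp: indicator_def)
  qed
  show "AE u in lborel. norm (indicator {0<..real J} u * g u) \<le> \<bar>g u\<bar>" for J
    by (auto simp: indicator_def)
qed (use g in auto)

lemma sqrt_sum_squares_le:
  fixes d :: "nat \<Rightarrow> real"
  assumes "\<And>j. (d j)\<^sup>2 \<le> (B * exp (- c * \<bar>real j - a\<bar>))\<^sup>2" "0 < c" "c \<le> 1" "0 < B"
  shows "sqrt (\<Sum>j<J. (d j)\<^sup>2) \<le> 3 * B / sqrt c"
proof -
  have "(\<Sum>j<J. (d j)\<^sup>2) \<le> (\<Sum>j<J. B\<^sup>2 * exp (- c * \<bar>real j - a\<bar>))"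
  proof (rule sum_mono)
    fix j
    have "(exp (- c * \<bar>real j - a\<bar>))\<^sup>2 \<le> exp (- c * \<bar>real j - a\<bar>)"
      using assms by (simp add: power2_eq_square mult_le_one flip: exp_add)
    then have "B\<^sup>2 * (exp (- c * \<bar>real j - a\<bar>))\<^sup>2 \<le> B\<^sup>2 * exp (- c * \<bar>real j - a\<bar>)"
      by (intro mult_left_mono) auto
    then show "(d j)\<^sup>2 \<le> B\<^sup>2 * exp (- c * \<bar>real j - a\<bar>)"
      using assms(1)[of j] by (simp add: power_mult_distrib)
  qed
  also have "\<dots> = B\<^sup>2 * (\<Sum>j<J. exp (- c * \<bar>real j - a\<bar>))" by (simp add: sum_distrib_left)
  also have "\<dots> \<le> B\<^sup>2 * (5 / c)" using assms by (intro mult_left_mono sum_exp_dist_le) auto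
  also have "\<dots> \<le> (3 * B / sqrt c)\<^sup>2"
    using assms by (simp add: power_divide power_mult_distrib divide_right_mono)
  finally show ?thesis using assms by (intro real_le_lsqrt sum_nonneg) auto
qed

context gaussian_path
begin

text \<open>
Here the increments are independent, so the squares of the coefficients are summed.
\<close>

lemma subgauss_steps:
  assumes "\<And>j. \<bar>d j\<bar> \<le> B * exp (- c * \<bar>real j - a\<bar>)" "0 < c" "c \<le> 1" "0 < B"
  shows "subgauss M (3 * B / sqrt c) (\<lambda>\<omega>. \<Sum>j<J. d j * (b (real (Suc j)) \<omega> - b (real j) \<omega>))"
proof (rule subgauss_mono)
  show "subgauss M (sqrt (\<Sum>j<J. (d j)\<^sup>2 * (real (Suc j) - real j))) (\<lambda>\<omega>. \<Sum>j<J. d j * (b (real (Suc j)) \<omega> - b (real j) \<omega>))"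
    by (rule subgauss_increments) auto
  have "sqrt (\<Sum>j<J. (d j)\<^sup>2) \<le> 3 * B / sqrt c"
  proof (rule sqrt_sum_squares_le)
    show "(d j)\<^sup>2 \<le> (B * exp (- c * \<bar>real j - a\<bar>))\<^sup>2" for j
      using power_mono[OF assms(1)[of j], of 2] by simp
  qed (use assms in auto)
  then show "\<bar>sqrt (\<Sum>j<J. (d j)\<^sup>2 * (real (Suc j) - real j))\<bar> \<le> 3 * B / sqrt c"
    by (simp add: sum_nonneg)
qed

text \<open>
For a fixed position \<open>x\<close> inside the cells the increments are taken over the disjoint intervals
\<open>[j + 1 - x, j + 1]\<close>. The partition \<open>\<tau>\<close> also contains the gaps between them, with coefficient 0.
\<close>

lemma subgauss_cells_shifted:
  assumes x: "0 \<le> x" "x < 1"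
    and hB: "\<And>u. \<bar>h u\<bar> \<le> B * exp (- c * \<bar>u - a\<bar>)" and c: "0 < c" "c \<le> 1" and B: "0 < B"
  shows "subgauss M (3 * B / sqrt c)
     (\<lambda>\<omega>. \<Sum>j<J. h (real (Suc j) - x) * (b (real (Suc j)) \<omega> - b (real (Suc j) - x) \<omega>))"
proof -
  \<comment> \<open>The points \<open>0, 1 - x, 1, 2 - x, 2, \<dots>\<close>.\<close>
  define \<tau> where "\<tau> i = (if even i then real (i div 2) else real (Suc (i div 2)) - x)" for i :: nat
  define d where "d i = (if even i then 0 else h (real (Suc (i div 2)) - x))" for i :: nat
  have pair: "(\<Sum>i<2 * J. f i) = (\<Sum>j<J. f (2 * j) + f (Suc (2 * j)))" for f :: "nat \<Rightarrow> real"
    by (induction J) auto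
  have sg: "subgauss M (sqrt (\<Sum>i<2 * J. (d i)\<^sup>2 * (\<tau> (Suc i) - \<tau> i)))
      (\<lambda>\<omega>. \<Sum>i<2 * J. d i * (b (\<tau> (Suc i)) \<omega> - b (\<tau> i) \<omega>))"
  proof (rule subgauss_increments)
    show "\<tau> i \<le> \<tau> (Suc i)" for i
      using x by (cases "even i") (auto simp: \<tau>_def elim!: evenE oddE)
  qed (simp add: \<tau>_def)
  have "(\<Sum>i<2 * J. d i * (b (\<tau> (Suc i)) \<omega> - b (\<tau> i) \<omega>))
     = (\<Sum>j<J. h (real (Suc j) - x) * (b (real (Suc j)) \<omega> - b (real (Suc j) - x) \<omega>))" for \<omega>
    unfolding pair by (simp add: d_def \<tau>_def)
  moreover have "(\<Sum>i<2 * J. (d i)\<^sup>2 * (\<tau> (Suc i) - \<tau> i)) = (\<Sum>j<J. (h (real (Suc j) - x))\<^sup>2 * x)"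
    unfolding pair by (simp add: d_def \<tau>_def)
  ultimately have sg': "subgauss M (sqrt (\<Sum>j<J. (h (real (Suc j) - x))\<^sup>2 * x))
      (\<lambda>\<omega>. \<Sum>j<J. h (real (Suc j) - x) * (b (real (Suc j)) \<omega> - b (real (Suc j) - x) \<omega>))"
    using sg by simp
  have nn: "0 \<le> (\<Sum>j<J. (h (real (Suc j) - x))\<^sup>2 * x)" using x by (intro sum_nonneg) auto
  have "sqrt (\<Sum>j<J. (h (real (Suc j) - x))\<^sup>2 * x) \<le> sqrt (\<Sum>j<J. (h (real (Suc j) - x))\<^sup>2)"
    using x by (intro real_sqrt_le_mono sum_mono mult_left_le) auto
  also have "\<dots> \<le> 3 * B / sqrt c"
  proof (rule sqrt_sum_squares_le)
    show "(h (real (Suc j) - x))\<^sup>2 \<le> (B * exp (- c * \<bar>real j - (a + x - 1)\<bar>))\<^sup>2" for j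
    proof -
      have "\<bar>h (real (Suc j) - x)\<bar> \<le> B * exp (- c * \<bar>real j - (a + x - 1)\<bar>)"
        using hB[of "real (Suc j) - x"] by (simp add: algebra_simps)
      from power_mono[OF this, of 2] show ?thesis by simp
    qed
  qed (use c B in auto)
  finally show ?thesis using nn by (intro subgauss_mono[OF sg']) simp
qed

text \<open>
Averaging \<open>subgauss_cells_shifted\<close> over \<open>x\<close> with \<open>subgauss_mixture\<close> preserves its parameter. So the
fluctuations inside the cells are controlled by the \<open>L\<^sup>2\<close> norm of \<open>h\<close>, although the integral runs
over the continuum.
\<close>

lemma subgauss_cell_noise:
  assumes h [measurable]: "h \<in> borel_measurable borel" and hB: "\<And>u. \<bar>h u\<bar> \<le> B * exp (- c * \<bar>u - a\<bar>)"
    and c: "0 < c" "c \<le> 1" and B: "0 < B"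
  shows "AE \<omega> in M. integrable lborel (\<lambda>u. h u * (b (of_int \<lceil>u\<rceil>) \<omega> - b u \<omega>))"
    and "subgauss M (3 * B / sqrt c) (\<lambda>\<omega>. LINT u|lborel. indicator {0<..real J} u * (h u * (b (of_int \<lceil>u\<rceil>) \<omega> - b u \<omega>)))"
    and "subgauss M (3 * B / sqrt c) (\<lambda>\<omega>. LINT u|lborel. h u * (b (of_int \<lceil>u\<rceil>) \<omega> - b u \<omega>))"
proof -
  let ?g = "\<lambda>u \<omega>. h u * (b (of_int \<lceil>u\<rceil>) \<omega> - b u \<omega>)"
  define s where "s u = B * exp (- c * \<bar>u - a\<bar>)" for u
  have s1: "integrable lborel s" unfolding s_def using exp_dist_integral(1)[of c a] c by simp
  have s0: "0 < s u" for u using B by (simp add: s_def)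
  have s3: "subgauss M (s u) (?g u)" for u
  proof (rule subgauss_mono[OF subgauss_scale[OF subgauss_increment]])
    have "\<bar>h u * sqrt \<bar>of_int \<lceil>u\<rceil> - u\<bar>\<bar> = \<bar>h u\<bar> * sqrt \<bar>of_int \<lceil>u\<rceil> - u\<bar>" by (simp add: abs_mult)
    also have "\<dots> \<le> s u * 1"
    proof (rule mult_mono)
      have "\<bar>of_int \<lceil>u\<rceil> - u\<bar> \<le> 1" by linarith
      then show "sqrt \<bar>of_int \<lceil>u\<rceil> - u\<bar> \<le> 1" by simp
    qed (use hB B in \<open>auto simp: s_def\<close>)
    finally show "\<bar>h u * sqrt \<bar>of_int \<lceil>u\<rceil> - u\<bar>\<bar> \<le> s u" by simp
  qed
  have t: "0 < (LINT u|lborel. s u) + 1" 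
    by (intro add_nonneg_pos integral_nonneg_AE AE_I2 less_imp_le[OF s0]) simp
  have gm [measurable]: "(\<lambda>(u, \<omega>). ?g u \<omega>) \<in> borel_measurable (lborel \<Otimes>\<^sub>M M)" by measurable
  show int: "AE \<omega> in M. integrable lborel (\<lambda>u. ?g u \<omega>)"
    by (rule subgauss_mixture(1)[OF lborel.sigma_finite_measure_axioms gm s1 s0 s3 _ t]) simp
  show trunc: "subgauss M (3 * B / sqrt c) (\<lambda>\<omega>. LINT u|lborel. indicator {0<..real J} u * ?g u \<omega>)" for J
  proof -
    define N where "N = restrict_space lborel {0..<1::real}"
    define Y where "Y x \<omega> = (\<Sum>j<J. h (real (Suc j) - x) * (b (real (Suc j)) \<omega> - b (real (Suc j) - x) \<omega>))" for x \<omega>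
    have spN: "space N = {0..<1}" by (simp add: N_def space_restrict_space)
    have sf: "sigma_finite_measure N"
      unfolding N_def by (rule sigma_finite_measure_restrict_space) (auto intro: lborel.sigma_finite_measure_axioms)
    have idN: "(\<lambda>x. x) \<in> N \<rightarrow>\<^sub>M borel" unfolding N_def by (rule measurable_restrict_space1) simp
    have [measurable]: "(\<lambda>p. fst p) \<in> N \<Otimes>\<^sub>M M \<rightarrow>\<^sub>M borel"
      by (rule measurable_compose[OF measurable_fst idN])
    have Ym: "(\<lambda>(x, \<omega>). Y x \<omega>) \<in> borel_measurable (N \<Otimes>\<^sub>M M)"
      unfolding Y_def case_prod_beta by measurable
    have mN: "emeasure N (space N) = 1"
      unfolding spN by (simp add: N_def emeasure_restrict_space)
    interpret N: finite_measure N by standard (simp add: mN)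
    have sN: "(LINT x|N. 3 * B / sqrt c) \<le> 3 * B / sqrt c"
      using mN by (simp add: measure_def)
    have "subgauss M (3 * B / sqrt c) (\<lambda>\<omega>. LINT x|N. Y x \<omega>)"
    proof (rule subgauss_mixture(2)[OF sf Ym _ _ _ sN])
      show "subgauss M (3 * B / sqrt c) (Y x)" if "x \<in> space N" for x
        unfolding Y_def using that spN by (intro subgauss_cells_shifted[OF _ _ hB c B]) auto
    qed (use B c in auto)
    then show ?thesis
    proof (rule subgauss_cong_AE)
      show "AE \<omega> in M. (LINT x|N. Y x \<omega>) = (LINT u|lborel. indicator {0<..real J} u * ?g u \<omega>)"
        using int
      proof eventually_elim
        case (elim \<omega>)
        have "(LINT x|N. Y x \<omega>) = (LINT x|lborel. indicator {0..<1} x * Y x \<omega>)"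
          unfolding N_def by (subst integral_restrict_space) auto
        also have "\<dots> = (LINT x|lborel. indicator {0..<1} x * (\<Sum>j<J. ?g (real (Suc j) - x) \<omega>))"
        proof (rule Bochner_Integration.integral_cong)
          fix x :: real
          have "\<lceil>real (Suc j) - x\<rceil> = int (Suc j)" if "0 \<le> x" "x < 1" for j
            using that by (simp add: ceiling_eq_iff)
          then show "indicator {0..<1} x * Y x \<omega> = indicator {0..<1} x * (\<Sum>j<J. ?g (real (Suc j) - x) \<omega>)"
            unfolding Y_def by (auto simp: indicator_def)
        qed simp
        also have "\<dots> = (LINT u|lborel. indicator {0<..real J} u * ?g u \<omega>)"
          by (rule integral_over_cells[OF elim])
        finally show ?case .
      qed
    qed measurable
  qed
  show "subgauss M (3 * B / sqrt c) (\<lambda>\<omega>. LINT u|lborel. ?g u \<omega>)"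
  proof (rule subgauss_limit[OF trunc])
    show "AE \<omega> in M. (\<lambda>J. LINT u|lborel. indicator {0<..real J} u * ?g u \<omega>) \<longlonglongrightarrow> (LINT u|lborel. ?g u \<omega>)"
      using int by eventually_elim (rule LINT_truncated_tendsto, simp_all add: b_nonpos)
  qed auto
qed

end

section \<open>The two errors as linear functionals of the path\<close>

context gaussian_path
begin

text \<open>
The lattice weights and the heat kernel both have total mass 1. Therefore the value \<open>b a\<close> at the centre
can be subtracted in both, which leaves a displacement term and a cell term. Without this subtraction
the estimate would depend on the size of \<open>b\<close>, hence on \<open>n\<close>.
\<close>

lemma subgauss_position_error:
  fixes \<alpha> :: real and k n :: nat
  assumes \<alpha>: "0 < \<alpha>" "\<alpha> < 1" and k: "k \<ge> 1"
    and heat: "\<And>y. heat_kernel \<alpha> k y \<le> B2 * exp (- c * \<bar>y\<bar>)"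
    and hopB: "\<And>m y. \<bar>m - k / \<alpha> - y\<bar> \<le> 1 \<Longrightarrow> \<bar>delay_prob \<alpha> k m - heat_kernel \<alpha> k y\<bar> \<le> B1 * exp (- c * \<bar>y\<bar>)"
    and c: "0 < c" "c \<le> 1" and B: "0 < B1" "0 < B2"
  shows "subgauss M (4 * B1 / (c * sqrt c) + 3 * B2 / sqrt c)
    (\<lambda>\<omega>. (\<Sum>m\<le>n. delay_prob \<alpha> k (int m) * b (real n - real m) \<omega>)
        - (LINT u|lborel. heat_kernel \<alpha> k (n - k / \<alpha> - u) * b u \<omega>))"
proof -
  define a where "a = n - k / \<alpha>"
  define q where "q u = heat_kernel \<alpha> k (a - u)" for u
  define p where "p j = delay_prob \<alpha> k (int n - j)" for j
  define P where "P u = p \<lceil>u\<rceil> - q u" for u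
  have k0: "real k > 0" using k by simp
  have sd: "sqrt ((rho \<alpha>)\<^sup>2 * k) > 0" using rho_sq_pos[OF \<alpha>] k0 by simp
  have q_m [measurable]: "q \<in> borel_measurable borel"
    unfolding q_def heat_kernel_def by measurable
  have p_m [measurable]: "(\<lambda>u::real. p \<lceil>u\<rceil>) \<in> borel_measurable borel" by measurable
  have P_m [measurable]: "P \<in> borel_measurable borel" unfolding P_def by measurable
  have q_int: "integrable lborel q" and q_one: "(LINT u|lborel. q u) = 1"
  proof -
    have "has_bochner_integral lborel (normal_density 0 (sqrt ((rho \<alpha>)\<^sup>2 * k))) 1"
      using integrable_normal_density[OF sd, of 0] integral_normal_density[OF sd, of 0] by (simp add: has_bochner_integral_iff)
    then have "has_bochner_integral lborel (\<lambda>u. normal_density 0 (sqrt ((rho \<alpha>)\<^sup>2 * k)) (a + (-1) * u)) (1 /\<^sub>R \<bar>-1\<bar>)"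
      by (subst (asm) lborel_has_bochner_integral_real_affine_iff[of "-1" _ _ a]) auto
    then show "integrable lborel q" "(LINT u|lborel. q u) = 1"
      by (auto simp: has_bochner_integral_iff q_def [abs_def] heat_kernel_def)
  qed
  have qB: "\<bar>q u\<bar> \<le> B2 * exp (- c * \<bar>u - a\<bar>)" for u
    using heat[of "a - u"] heat_kernel_nonneg[OF \<alpha>, of k "a - u"] by (simp add: q_def abs_minus_commute)
  have PB: "\<bar>P u\<bar> \<le> B1 * exp (- c * \<bar>u - a\<bar>)" for u
  proof -
    have "\<bar>(int n - \<lceil>u\<rceil>) - k / \<alpha> - (a - u)\<bar> = \<bar>u - of_int \<lceil>u\<rceil>\<bar>" by (simp add: a_def)
    also have "\<dots> \<le> 1" by linarith
    finally show ?thesis using hopB[of "int n - \<lceil>u\<rceil>" "a - u"] by (simp add: P_def p_def q_def abs_minus_commute)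
  qed
  have P_int: "integrable lborel P"
  proof (rule Bochner_Integration.integrable_bound)
    show "integrable lborel (\<lambda>u. B1 * exp (- c * \<bar>u - a\<bar>))" using exp_dist_integral(1)[OF c(1)] by simp
    show "AE u in lborel. norm (P u) \<le> norm (B1 * exp (- c * \<bar>u - a\<bar>))"
      unfolding real_norm_def by (intro AE_I2 order_trans[OF PB abs_ge_self])
  qed simp
  have p_int: "integrable lborel (\<lambda>u::real. p \<lceil>u\<rceil>)"
    using Bochner_Integration.integrable_add[OF P_int q_int] by (simp add: P_def)
  have p_one: "(LINT u|lborel. p \<lceil>u::real\<rceil>) = 1"
  proof (rule LIMSEQ_unique)
    define g where "g J u = indicator {real n - real J<..real n} u * p \<lceil>u\<rceil>" for J :: nat and u :: real
    have gJ: "(LINT u|lborel. g J u) = (\<Sum>j<J. delay_prob \<alpha> k (int j))" for J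
    proof -
      have "(LINT u|lborel. g J u) = (LINT v|lborel. g J ((real n - real J) + 1 * v))"
        using lborel_integral_real_affine[of 1 "g J" "real n - real J"] by simp
      also have "(\<lambda>v. g J ((real n - real J) + 1 * v)) = (\<lambda>v. indicator {0<..real J} v * delay_prob \<alpha> k (int J - \<lceil>v\<rceil>))"
      proof
        fix v :: real
        have "\<lceil>(real n - real J) + 1 * v\<rceil> = \<lceil>v\<rceil> + (int n - int J)"
          using ceiling_add_of_int[of v "int n - int J"] by (simp add: add.commute)
        then have arg: "int n - \<lceil>(real n - real J) + 1 * v\<rceil> = int J - \<lceil>v\<rceil>" by linarith
        have ind: "indicator {real n - real J<..real n} ((real n - real J) + 1 * v) = (indicator {0<..real J} v :: real)"
          by (auto simp: indicator_def)
        show "g J ((real n - real J) + 1 * v) = indicator {0<..real J} v * delay_prob \<alpha> k (int J - \<lceil>v\<rceil>)"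
          unfolding g_def p_def arg ind ..
      qed
      also have "(LINT v|lborel. indicator {0<..real J} v * delay_prob \<alpha> k (int J - \<lceil>v\<rceil>)) = (\<Sum>j<J. delay_prob \<alpha> k (int J - int (Suc j)))"
        by (rule has_bochner_integral_integral_eq[OF has_bochner_integral_ceiling_step])
      also have "\<dots> = (\<Sum>j<J. delay_prob \<alpha> k (int (J - Suc j)))" by (intro sum.cong) (auto simp: of_nat_diff)
      also have "\<dots> = (\<Sum>j<J. delay_prob \<alpha> k (int j))" by (rule sum.nat_diff_reindex)
      finally show ?thesis .
    qed
    show "(\<lambda>J. LINT u|lborel. g J u) \<longlonglongrightarrow> 1"
      unfolding gJ using delay_prob_sums[OF \<alpha>, of k] by (simp add: sums_def)
    show "(\<lambda>J. LINT u|lborel. g J u) \<longlonglongrightarrow> (LINT u|lborel. p \<lceil>u::real\<rceil>)"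
    proof (rule integral_dominated_convergence[where w = "\<lambda>u::real. \<bar>p \<lceil>u\<rceil>\<bar>"])
      show "AE u in lborel. (\<lambda>J. g J u) \<longlonglongrightarrow> p \<lceil>u\<rceil>"
      proof (rule AE_I2, rule tendsto_eventually)
        fix u :: real
        obtain J0 :: nat where J0: "n - u < real J0" using reals_Archimedean2 by blast
        have "u > n \<Longrightarrow> p \<lceil>u\<rceil> = 0" by (simp add: p_def delay_prob_neg less_ceiling_iff)
        then show "\<forall>\<^sub>F J in sequentially. g J u = p \<lceil>u\<rceil>"
          using J0 by (intro eventually_sequentiallyI[of J0]) (auto simp: g_def indicator_def)
      qed
      show "AE u in lborel. norm (g J u) \<le> \<bar>p \<lceil>u\<rceil>\<bar>" for J
        by (auto simp: g_def indicator_def)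
    qed (use p_int in \<open>auto simp: g_def\<close>)
  qed
  have P_zero: "(LINT u|lborel. P u) = 0"
    unfolding P_def by (subst Bochner_Integration.integral_diff[OF p_int q_int]) (simp add: p_one q_one)
  have front: "has_bochner_integral lborel (\<lambda>u::real. p \<lceil>u\<rceil> * b (of_int \<lceil>u\<rceil>) \<omega>)
      (\<Sum>m\<le>n. delay_prob \<alpha> k (int m) * b (real n - real m) \<omega>)" for \<omega>
  proof -
    have "has_bochner_integral lborel (\<lambda>u. indicator {0<..real n} u * (p \<lceil>u\<rceil> * b (of_int \<lceil>u\<rceil>) \<omega>))
       (\<Sum>j<n. p (int (Suc j)) * b (of_int (int (Suc j))) \<omega>)"
      using has_bochner_integral_ceiling_step[of n "\<lambda>j. p j * b (of_int j) \<omega>"] by simp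
    moreover have "indicator {0<..real n} u * (p \<lceil>u\<rceil> * b (of_int \<lceil>u\<rceil>) \<omega>) = p \<lceil>u\<rceil> * b (of_int \<lceil>u\<rceil>) \<omega>" for u
    proof -
      have "u > n \<Longrightarrow> p \<lceil>u\<rceil> = 0" by (simp add: p_def delay_prob_neg less_ceiling_iff)
      moreover have "u \<le> 0 \<Longrightarrow> b (of_int \<lceil>u\<rceil>) \<omega> = 0" by (simp add: b_nonpos)
      ultimately show ?thesis
        by (cases "u \<le> 0 \<or> u > n") (auto simp: indicator_def not_le not_less)
    qed
    moreover have "(\<Sum>j<n. p (int (Suc j)) * b (of_int (int (Suc j))) \<omega>)
        = (\<Sum>m\<le>n. delay_prob \<alpha> k (int m) * b (real n - real m) \<omega>)"
    proof -
      have "(\<Sum>m\<le>n. delay_prob \<alpha> k (int m) * b (real n - real m) \<omega>) = (\<Sum>m<n. delay_prob \<alpha> k (int m) * b (real n - real m) \<omega>)"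
        by (simp add: lessThan_Suc_atMost[symmetric] b_nonpos)
      also have "\<dots> = (\<Sum>j<n. delay_prob \<alpha> k (int (n - Suc j)) * b (real n - real (n - Suc j)) \<omega>)"
        by (rule sum.nat_diff_reindex[symmetric])
      also have "\<dots> = (\<Sum>j<n. p (int (Suc j)) * b (of_int (int (Suc j))) \<omega>)"
        by (intro sum.cong) (auto simp: p_def of_nat_diff)
      finally show ?thesis by simp
    qed
    ultimately show ?thesis by simp
  qed
  have f: "\<bar>of_int \<lceil>u\<rceil> - a\<bar> \<le> \<bar>u - a\<bar> + 1" for u :: real by linarith
  have fm: "(\<lambda>u::real. real_of_int \<lceil>u\<rceil>) \<in> borel_measurable borel" by measurable
  note disp = subgauss_displacement[OF P_m PB fm f c B(1)]
  note cell = subgauss_cell_noise(1,3)[OF q_m qB c B(2)]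
  have "subgauss M (4 * B1 / (c * sqrt c) + 3 * B2 / sqrt c)
    (\<lambda>\<omega>. (LINT u|lborel. P u * (b (of_int \<lceil>u\<rceil>) \<omega> - b a \<omega>)) + (LINT u|lborel. q u * (b (of_int \<lceil>u\<rceil>) \<omega> - b u \<omega>)))"
    using c B by (intro subgauss_add disp cell) auto
  then show ?thesis
  proof (rule subgauss_cong_AE)
    note [measurable] = b_measurable
    show "(\<lambda>\<omega>. (\<Sum>m\<le>n. delay_prob \<alpha> k (int m) * b (real n - real m) \<omega>)
        - (LINT u|lborel. heat_kernel \<alpha> k (n - k / \<alpha> - u) * b u \<omega>)) \<in> borel_measurable M"
      unfolding a_def[symmetric] q_def[symmetric] by measurable
    show "AE \<omega> in M. (LINT u|lborel. P u * (b (of_int \<lceil>u\<rceil>) \<omega> - b a \<omega>)) + (LINT u|lborel. q u * (b (of_int \<lceil>u\<rceil>) \<omega> - b u \<omega>))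
       = (\<Sum>m\<le>n. delay_prob \<alpha> k (int m) * b (real n - real m) \<omega>)
        - (LINT u|lborel. heat_kernel \<alpha> k (n - k / \<alpha> - u) * b u \<omega>)"
      using disp(1) cell(1)
    proof eventually_elim
      case (elim \<omega>)
      let ?G = "\<lambda>u::real. p \<lceil>u\<rceil> * b (of_int \<lceil>u\<rceil>) \<omega>" and ?A = "\<lambda>u. P u * (b (of_int \<lceil>u\<rceil>) \<omega> - b a \<omega>)"
        and ?C = "\<lambda>u. q u * (b (of_int \<lceil>u\<rceil>) \<omega> - b u \<omega>)"
      have G: "integrable lborel ?G" using front[of \<omega>] by (simp add: has_bochner_integral_iff)
      have Pa: "integrable lborel (\<lambda>u. P u * b a \<omega>)" using P_int by simp
      \<comment> \<open>Every term on the right is integrable, so the integral of the smooth approximation may be split.\<close>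
      have "(\<lambda>u. q u * b u \<omega>) = (\<lambda>u. ?G u - ?A u - P u * b a \<omega> - ?C u)"
        by (auto simp: P_def algebra_simps)
      then have "(LINT u|lborel. q u * b u \<omega>) = (LINT u|lborel. ?G u) - (LINT u|lborel. ?A u) - (LINT u|lborel. P u * b a \<omega>) - (LINT u|lborel. ?C u)"
        using G Pa elim by simp
      also have "(LINT u|lborel. P u * b a \<omega>) = 0" by (simp add: P_zero)
      also have "(LINT u|lborel. ?G u) = (\<Sum>m\<le>n. delay_prob \<alpha> k (int m) * b (real n - real m) \<omega>)"
        by (rule has_bochner_integral_integral_eq[OF front])
      finally show ?case unfolding a_def[symmetric] q_def[symmetric] by simp
    qed
  qed
qed

lemma AE_integrable_kernel:
  assumes h [measurable]: "h \<in> borel_measurable borel" and hB: "\<And>u. \<bar>h u\<bar> \<le> B * exp (- c * \<bar>u - a\<bar>)"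
    and c: "0 < c" "c \<le> 1" and B: "0 \<le> B"
  shows "AE \<omega> in M. integrable lborel (\<lambda>u. h u * b u \<omega>)"
  using AE_integrable_exp_weight[OF c]
proof eventually_elim
  case (elim \<omega>)
  show ?case
  proof (rule Bochner_Integration.integrable_bound)
    show "integrable lborel (\<lambda>u. B * exp (c * \<bar>a\<bar>) * (exp (- c * \<bar>u\<bar>) * b u \<omega>))" using elim by simp
    show "AE u in lborel. norm (h u * b u \<omega>) \<le> norm (B * exp (c * \<bar>a\<bar>) * (exp (- c * \<bar>u\<bar>) * b u \<omega>))"
    proof (rule AE_I2)
      fix u
      have "c * \<bar>u\<bar> \<le> c * (\<bar>a\<bar> + \<bar>u - a\<bar>)" using c by (intro mult_left_mono) auto
      then have "exp (- c * \<bar>u - a\<bar>) \<le> exp (c * \<bar>a\<bar>) * exp (- c * \<bar>u\<bar>)"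
        by (simp add: algebra_simps flip: exp_add)
      then have "\<bar>h u\<bar> \<le> B * (exp (c * \<bar>a\<bar>) * exp (- c * \<bar>u\<bar>))"
        using B by (intro order_trans[OF hB] mult_left_mono)
      then have "\<bar>h u\<bar> * \<bar>b u \<omega>\<bar> \<le> B * (exp (c * \<bar>a\<bar>) * exp (- c * \<bar>u\<bar>)) * \<bar>b u \<omega>\<bar>"
        by (intro mult_right_mono) auto
      then show "norm (h u * b u \<omega>) \<le> norm (B * exp (c * \<bar>a\<bar>) * (exp (- c * \<bar>u\<bar>) * b u \<omega>))"
        using B by (simp add: abs_mult mult.assoc)
    qed
  qed simp
qed

text \<open>
With \<open>h\<close> the flux kernel and \<open>h'\<close> its derivative, summation by parts over \<open>(0, J]\<close> gives
\[
  \int_0^J h'(u) b(\lceil u \rceil) du = h(J) b(J) - \sum_{j<J} h(j) (b(j+1) - b(j)) .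
\]
Hence the error is the limit of a sum of increments with coefficients
\<open>h(j) - P(T\<^sub>k\<^sub>+\<^sub>1 = n - j) / \<alpha>\<close>, a cell term, and a boundary term \<open>h(J) b(J)\<close> that tends to 0.
\<close>

lemma subgauss_velocity_error:
  fixes \<alpha> :: real and k n :: nat
  assumes \<alpha>: "0 < \<alpha>" "\<alpha> < 1" and k: "k \<ge> 1"
    and drift: "\<And>y. \<bar>drift_kernel \<alpha> k y\<bar> \<le> B * exp (- c * \<bar>y\<bar>)"
    and hopB: "\<And>m::int. \<bar>delay_prob \<alpha> (Suc k) m / \<alpha> - flux_kernel \<alpha> k (m - k / \<alpha>)\<bar> \<le> B * exp (- c * \<bar>m - k / \<alpha>\<bar>)"
    and c: "0 < c" "c \<le> 1" and B: "0 < B"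
  shows "subgauss M (6 * B / sqrt c)
    (\<lambda>\<omega>. - (\<Sum>m\<le>n. delay_prob \<alpha> (Suc k) (int m) * (b (real n + 1 - real m) \<omega> - b (real n - real m) \<omega>)) / \<alpha>
        - (LINT u|lborel. drift_kernel \<alpha> k (n - k / \<alpha> - u) * b u \<omega>))"
proof -
  define a where "a = n - k / \<alpha>"
  define h where "h u = flux_kernel \<alpha> k (a - u)" for u
  define h' where "h' u = drift_kernel \<alpha> k (a - u)" for u
  define d where "d j = h (real j) - delay_prob \<alpha> (Suc k) (int n - int j) / \<alpha>" for j
  have k0: "real k > 0" using k by simp
  have h'_cont: "continuous_on UNIV h'"
    unfolding h'_def drift_kernel_def heat_kernel_def normal_density_def
    using rho_sq_pos[OF \<alpha>] \<alpha> k0 by (intro continuous_intros) auto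
  have [measurable]: "h' \<in> borel_measurable borel" by (rule borel_measurable_continuous_onI[OF h'_cont])
  have h_deriv: "(h has_real_derivative h' u) (at u)" for u
  proof -
    have "((\<lambda>u. flux_kernel \<alpha> k (a - u)) has_real_derivative (- drift_kernel \<alpha> k (a - u)) * (0 - 1)) (at u)"
      by (rule DERIV_chain'[OF _ flux_kernel_DERIV[OF \<alpha> k0]]) (auto intro!: derivative_eq_intros)
    then show ?thesis unfolding h_def [abs_def] h'_def by simp
  qed
  have h'B: "\<bar>h' u\<bar> \<le> B * exp (- c * \<bar>u - a\<bar>)" for u
    using drift[of "a - u"] by (simp add: h'_def abs_minus_commute)
  have dB: "\<bar>d j\<bar> \<le> B * exp (- c * \<bar>real j - a\<bar>)" for j
    using hopB[of "int n - int j"] by (simp add: d_def h_def a_def abs_minus_commute algebra_simps)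
  have hJ: "\<bar>h (real J)\<bar> \<le> B * exp (- c * \<bar>real J - a\<bar>)" if "J > n" for J
    using dB[of J] that by (simp add: d_def delay_prob_neg)
  have h'_cell: "has_bochner_integral lborel (\<lambda>u. indicator {real j<..real (Suc j)} u * h' u) (h (real (Suc j)) - h (real j))" for j
  proof -
    have "has_bochner_integral lborel (\<lambda>u. indicator {real j..real (Suc j)} u *\<^sub>R h' u) (h (real (Suc j)) - h (real j))"
      by (rule has_bochner_integral_FTC_Icc)
         (auto intro!: continuous_on_subset[OF h'_cont] has_field_derivative_at_within[OF h_deriv]
            simp: has_real_derivative_iff_has_vector_derivative[symmetric])
    moreover have "AE u in lborel. indicator {real j..real (Suc j)} u *\<^sub>R h' u = indicator {real j<..real (Suc j)} u * h' u"
      using AE_lborel_singleton[of "real j"] by eventually_elim (auto simp: indicator_def)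
    ultimately show ?thesis
      by (subst has_bochner_integral_cong_AE[symmetric]) auto
  qed
  have parts: "has_bochner_integral lborel (\<lambda>u. indicator {0<..real J} u * (h' u * b (of_int \<lceil>u\<rceil>) \<omega>))
      (h (real J) * b (real J) \<omega> - (\<Sum>j<J. h (real j) * (b (real (Suc j)) \<omega> - b (real j) \<omega>)))" for J \<omega>
  proof (induction J)
    case 0
    then show ?case by (simp add: b_nonpos has_bochner_integral_zero)
  next
    case (Suc J)
    have "has_bochner_integral lborel (\<lambda>u. indicator {0<..real J} u * (h' u * b (of_int \<lceil>u\<rceil>) \<omega>)
        + (indicator {real J<..real (Suc J)} u * h' u) * b (real (Suc J)) \<omega>)
      (h (real J) * b (real J) \<omega> - (\<Sum>j<J. h (real j) * (b (real (Suc j)) \<omega> - b (real j) \<omega>))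
        + (h (real (Suc J)) - h (real J)) * b (real (Suc J)) \<omega>)"
      by (intro has_bochner_integral_add Suc has_bochner_integral_mult_left h'_cell)
    moreover have "indicator {0<..real J} u * (h' u * b (of_int \<lceil>u\<rceil>) \<omega>)
        + (indicator {real J<..real (Suc J)} u * h' u) * b (real (Suc J)) \<omega>
        = indicator {0<..real (Suc J)} u * (h' u * b (of_int \<lceil>u\<rceil>) \<omega>)" for u
    proof -
      have "real_of_int \<lceil>u\<rceil> = real (Suc J)" if "real J < u" "u \<le> real (Suc J)"
      proof -
        have "\<lceil>u\<rceil> = int (Suc J)" using that by (simp add: ceiling_eq_iff)
        then show ?thesis by simp
      qed
      then show ?thesis by (auto simp: indicator_def)
    qed
    moreover have "h (real J) * b (real J) \<omega> - (\<Sum>j<J. h (real j) * (b (real (Suc j)) \<omega> - b (real j) \<omega>))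
        + (h (real (Suc J)) - h (real J)) * b (real (Suc J)) \<omega>
      = h (real (Suc J)) * b (real (Suc J)) \<omega> - (\<Sum>j<Suc J. h (real j) * (b (real (Suc j)) \<omega> - b (real j) \<omega>))"
      by (simp add: algebra_simps)
    ultimately show ?case by (simp only:)
  qed
  define V where "V \<omega> = - (\<Sum>m\<le>n. delay_prob \<alpha> (Suc k) (int m) * (b (real n + 1 - real m) \<omega> - b (real n - real m) \<omega>)) / \<alpha>" for \<omega>
  have V_eq: "V \<omega> = - (\<Sum>j<J. delay_prob \<alpha> (Suc k) (int n - int j) / \<alpha> * (b (real (Suc j)) \<omega> - b (real j) \<omega>))" if "J > n" for J \<omega>
  proof -
    have "(\<Sum>m\<le>n. delay_prob \<alpha> (Suc k) (int m) * (b (real n + 1 - real m) \<omega> - b (real n - real m) \<omega>))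
       = (\<Sum>m<Suc n. delay_prob \<alpha> (Suc k) (int m) * (b (real n + 1 - real m) \<omega> - b (real n - real m) \<omega>))"
      by (simp add: lessThan_Suc_atMost)
    also have "\<dots> = (\<Sum>j<Suc n. delay_prob \<alpha> (Suc k) (int (Suc n - Suc j)) * (b (real n + 1 - real (Suc n - Suc j)) \<omega> - b (real n - real (Suc n - Suc j)) \<omega>))"
      by (rule sum.nat_diff_reindex[symmetric])
    also have "\<dots> = (\<Sum>j<Suc n. delay_prob \<alpha> (Suc k) (int n - int j) * (b (real (Suc j)) \<omega> - b (real j) \<omega>))"
      by (intro sum.cong) (auto simp: of_nat_diff algebra_simps)
    also have "\<dots> = (\<Sum>j<J. delay_prob \<alpha> (Suc k) (int n - int j) * (b (real (Suc j)) \<omega> - b (real j) \<omega>))"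
      using that by (intro sum.mono_neutral_left) (auto simp: delay_prob_neg)
    finally show ?thesis unfolding V_def by (simp add: sum_divide_distrib)
  qed
  have V_m [measurable]: "V \<in> borel_measurable M"
    unfolding V_def using b_measurable by measurable
  define E where "E J \<omega> = (\<Sum>j<J. d j * (b (real (Suc j)) \<omega> - b (real j) \<omega>))
     + (LINT u|lborel. indicator {0<..real J} u * (h' u * (b (of_int \<lceil>u\<rceil>) \<omega> - b u \<omega>)))
     + (- h (real J)) * b (real J) \<omega>" for J \<omega>
  \<comment> \<open>The summand \<open>1 / (J + 1)\<close> only makes the parameter positive.\<close>
  define r where "r J = \<bar>h (real J)\<bar> * sqrt (real J) + 1 / real (Suc J)" for J
  note cell = subgauss_cell_noise(1,2)[OF _ h'B c B, simplified]
  have E_sub: "subgauss M (3 * B / sqrt c + 3 * B / sqrt c + r J) (E J)" for J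
    unfolding E_def
  proof (intro subgauss_add subgauss_steps[OF dB c B] cell)
    have "subgauss M (sqrt (real J)) (b (real J))"
      using subgauss_increment[of "real J" 0] by (simp add: b_nonpos)
    from subgauss_scale[OF this, of "- h (real J)"]
    show "subgauss M (r J) (\<lambda>\<omega>. - h (real J) * b (real J) \<omega>)"
      by (rule subgauss_mono) (simp add: r_def abs_mult)
    show "0 < r J" by (simp add: r_def add_nonneg_pos)
  qed (use c B in \<open>auto simp: add_pos_pos\<close>)
  have r_lim: "r \<longlonglongrightarrow> 0"
  proof (rule tendsto_sandwich[where f = "\<lambda>_. 0"])
    show "(\<lambda>J. B * exp (- c * (real J - a)) * sqrt (real J) + 1 / real (Suc J)) \<longlonglongrightarrow> 0"
      using c B by real_asymp
    show "\<forall>\<^sub>F J in sequentially. r J \<le> B * exp (- c * (real J - a)) * sqrt (real J) + 1 / real (Suc J)"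
    proof (rule eventually_sequentiallyI[of "Suc n"])
      fix J assume J: "Suc n \<le> J"
      have "k / \<alpha> \<ge> 0" using \<alpha> by simp
      then have "real J - a \<ge> 0" using J by (simp add: a_def)
      then have "\<bar>h (real J)\<bar> \<le> B * exp (- c * (real J - a))" using hJ[of J] J by simp
      then show "r J \<le> B * exp (- c * (real J - a)) * sqrt (real J) + 1 / real (Suc J)"
        unfolding r_def by (intro add_mono mult_right_mono) auto
    qed
    show "\<forall>\<^sub>F J in sequentially. 0 \<le> r J" by (auto simp: r_def)
  qed auto
  have s_lim: "(\<lambda>J. 3 * B / sqrt c + 3 * B / sqrt c + r J) \<longlonglongrightarrow> 3 * B / sqrt c + 3 * B / sqrt c + 0"
    by (intro tendsto_intros r_lim)
  have "subgauss M (3 * B / sqrt c + 3 * B / sqrt c + 0) (\<lambda>\<omega>. V \<omega> - (LINT u|lborel. h' u * b u \<omega>))"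
  proof (rule subgauss_limit[OF E_sub s_lim])
    have iw: "AE \<omega> in M. integrable lborel (\<lambda>u. h' u * b u \<omega>)"
      by (rule AE_integrable_kernel[OF _ h'B c]) (use B in auto)
    show "AE \<omega> in M. (\<lambda>J. E J \<omega>) \<longlonglongrightarrow> V \<omega> - (LINT u|lborel. h' u * b u \<omega>)"
      using iw
    proof eventually_elim
      case (elim \<omega>)
      have tail: "(\<lambda>J. LINT u|lborel. indicator {0<..real J} u * (h' u * b u \<omega>)) \<longlonglongrightarrow> (LINT u|lborel. h' u * b u \<omega>)"
        by (rule LINT_truncated_tendsto[OF elim]) (simp add: b_nonpos)
      have E_eq: "E J \<omega> = V \<omega> - (LINT u|lborel. indicator {0<..real J} u * (h' u * b u \<omega>))" if J: "J > n" for J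
      proof -
        have i: "integrable lborel (\<lambda>u. indicator {0<..real J} u * (h' u * b u \<omega>))"
          using integrable_mult_indicator[OF _ elim, of "{0<..real J}"] by simp
        have "(LINT u|lborel. indicator {0<..real J} u * (h' u * (b (of_int \<lceil>u\<rceil>) \<omega> - b u \<omega>)))
          = (LINT u|lborel. indicator {0<..real J} u * (h' u * b (of_int \<lceil>u\<rceil>) \<omega>))
            - (LINT u|lborel. indicator {0<..real J} u * (h' u * b u \<omega>))"
          using parts[of J \<omega>] i
          by (subst Bochner_Integration.integral_diff[symmetric]) (auto simp: has_bochner_integral_iff right_diff_distrib)
        also have "(LINT u|lborel. indicator {0<..real J} u * (h' u * b (of_int \<lceil>u\<rceil>) \<omega>))
          = h (real J) * b (real J) \<omega> - (\<Sum>j<J. h (real j) * (b (real (Suc j)) \<omega> - b (real j) \<omega>))"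
          by (rule has_bochner_integral_integral_eq[OF parts])
        finally show ?thesis
          unfolding E_def V_eq[OF J] d_def by (simp add: left_diff_distrib sum_subtractf)
      qed
      have "\<forall>\<^sub>F J in sequentially. V \<omega> - (LINT u|lborel. indicator {0<..real J} u * (h' u * b u \<omega>)) = E J \<omega>"
        by (intro eventually_sequentiallyI[of "Suc n"]) (simp add: E_eq)
      with tendsto_diff[OF tendsto_const tail, of "V \<omega>"] show ?case
        by (rule Lim_transform_eventually)
    qed
  qed measurable
  then show ?thesis
    unfolding V_def h'_def a_def by simp
qed

end

section \<open>Coordinates of Brownian motion\<close>

lemma nn_integral_normal_exp:
  fixes c s :: real assumes s: "0 < s"
  shows "(\<integral>\<^sup>+z. ennreal (normal_density 0 s z * exp (c * z)) \<partial>lborel) = ennreal (exp (c\<^sup>2 * s\<^sup>2 / 2))"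
proof -
  have sq: "normal_density 0 s z * exp (c * z) = exp (c\<^sup>2 * s\<^sup>2 / 2) * normal_density (c * s\<^sup>2) s z" for z
  proof -
    have "- (z - 0)\<^sup>2 / (2 * s\<^sup>2) + c * z = c\<^sup>2 * s\<^sup>2 / 2 + - (z - c * s\<^sup>2)\<^sup>2 / (2 * s\<^sup>2)"
      using s by (simp add: field_simps power2_eq_square)
    then have "exp (- (z - 0)\<^sup>2 / (2 * s\<^sup>2)) * exp (c * z) = exp (c\<^sup>2 * s\<^sup>2 / 2) * exp (- (z - c * s\<^sup>2)\<^sup>2 / (2 * s\<^sup>2))"
      by (simp only: exp_add[symmetric])
    then show ?thesis unfolding normal_density_def by (simp only: mult.assoc mult.left_commute)
  qed
  have "(\<integral>\<^sup>+z. ennreal (normal_density 0 s z * exp (c * z)) \<partial>lborel)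
      = (\<integral>\<^sup>+z. ennreal (exp (c\<^sup>2 * s\<^sup>2 / 2)) * ennreal (normal_density (c * s\<^sup>2) s z) \<partial>lborel)"
    unfolding sq by (simp add: ennreal_mult')
  also have "\<dots> = ennreal (exp (c\<^sup>2 * s\<^sup>2 / 2)) * (\<integral>\<^sup>+z. ennreal (normal_density (c * s\<^sup>2) s z) \<partial>lborel)"
    by (rule nn_integral_cmult) simp
  also have "(\<integral>\<^sup>+z. ennreal (normal_density (c * s\<^sup>2) s z) \<partial>lborel) = 1"
    using integrable_normal_density[OF s] integral_normal_density[OF s]
    by (subst nn_integral_eq_integral) auto
  finally show ?thesis by simp
qed

text \<open>
The other coordinates integrate to 1 by Tonelli's theorem.
\<close>

lemma nn_integral_normal_vec_exp:
  fixes j :: "'n::finite" and c s :: real assumes s: "0 < s"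
  shows "(\<integral>\<^sup>+x. ennreal (\<Prod>i\<in>UNIV. normal_density 0 s (x $ i)) * ennreal (exp (c * x $ j)) \<partial>(lborel :: (real ^ 'n) measure))
     = ennreal (exp (c\<^sup>2 * s\<^sup>2 / 2))"
proof -
  define e where "e i = (axis i 1 :: real ^ 'n)" for i
  have inj: "inj e" unfolding e_def inj_def by (auto simp: axis_eq_axis)
  have Bas: "Basis = range e" by (auto simp: Basis_vec_def e_def)
  define f where "f d z = ennreal (normal_density 0 s z * (if d = e j then exp (c * z) else 1))" for d :: "real ^ 'n" and z
  have fm: "f d \<in> borel_measurable borel" for d unfolding f_def by measurable
  have "(\<Prod>d\<in>Basis. f d (x \<bullet> d)) = ennreal (\<Prod>i\<in>UNIV. normal_density 0 s (x $ i)) * ennreal (exp (c * x $ j))" for x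
  proof -
    have "(\<Prod>d\<in>Basis. f d (x \<bullet> d)) = (\<Prod>i\<in>UNIV. f (e i) (x $ i))"
      unfolding Bas by (subst prod.reindex[OF inj]) (simp add: e_def inner_axis)
    also have "\<dots> = (\<Prod>i\<in>UNIV. ennreal (normal_density 0 s (x $ i) * (if i = j then exp (c * x $ i) else 1)))"
      using inj by (simp add: f_def inj_eq)
    also have "\<dots> = ennreal (\<Prod>i\<in>UNIV. normal_density 0 s (x $ i) * (if i = j then exp (c * x $ i) else 1))"
      by (rule prod_ennreal) simp
    also have "(\<Prod>i\<in>UNIV. normal_density 0 s (x $ i) * (if i = j then exp (c * x $ i) else 1))
        = (\<Prod>i\<in>UNIV. normal_density 0 s (x $ i)) * exp (c * x $ j)"
      by (simp add: prod.distrib prod.delta)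
    finally show ?thesis by (simp add: ennreal_mult' prod_nonneg)
  qed
  then have "(\<integral>\<^sup>+x. ennreal (\<Prod>i\<in>UNIV. normal_density 0 s (x $ i)) * ennreal (exp (c * x $ j)) \<partial>(lborel :: (real ^ 'n) measure))
     = (\<integral>\<^sup>+x. (\<Prod>d\<in>Basis. f d (x \<bullet> d)) \<partial>lborel)" by simp
  also have "\<dots> = (\<Prod>d\<in>Basis. \<integral>\<^sup>+z. f d z \<partial>lborel)"
    by (rule nn_integral_lborel_prod) (auto intro: fm)
  also have "\<dots> = (\<Prod>i\<in>UNIV. if i = j then ennreal (exp (c\<^sup>2 * s\<^sup>2 / 2)) else 1)"
    unfolding Bas
  proof (subst prod.reindex[OF inj], unfold o_def, rule prod.cong)
    fix i
    show "(\<integral>\<^sup>+z. f (e i) z \<partial>lborel) = (if i = j then ennreal (exp (c\<^sup>2 * s\<^sup>2 / 2)) else 1)"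
    proof (cases "i = j")
      case True
      then show ?thesis using nn_integral_normal_exp[OF s, of c] by (simp add: f_def)
    next
      case False
      then have "e i \<noteq> e j" using inj by (simp add: inj_eq)
      then show ?thesis using False nn_integral_normal_exp[OF s, of 0] by (simp add: f_def)
    qed
  qed simp
  also have "\<dots> = ennreal (exp (c\<^sup>2 * s\<^sup>2 / 2))" by (simp add: prod.delta)
  finally show ?thesis .
qed

text \<open>
The set \<open>G\<close> is meant to be the set of outcomes with a continuous path started at 0. Setting the process to 0 elsewhere makes
every path continuous without changing any law.
\<close>

definition coordinate :: "'w set \<Rightarrow> (real \<Rightarrow> 'w \<Rightarrow> real ^ 'n) \<Rightarrow> 'n \<Rightarrow> real \<Rightarrow> 'w \<Rightarrow> real" where
  "coordinate G W j t \<omega> = (if \<omega> \<in> G \<and> 0 < t then W t \<omega> $ j else 0)"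

lemma (in standard_brownian_motion) gaussian_path_coordinate:
  fixes j :: 'd
  assumes G: "G \<in> sets M" "AE \<omega> in M. \<omega> \<in> G"
    and zero: "\<And>\<omega>. \<omega> \<in> G \<Longrightarrow> W 0 \<omega> = 0"
    and cont: "\<And>\<omega>. \<omega> \<in> G \<Longrightarrow> continuous_on {0..} (\<lambda>t. W t \<omega>)"
  shows "gaussian_path M (coordinate G W j)"
proof (unfold_locales)
  fix t
  have nth [measurable]: "(\<lambda>x::real ^ 'd. x $ j) \<in> borel_measurable borel"
    by (intro borel_measurable_continuous_onI continuous_intros)
  show "coordinate G W j t \<in> borel_measurable M"
  proof (cases "0 < t")
    case True
    then have [measurable]: "W t \<in> borel_measurable M" by (intro measurable_W) simp
    have "(\<lambda>\<omega>. if \<omega> \<in> G then W t \<omega> $ j else 0) \<in> borel_measurable M"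
      using G(1) by measurable
    then show ?thesis using True by (simp add: coordinate_def [abs_def])
  qed (simp add: coordinate_def [abs_def])
  show "coordinate G W j t \<omega> = 0" if "t \<le> 0" for \<omega> using that by (simp add: coordinate_def)
next
  fix \<omega>
  show "continuous_on UNIV (\<lambda>t. coordinate G W j t \<omega>)"
  proof (cases "\<omega> \<in> G")
    case True
    have "continuous_on UNIV (\<lambda>t. W (max t 0) \<omega>)"
      by (rule continuous_on_compose2[OF cont[OF True]]) (auto intro!: continuous_intros)
    then have "continuous_on UNIV (\<lambda>t. W (max t 0) \<omega> $ j)" by (intro continuous_intros)
    moreover have "W (max t 0) \<omega> $ j = coordinate G W j t \<omega>" for t
      using True zero[OF True] by (simp add: coordinate_def max_def)
    ultimately show ?thesis by simp
  qed (simp add: coordinate_def)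
next
  fix \<tau> :: "nat \<Rightarrow> real" and m :: nat and c :: "nat \<Rightarrow> real"
  assume \<tau>0: "0 \<le> \<tau> 0" and mono: "\<And>i. i < m \<Longrightarrow> \<tau> i \<le> \<tau> (Suc i)"
  have nth [measurable]: "(\<lambda>x::real ^ 'd. x $ j) \<in> borel_measurable borel"
    by (intro borel_measurable_continuous_onI continuous_intros)
  have \<tau>nn: "i \<le> m \<Longrightarrow> 0 \<le> \<tau> i" for i
  proof (induction i)
    case (Suc i)
    then show ?case using mono[of i] by simp
  qed (use \<tau>0 in simp)
  let ?D = "\<lambda>i \<omega>. W (\<tau> (Suc i)) \<omega> - W (\<tau> i) \<omega>"
  have "(\<integral>\<^sup>+\<omega>. ennreal (exp (\<Sum>i<m. c i * (coordinate G W j (\<tau> (Suc i)) \<omega> - coordinate G W j (\<tau> i) \<omega>))) \<partial>M)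
     = (\<integral>\<^sup>+\<omega>. (\<Prod>i<m. ennreal (exp (c i * ?D i \<omega> $ j))) \<partial>M)"
  proof (rule nn_integral_cong_AE)
    show "AE \<omega> in M. ennreal (exp (\<Sum>i<m. c i * (coordinate G W j (\<tau> (Suc i)) \<omega> - coordinate G W j (\<tau> i) \<omega>)))
       = (\<Prod>i<m. ennreal (exp (c i * ?D i \<omega> $ j)))"
      using G(2)
    proof eventually_elim
      case (elim \<omega>)
      have co: "coordinate G W j (\<tau> i) \<omega> = W (\<tau> i) \<omega> $ j" if "i \<le> m" for i
        using elim zero[OF elim] \<tau>nn[OF that] by (cases "\<tau> i = 0") (auto simp: coordinate_def)
      have "(\<Sum>i<m. c i * (coordinate G W j (\<tau> (Suc i)) \<omega> - coordinate G W j (\<tau> i) \<omega>)) = (\<Sum>i<m. c i * ?D i \<omega> $ j)"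
        by (intro sum.cong) (auto simp: co)
      then show ?case by (simp add: exp_sum prod_ennreal)
    qed
  qed
  also have "\<dots> = (\<Prod>i<m. \<integral>\<^sup>+\<omega>. ennreal (exp (c i * ?D i \<omega> $ j)) \<partial>M)"
  proof (rule indep_vars_nn_integral)
    show "indep_vars (\<lambda>_. borel) (\<lambda>i \<omega>. ennreal (exp (c i * ?D i \<omega> $ j))) {..<m}"
      by (rule indep_vars_compose2[OF indep_increments[OF \<tau>0 mono], where Y = "\<lambda>i x. ennreal (exp (c i * x $ j))" and N = "\<lambda>_. borel"])
         auto
  qed auto
  also have "\<dots> \<le> (\<Prod>i<m. ennreal (exp ((c i)\<^sup>2 * (\<tau> (Suc i) - \<tau> i) / 2)))"
  proof (rule prod_mono_ennreal)
    fix i assume "i \<in> {..<m}"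
    then have i: "\<tau> i \<le> \<tau> (Suc i)" "0 \<le> \<tau> i" using mono \<tau>nn by auto
    show "(\<integral>\<^sup>+\<omega>. ennreal (exp (c i * ?D i \<omega> $ j)) \<partial>M) \<le> ennreal (exp ((c i)\<^sup>2 * (\<tau> (Suc i) - \<tau> i) / 2))"
    proof (cases "\<tau> i = \<tau> (Suc i)")
      case True
      then show ?thesis by (simp add: emeasure_space_1)
    next
      case False
      then have lt: "\<tau> i < \<tau> (Suc i)" using i by simp
      have "(\<integral>\<^sup>+\<omega>. ennreal (exp (c i * ?D i \<omega> $ j)) \<partial>M)
         = (\<integral>\<^sup>+x. ennreal (\<Prod>l\<in>UNIV. normal_density 0 (sqrt (\<tau> (Suc i) - \<tau> i)) (x $ l)) * ennreal (exp (c i * x $ j)) \<partial>lborel)"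
        by (rule distributed_nn_integral[OF normal_increments[OF i(2) lt], symmetric]) measurable
      also have "\<dots> = ennreal (exp ((c i)\<^sup>2 * (sqrt (\<tau> (Suc i) - \<tau> i))\<^sup>2 / 2))"
        using lt by (intro nn_integral_normal_vec_exp) simp
      finally show ?thesis using lt by simp
    qed
  qed
  also have "\<dots> = ennreal (exp ((\<Sum>i<m. (c i)\<^sup>2 * (\<tau> (Suc i) - \<tau> i)) / 2))"
    by (simp add: prod_ennreal exp_sum sum_divide_distrib)
  finally show "(\<integral>\<^sup>+\<omega>. ennreal (exp (\<Sum>i<m. c i * (coordinate G W j (\<tau> (Suc i)) \<omega> - coordinate G W j (\<tau> i) \<omega>))) \<partial>M)
        \<le> ennreal (exp ((\<Sum>i<m. (c i)\<^sup>2 * (\<tau> (Suc i) - \<tau> i)) / 2))" .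
qed

section \<open>Differentiating the smooth approximation\<close>

text \<open>
Differentiation under the integral sign. The difference quotients of the kernel are dominated by
\<open>G\<close> through the mean value theorem; \<open>w\<close> itself may be as rough as a Brownian path.
\<close>

lemma has_vector_derivative_kernel_integral:
  fixes w :: "real \<Rightarrow> 'v::{banach, second_countable_topology}" and g g' :: "real \<Rightarrow> real \<Rightarrow> real"
  assumes S: "open S" "convex S" "k \<in> S"
    and deriv: "\<And>x u. x \<in> S \<Longrightarrow> ((\<lambda>x. g x u) has_real_derivative g' x u) (at x)"
    and dom: "\<And>x u. x \<in> S \<Longrightarrow> \<bar>g' x u\<bar> \<le> G u"
    and G: "integrable lborel (\<lambda>u. G u *\<^sub>R w u)"
    and w [measurable]: "w \<in> borel_measurable borel"
    and gi: "\<And>x. x \<in> S \<Longrightarrow> integrable lborel (\<lambda>u. g x u *\<^sub>R w u)"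
    and g' [measurable]: "g' k \<in> borel_measurable borel"
  shows "integrable lborel (\<lambda>u. g' k u *\<^sub>R w u)"
    and "((\<lambda>x. LINT u|lborel. g x u *\<^sub>R w u) has_vector_derivative (LINT u|lborel. g' k u *\<^sub>R w u)) (at k)"
proof -
  have G0: "0 \<le> G u" for u using dom[OF S(3), of u] by linarith
  show g'i: "integrable lborel (\<lambda>u. g' k u *\<^sub>R w u)"
  proof (rule Bochner_Integration.integrable_bound[OF G])
    show "AE u in lborel. norm (g' k u *\<^sub>R w u) \<le> norm (G u *\<^sub>R w u)"
      using dom[OF S(3)] G0 by (intro AE_I2) (simp add: mult_right_mono)
  qed measurable
  define U where "U x = (LINT u|lborel. g x u *\<^sub>R w u)" for x
  define V where "V = (LINT u|lborel. g' k u *\<^sub>R w u)"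
  have "(U has_vector_derivative V) (at k within S)"
    unfolding has_vector_derivative_def has_derivative_within
  proof (intro conjI)
    show "bounded_linear (\<lambda>x. x *\<^sub>R V)" by (rule bounded_linear_scaleR_left)
    show "((\<lambda>x. (1 / norm (x - k)) *\<^sub>R (U x - (U k + (x - k) *\<^sub>R V))) \<longlongrightarrow> 0) (at k within S)"
      unfolding tendsto_at_iff_sequentially o_def
    proof (intro allI impI)
      fix X assume X: "\<forall>i. X i \<in> S - {k}" and Xk: "X \<longlonglongrightarrow> k"
      define r where "r i u = (g (X i) u - g k u - (X i - k) * g' k u) / \<bar>X i - k\<bar>" for i u
      have comb: "(1 / norm (X i - k)) *\<^sub>R (g (X i) u *\<^sub>R w u - (g k u *\<^sub>R w u + (X i - k) *\<^sub>R (g' k u *\<^sub>R w u)))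
          = r i u *\<^sub>R w u" for i u
      proof -
        have "g (X i) u *\<^sub>R w u - (g k u *\<^sub>R w u + (X i - k) *\<^sub>R (g' k u *\<^sub>R w u))
          = (g (X i) u - g k u - (X i - k) * g' k u) *\<^sub>R w u"
          by (simp add: scaleR_diff_left)
        then show ?thesis by (simp add: r_def)
      qed
      have rw: "(1 / norm (X i - k)) *\<^sub>R (U (X i) - (U k + (X i - k) *\<^sub>R V)) = (LINT u|lborel. r i u *\<^sub>R w u)" for i
      proof -
        have lin: "U (X i) - (U k + (X i - k) *\<^sub>R V)
          = (LINT u|lborel. g (X i) u *\<^sub>R w u - (g k u *\<^sub>R w u + (X i - k) *\<^sub>R (g' k u *\<^sub>R w u)))"
        proof -
          have Xi: "X i \<in> S" using X by auto
          note i2 = integrable_scaleR_right[OF g'i, of "X i - k"]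
          note i3 = Bochner_Integration.integrable_add[OF gi[OF S(3)] i2]
          show ?thesis
            unfolding U_def V_def Bochner_Integration.integral_diff[OF gi[OF Xi] i3]
              Bochner_Integration.integral_add[OF gi[OF S(3)] i2] integral_scaleR_right ..
        qed
        have "(1 / norm (X i - k)) *\<^sub>R (U (X i) - (U k + (X i - k) *\<^sub>R V)) = (LINT u|lborel. (1 / norm (X i - k)) *\<^sub>R (g (X i) u *\<^sub>R w u - (g k u *\<^sub>R w u + (X i - k) *\<^sub>R (g' k u *\<^sub>R w u))))"
          unfolding lin by (rule integral_scaleR_right[symmetric])
        also have "\<dots> = (LINT u|lborel. r i u *\<^sub>R w u)"
          by (rule Bochner_Integration.integral_cong[OF refl comb])
        finally show ?thesis .
      qed
      have ri: "(\<lambda>u. r i u *\<^sub>R w u) \<in> borel_measurable lborel" for i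
      proof -
        have "integrable lborel (\<lambda>u. (1 / norm (X i - k)) *\<^sub>R (g (X i) u *\<^sub>R w u - (g k u *\<^sub>R w u + (X i - k) *\<^sub>R (g' k u *\<^sub>R w u))))"
          by (intro integrable_scaleR_right Bochner_Integration.integrable_diff Bochner_Integration.integrable_add
                gi S(3) g'i) (use X in auto)
        then show ?thesis unfolding comb by (rule borel_measurable_integrable)
      qed
      have rb: "\<bar>r i u\<bar> \<le> 2 * G u" for i u
      proof -
        have Xi: "X i \<in> S" "X i \<noteq> k" using X by auto
        have "norm (g (X i) u - g k u) \<le> G u * norm (X i - k)"
          by (rule field_differentiable_bound[OF S(2), where f' = "\<lambda>x. g' x u"])
             (use Xi S(3) dom deriv in \<open>auto intro: has_field_derivative_at_within\<close>)
        moreover have "\<bar>(X i - k) * g' k u\<bar> \<le> G u * \<bar>X i - k\<bar>"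
          using mult_right_mono[OF dom[OF S(3), of u], of "\<bar>X i - k\<bar>"] by (simp add: abs_mult mult.commute)
        ultimately have "\<bar>g (X i) u - g k u - (X i - k) * g' k u\<bar> \<le> (2 * G u) * \<bar>X i - k\<bar>"
          unfolding real_norm_def by linarith
        then show ?thesis using Xi by (simp add: r_def pos_divide_le_eq)
      qed
      have rl: "(\<lambda>i. r i u) \<longlonglongrightarrow> 0" for u
      proof -
        have "((\<lambda>x. (g x u - g k u) / (x - k)) \<longlongrightarrow> g' k u) (at k)"
          using deriv[OF S(3), of u] by (simp add: has_field_derivative_iff)
        then have "(\<lambda>i. (g (X i) u - g k u) / (X i - k)) \<longlonglongrightarrow> g' k u"
          using X Xk unfolding tendsto_at_iff_sequentially o_def by auto
        then have "(\<lambda>i. (g (X i) u - g k u) / (X i - k) - g' k u) \<longlonglongrightarrow> 0"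
          by (simp add: LIM_zero)
        then have "(\<lambda>i. \<bar>(g (X i) u - g k u) / (X i - k) - g' k u\<bar>) \<longlonglongrightarrow> 0"
          by (rule tendsto_rabs_zero)
        moreover have "\<bar>r i u\<bar> = \<bar>(g (X i) u - g k u) / (X i - k) - g' k u\<bar>" for i
        proof -
          have "X i - k \<noteq> 0" using X by auto
          then have "(g (X i) u - g k u) / (X i - k) - g' k u = (g (X i) u - g k u - (X i - k) * g' k u) / (X i - k)"
            by (simp add: field_simps)
          then show ?thesis by (simp add: r_def)
        qed
        ultimately have "(\<lambda>i. \<bar>r i u\<bar>) \<longlonglongrightarrow> 0" by simp
        then show ?thesis by (rule tendsto_rabs_zero_cancel)
      qed
      have "(\<lambda>i. LINT u|lborel. r i u *\<^sub>R w u) \<longlonglongrightarrow> integral\<^sup>L lborel (\<lambda>u::real. (0::'v))"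
      proof (rule integral_dominated_convergence[where w = "\<lambda>u. 2 * norm (G u *\<^sub>R w u)"])
        show "AE u in lborel. (\<lambda>i. r i u *\<^sub>R w u) \<longlonglongrightarrow> 0"
        proof (rule AE_I2)
          fix u
          show "(\<lambda>i. r i u *\<^sub>R w u) \<longlonglongrightarrow> 0"
            using tendsto_scaleR[OF rl[of u] tendsto_const[of "w u"]] by (simp only: scaleR_zero_left)
        qed
        show "AE u in lborel. norm (r i u *\<^sub>R w u) \<le> 2 * norm (G u *\<^sub>R w u)" for i
        proof (rule AE_I2)
          fix u
          show "norm (r i u *\<^sub>R w u) \<le> 2 * norm (G u *\<^sub>R w u)"
            using mult_right_mono[OF rb[of i u], of "norm (w u)"] G0[of u] by simp
        qed
        show "integrable lborel (\<lambda>u. 2 * norm (G u *\<^sub>R w u))"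
          by (intro integrable_mult_right integrable_norm G)
      qed (use ri in auto)
      then show "(\<lambda>i. (1 / norm (X i - k)) *\<^sub>R (U (X i) - (U k + (X i - k) *\<^sub>R V))) \<longlonglongrightarrow> 0"
        unfolding rw by simp
    qed
  qed
  then show "((\<lambda>x. LINT u|lborel. g x u *\<^sub>R w u) has_vector_derivative (LINT u|lborel. g' k u *\<^sub>R w u)) (at k)"
    unfolding U_def [abs_def] V_def at_within_open[OF S(3,1)] .
qed

text \<open>
The recursion says that a particle moves by \<open>\<alpha>\<close> times its distance to its predecessor. So this distance
is a time increment of a single particle, which is a weighted sum of increments of the leader.
\<close>

lemma conga_speed:
  fixes w :: "real \<Rightarrow> 'v::real_vector"
  assumes "\<alpha> \<noteq> 0" "w 0 = 0"
  shows "conga \<alpha> w (k + 2) n - conga \<alpha> w (k + 1) n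
    = - (1 / \<alpha>) *\<^sub>R (\<Sum>m\<le>n. delay_prob \<alpha> (Suc k) (int m) *\<^sub>R (w (real n + 1 - real m) - w (real n - real m)))"
proof -
  let ?c = "conga \<alpha> w (Suc (Suc k))"
  have "?c (Suc n) - ?c n = - (\<alpha> *\<^sub>R (conga \<alpha> w (k + 2) n - conga \<alpha> w (k + 1) n))"
    by (simp add: algebra_simps)
  then have "conga \<alpha> w (k + 2) n - conga \<alpha> w (k + 1) n = - (1 / \<alpha>) *\<^sub>R (?c (Suc n) - ?c n)"
    using assms(1) by simp
  also have "?c (Suc n) - ?c n
      = (\<Sum>m\<le>n. delay_prob \<alpha> (Suc k) (int m) *\<^sub>R (w (real n + 1 - real m) - w (real n - real m)))"
    unfolding conga_eq_sum_delay_prob using assms(2)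
    by (simp add: scaleR_diff_right sum_subtractf add.commute)
  finally show ?thesis .
qed

lemma ubar_eq_heat_integral:
  fixes w :: "real \<Rightarrow> 'v::{banach, second_countable_topology}"
  assumes [measurable]: "w \<in> borel_measurable borel"
  shows "ubar \<alpha> w x t = (LINT u|lborel. heat_kernel \<alpha> x (t - x / \<alpha> - u) *\<^sub>R w u)"
proof -
  have "ubar \<alpha> w x t = (LINT z|lborel. heat_kernel \<alpha> x z *\<^sub>R w (t - x / \<alpha> - z))"
    unfolding ubar_def heat_kernel_def by (subst integral_density) auto
  also have "\<dots> = \<bar>-1\<bar> *\<^sub>R (LINT u|lborel. heat_kernel \<alpha> x ((t - x / \<alpha>) + (-1) * u) *\<^sub>R w (t - x / \<alpha> - ((t - x / \<alpha>) + (-1) * u)))"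
    by (rule lborel_integral_real_affine) simp
  finally show ?thesis by simp
qed

lemma integrable_dominated_scaleR:
  fixes w :: "real \<Rightarrow> 'v::{banach, second_countable_topology}"
  assumes "integrable lborel (\<lambda>u. G u *\<^sub>R w u)" "h \<in> borel_measurable borel" "w \<in> borel_measurable borel"
    and "\<And>u. \<bar>h u\<bar> \<le> D * G u" "D \<ge> 0" "\<And>u. 0 \<le> G u"
  shows "integrable lborel (\<lambda>u. h u *\<^sub>R w u)"
proof (rule Bochner_Integration.integrable_bound)
  show "integrable lborel (\<lambda>u. D *\<^sub>R (G u *\<^sub>R w u))" using assms(1) by (rule integrable_scaleR_right)
  show "AE u in lborel. norm (h u *\<^sub>R w u) \<le> norm (D *\<^sub>R (G u *\<^sub>R w u))"
  proof (rule AE_I2)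
    fix u
    show "norm (h u *\<^sub>R w u) \<le> norm (D *\<^sub>R (G u *\<^sub>R w u))"
      using mult_right_mono[OF assms(4)[of u], of "norm (w u)"] assms(5,6) by simp
  qed
qed (use assms in measurable)

context
  fixes \<alpha> :: real
  assumes \<alpha>: "0 < \<alpha>" "\<alpha> < 1"
begin

text \<open>
The bounds must hold simultaneously for all \<open>x\<close> in a neighbourhood of \<open>k\<close>, with one and the same
exponential weight; the rate \<open>1 / (2 k)\<close> is at most \<open>1 / sqrt x\<close> on \<open>(k/2, 2 k)\<close>.
\<close>

lemma kernels_dominated_near:
  fixes k :: nat and t :: real
  assumes k: "k \<ge> 1" and t: "t \<ge> 0"
  obtains D where "D > 0"
    "\<And>x u. real k / 2 < x \<Longrightarrow> x < 2 * real k \<Longrightarrow> \<bar>heat_kernel \<alpha> x (t - x / \<alpha> - u)\<bar> \<le> D * exp (- (1 / (2 * real k)) * \<bar>u\<bar>)"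
    "\<And>x u. real k / 2 < x \<Longrightarrow> x < 2 * real k \<Longrightarrow> \<bar>drift_kernel \<alpha> x (t - x / \<alpha> - u)\<bar> \<le> D * exp (- (1 / (2 * real k)) * \<bar>u\<bar>)"
proof -
  obtain C where C: "C > 0"
    and heat: "\<And>x y. x \<ge> 1/2 \<Longrightarrow> heat_kernel \<alpha> x y \<le> C / sqrt x * exp (- \<bar>y\<bar> / sqrt x)"
    and drift: "\<And>x y. x \<ge> 1/2 \<Longrightarrow> \<bar>drift_kernel \<alpha> x y\<bar> \<le> C / x * exp (- \<bar>y\<bar> / sqrt x)"
    using kernel_envelopes[OF \<alpha>] by metis
  define R where "R = (t + 2 * real k / \<alpha>) / (2 * real k)"
  define D where "D = 2 * C * exp R"
  have main: "1 / sqrt x \<le> 2 \<and> 1 / x \<le> 2 \<and> 1 / 2 \<le> x \<and>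
      exp (- \<bar>t - x / \<alpha> - u\<bar> / sqrt x) \<le> exp R * exp (- (1 / (2 * real k)) * \<bar>u\<bar>)"
    if x: "real k / 2 < x" "x < 2 * real k" for x u
  proof (intro conjI)
    have "1 \<le> real k" using k by simp
    then have x2: "1 / 2 \<le> x" using x by linarith
    then show "1 / 2 \<le> x" .
    have xp: "x > 0" using x2 by simp
    show "1 / x \<le> 2" using x2 by (simp add: field_simps)
    have "1 / 2 \<le> sqrt x" using x2 by (intro real_le_rsqrt) (simp add: power2_eq_square)
    then show "1 / sqrt x \<le> 2" using xp by (simp add: field_simps)
    have sx: "sqrt x \<le> 2 * real k"
    proof -
      have "x \<le> (2 * real k)\<^sup>2"
      proof -
        have "x \<le> 2 * real k * 1" using x by simp
        also have "\<dots> \<le> 2 * real k * (2 * real k)" using k by (intro mult_left_mono) auto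
        finally show ?thesis by (simp add: power2_eq_square)
      qed
      then show ?thesis using k by (intro real_le_lsqrt) (use xp in auto)
    qed
    have "x / \<alpha> \<le> 2 * real k / \<alpha>" using x \<alpha> by (intro divide_right_mono) auto
    moreover have "0 \<le> x / \<alpha>" using xp \<alpha> by simp
    ultimately have "\<bar>u\<bar> - (t + 2 * real k / \<alpha>) \<le> \<bar>t - x / \<alpha> - u\<bar>" using t by linarith
    then have "(\<bar>u\<bar> - (t + 2 * real k / \<alpha>)) / (2 * real k) \<le> \<bar>t - x / \<alpha> - u\<bar> / (2 * real k)"
      using k by (intro divide_right_mono) auto
    also have "\<dots> \<le> \<bar>t - x / \<alpha> - u\<bar> / sqrt x" using sx xp k by (intro divide_left_mono) auto
    finally have "\<bar>u\<bar> / (2 * real k) - R \<le> \<bar>t - x / \<alpha> - u\<bar> / sqrt x" by (simp add: R_def diff_divide_distrib)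
    then show "exp (- \<bar>t - x / \<alpha> - u\<bar> / sqrt x) \<le> exp R * exp (- (1 / (2 * real k)) * \<bar>u\<bar>)"
      by (simp flip: exp_add)
  qed
  show ?thesis
  proof (rule that)
    show "D > 0" using C by (simp add: D_def)
    fix x u assume x: "real k / 2 < x" "x < 2 * real k"
    note m = main[OF x, of u]
    have "\<bar>heat_kernel \<alpha> x (t - x / \<alpha> - u)\<bar> \<le> C * (1 / sqrt x) * exp (- \<bar>t - x / \<alpha> - u\<bar> / sqrt x)"
      using heat[of x "t - x / \<alpha> - u"] heat_kernel_nonneg[OF \<alpha>] m by simp
    also have "\<dots> \<le> C * 2 * (exp R * exp (- (1 / (2 * real k)) * \<bar>u\<bar>))"
      using m C by (intro mult_mono) auto
    finally show "\<bar>heat_kernel \<alpha> x (t - x / \<alpha> - u)\<bar> \<le> D * exp (- (1 / (2 * real k)) * \<bar>u\<bar>)"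
      by (simp add: D_def mult_ac)
    have "\<bar>drift_kernel \<alpha> x (t - x / \<alpha> - u)\<bar> \<le> C * (1 / x) * exp (- \<bar>t - x / \<alpha> - u\<bar> / sqrt x)"
      using drift[of x "t - x / \<alpha> - u"] m by simp
    also have "\<dots> \<le> C * 2 * (exp R * exp (- (1 / (2 * real k)) * \<bar>u\<bar>))"
      using m C by (intro mult_mono) auto
    finally show "\<bar>drift_kernel \<alpha> x (t - x / \<alpha> - u)\<bar> \<le> D * exp (- (1 / (2 * real k)) * \<bar>u\<bar>)"
      by (simp add: D_def mult_ac)
  qed
qed

lemma heat_kernel_measurable: "(\<lambda>u. heat_kernel \<alpha> x (a - u)) \<in> borel_measurable borel"
  unfolding heat_kernel_def by measurable

lemma drift_kernel_measurable: "(\<lambda>u. drift_kernel \<alpha> x (a - u)) \<in> borel_measurable borel"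
  unfolding drift_kernel_def heat_kernel_def by measurable

lemma ubar_dx_ubar_kernels:
  fixes w :: "real \<Rightarrow> 'v::{banach, second_countable_topology}" and k :: nat
  assumes k: "k \<ge> 1" and t: "t \<ge> 0" and w: "w \<in> borel_measurable borel"
    and wi: "integrable lborel (\<lambda>u. exp (- (1 / (2 * real k)) * \<bar>u\<bar>) *\<^sub>R w u)"
  shows "integrable lborel (\<lambda>u. heat_kernel \<alpha> k (t - k / \<alpha> - u) *\<^sub>R w u)"
    and "integrable lborel (\<lambda>u. drift_kernel \<alpha> k (t - k / \<alpha> - u) *\<^sub>R w u)"
    and "dx_ubar \<alpha> w k t = (LINT u|lborel. drift_kernel \<alpha> k (t - k / \<alpha> - u) *\<^sub>R w u)"
proof -
  obtain D where D: "D > 0"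
    and hD: "\<And>x u. real k / 2 < x \<Longrightarrow> x < 2 * real k \<Longrightarrow> \<bar>heat_kernel \<alpha> x (t - x / \<alpha> - u)\<bar> \<le> D * exp (- (1 / (2 * real k)) * \<bar>u\<bar>)"
    and dD: "\<And>x u. real k / 2 < x \<Longrightarrow> x < 2 * real k \<Longrightarrow> \<bar>drift_kernel \<alpha> x (t - x / \<alpha> - u)\<bar> \<le> D * exp (- (1 / (2 * real k)) * \<bar>u\<bar>)"
    using kernels_dominated_near[OF k t] by metis
  define S where "S = {real k / 2<..<2 * real k}"
  have kS: "real k \<in> S" using k by (simp add: S_def)
  have heat_int: "integrable lborel (\<lambda>u. heat_kernel \<alpha> x (t - x / \<alpha> - u) *\<^sub>R w u)" if "x \<in> S" for x
    using that D by (intro integrable_dominated_scaleR[OF wi heat_kernel_measurable w hD]) (auto simp: S_def)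
  show "integrable lborel (\<lambda>u. heat_kernel \<alpha> k (t - k / \<alpha> - u) *\<^sub>R w u)" by (rule heat_int[OF kS])
  have Gi: "integrable lborel (\<lambda>u. (D * exp (- (1 / (2 * real k)) * \<bar>u\<bar>)) *\<^sub>R w u)"
    using integrable_scaleR_right[OF wi, of D] by simp
  note der = has_vector_derivative_kernel_integral[of S "real k"
      "\<lambda>x u. heat_kernel \<alpha> x (t - x / \<alpha> - u)" "\<lambda>x u. drift_kernel \<alpha> x (t - x / \<alpha> - u)", OF _ _ kS _ _ Gi w heat_int]
  have deriv: "((\<lambda>x. heat_kernel \<alpha> x (t - x / \<alpha> - u)) has_real_derivative drift_kernel \<alpha> x (t - x / \<alpha> - u)) (at x)"
    if "x \<in> S" for x u
  proof -
    have "x > 0" using that k by (simp add: S_def)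
    from heat_kernel_DERIV_x[OF \<alpha> this, of "t - u"] show ?thesis by (simp add: algebra_simps)
  qed
  show "integrable lborel (\<lambda>u. drift_kernel \<alpha> k (t - k / \<alpha> - u) *\<^sub>R w u)"
    by (rule der(1)) (use deriv dD in \<open>auto simp: S_def drift_kernel_measurable\<close>)
  have "((\<lambda>x. LINT u|lborel. heat_kernel \<alpha> x (t - x / \<alpha> - u) *\<^sub>R w u) has_vector_derivative
      (LINT u|lborel. drift_kernel \<alpha> k (t - k / \<alpha> - u) *\<^sub>R w u)) (at (real k))"
    by (rule der(2)) (use deriv dD in \<open>auto simp: S_def drift_kernel_measurable\<close>)
  then show "dx_ubar \<alpha> w k t = (LINT u|lborel. drift_kernel \<alpha> k (t - k / \<alpha> - u) *\<^sub>R w u)"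
    unfolding dx_ubar_def ubar_eq_heat_integral[OF w] by (rule vector_derivative_at)
qed

end

lemma integral_vec_nth:
  fixes f :: "'a \<Rightarrow> real ^ 'n"
  assumes "integrable M f"
  shows "(LINT x|M. f x) $ i = (LINT x|M. f x $ i)"
  using integral_bounded_linear[OF bounded_linear_vec_nth assms, of i] by simp

lemma integrable_vecI:
  fixes f :: "'a \<Rightarrow> real ^ 'n"
  assumes "\<And>i. integrable M (\<lambda>x. f x $ i)"
  shows "integrable M f"
proof -
  have "integrable M (\<lambda>x. \<Sum>i\<in>UNIV. (f x $ i) *\<^sub>R axis i 1 :: real ^ 'n)"
    using assms by (intro Bochner_Integration.integrable_sum integrable_scaleR_left) auto
  moreover have "(\<Sum>i\<in>UNIV. (f x $ i) *\<^sub>R axis i 1) = f x" for x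
    using basis_expansion[of "f x"] by (simp add: scalar_mult_eq_scaleR)
  ultimately show ?thesis by simp
qed

section \<open>Tail bounds and the Borel--Cantelli argument\<close>

lemma norm_gt_imp_component:
  fixes v :: "real ^ 2"
  assumes "norm v > t"
  shows "\<exists>i. \<bar>v $ i\<bar> > t / 2"
proof (rule ccontr)
  assume "\<not> ?thesis"
  then have "\<bar>v $ i\<bar> \<le> t / 2" for i by (simp add: not_less)
  then have "(\<Sum>i\<in>UNIV. \<bar>v $ i\<bar>) \<le> real (card (UNIV :: 2 set)) * (t / 2)" by (intro sum_bounded_above) auto
  then show False using norm_le_l1_cart[of v] assms by simp
qed

lemma summable_stretched_exp:
  fixes c g :: real assumes "c > 0" "g > 0"
  shows "summable (\<lambda>n. real n * exp (- c * real n powr g))"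
proof -
  have "(\<lambda>n::nat. real n * exp (- c * real n powr g)) \<in> O(\<lambda>n. 1 / real n ^ 2)"
    using assms by real_asymp
  then obtain K where K: "eventually (\<lambda>n. norm (real n * exp (- c * real n powr g)) \<le> K * norm (1 / real n ^ 2)) sequentially"
    by (elim landau_o.bigE)
  show ?thesis
  proof (rule summable_comparison_test_ev)
    show "eventually (\<lambda>n. norm (real n * exp (- c * real n powr g)) \<le> K * (1 / real n ^ 2)) sequentially"
      using K by simp
    show "summable (\<lambda>n. K * (1 / real n ^ 2))"
      using inverse_power_summable[of 2, where 'a = real] by (intro summable_mult) (simp add: divide_inverse)
  qed
qed

text \<open>
The two error bounds with the parameters of \<open>lattice_envelopes\<close>: with rate \<open>e = c / sqrt k\<close>, a factor
\<open>1 / sqrt e\<close> is worth \<open>k powr (1/4)\<close> and a factor \<open>1 / e\<close> is worth \<open>k powr (1/2)\<close>.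
\<close>

lemma (in gaussian_path) subgauss_conga_errors:
  fixes \<alpha> d :: real
  assumes \<alpha>: "0 < \<alpha>" "\<alpha> < 1" and C: "C > 0" and c: "0 < c" "c \<le> 1" and d: "0 < d" "d < 1"
    and heat: "\<And>y. heat_kernel \<alpha> k y \<le> C / sqrt k * exp (- (c / sqrt k) * \<bar>y\<bar>)"
    and drift: "\<And>y. \<bar>drift_kernel \<alpha> k y\<bar> \<le> C * k powr (d - 1) * exp (- (c / sqrt k) * \<bar>y\<bar>)"
    and delay_prob: "\<And>m y. \<bar>m - k / \<alpha> - y\<bar> \<le> 1 \<Longrightarrow>
       \<bar>delay_prob \<alpha> k m - heat_kernel \<alpha> k y\<bar> \<le> C * k powr (d - 1) * exp (- (c / sqrt k) * \<bar>y\<bar>)"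
    and flux: "\<And>m. \<bar>delay_prob \<alpha> (Suc k) m / \<alpha> - flux_kernel \<alpha> k (m - k / \<alpha>)\<bar>
          \<le> C * k powr (d - 1) * exp (- (c / sqrt k) * \<bar>m - k / \<alpha>\<bar>)"
    and k: "k \<ge> 1"
  shows "subgauss M (13 * C / (c * sqrt c) * k powr (d - 1/4))
    (\<lambda>\<omega>. (\<Sum>m\<le>n. delay_prob \<alpha> k (int m) * b (real n - real m) \<omega>)
        - (LINT u|lborel. heat_kernel \<alpha> k (n - k / \<alpha> - u) * b u \<omega>))" (is "subgauss M _ ?D")
    and "subgauss M (13 * C / (c * sqrt c) * k powr (d - 3/4))
    (\<lambda>\<omega>. - (\<Sum>m\<le>n. delay_prob \<alpha> (Suc k) (int m) * (b (real n + 1 - real m) \<omega> - b (real n - real m) \<omega>)) / \<alpha>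
        - (LINT u|lborel. drift_kernel \<alpha> k (n - k / \<alpha> - u) * b u \<omega>))" (is "subgauss M _ ?E")
proof -
  have kp: "real k > 0" "real k \<ge> 1" "sqrt k \<ge> 1" using k by auto
  define e where "e = c / sqrt k"
  have e: "0 < e" using c kp by (auto simp: e_def)
  have e1: "e \<le> 1"
    unfolding e_def using order_trans[OF c(2) kp(3)] kp(3) by (subst divide_le_eq_1_pos) auto
  have se: "1 / sqrt e = k powr (1/4) / sqrt c"
  proof -
    have "sqrt (sqrt k) = (k powr (1/2)) powr (1/2)" using kp by (simp add: powr_half_sqrt)
    also have "\<dots> = k powr (1/4)" by (simp add: powr_powr)
    finally show ?thesis by (simp add: e_def real_sqrt_divide)
  qed
  have ie: "1 / e = k powr (1/2) / c" using kp by (simp add: e_def powr_half_sqrt)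
  have cc: "c * sqrt c \<le> sqrt c" using c by (simp add: mult_left_le_one_le)
  have cp: "c * sqrt c > 0" using c by simp
  have "subgauss M (4 * (C * k powr (d - 1)) / (e * sqrt e) + 3 * (C / sqrt k) / sqrt e) ?D"
    by (rule subgauss_position_error[OF \<alpha> k]) (use heat delay_prob C kp e e1 in \<open>auto simp: e_def\<close>)
  then show "subgauss M (13 * C / (c * sqrt c) * k powr (d - 1/4)) ?D"
  proof (rule subgauss_mono)
    have "4 * (C * k powr (d - 1)) / (e * sqrt e) = 4 * C * k powr (d - 1) * (1 / e) * (1 / sqrt e)" by simp
    also have "\<dots> = 4 * C / (c * sqrt c) * (k powr (d - 1) * k powr (1/2) * k powr (1/4))"
      unfolding ie se by simp
    also have "k powr (d - 1) * k powr (1/2) * k powr (1/4) = k powr (d - 1/4)"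
      by (simp flip: powr_add)
    finally have 1: "4 * (C * k powr (d - 1)) / (e * sqrt e) = 4 * C / (c * sqrt c) * k powr (d - 1/4)" .
    have "3 * (C / sqrt k) / sqrt e = 3 * C * (1 / sqrt k) * (1 / sqrt e)" by simp
    also have "1 / sqrt k = k powr (-1/2)" using kp powr_minus_divide[of "real k" "1/2"] by (simp add: powr_half_sqrt)
    also have "3 * C * k powr (-1/2) * (1 / sqrt e) = 3 * C / sqrt c * (k powr (-1/2) * k powr (1/4))"
      unfolding se by simp
    also have "k powr (-1/2) * k powr (1/4) = k powr (-1/4)" by (simp flip: powr_add)
    also have "3 * C / sqrt c * k powr (-1/4) \<le> 3 * C / (c * sqrt c) * k powr (d - 1/4)"
      using C c cc cp kp d by (intro mult_mono divide_left_mono powr_mono mult_pos_pos) auto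
    finally have 2: "3 * (C / sqrt k) / sqrt e \<le> 3 * C / (c * sqrt c) * k powr (d - 1/4)" .
    have "4 * (C * k powr (d - 1)) / (e * sqrt e) + 3 * (C / sqrt k) / sqrt e \<le> 7 * C / (c * sqrt c) * k powr (d - 1/4)"
      using 1 2 by (simp add: add_divide_distrib distrib_right)
    also have "\<dots> \<le> 13 * C / (c * sqrt c) * k powr (d - 1/4)"
      using C cp by (intro mult_right_mono divide_right_mono) auto
    finally show "\<bar>4 * (C * k powr (d - 1)) / (e * sqrt e) + 3 * (C / sqrt k) / sqrt e\<bar> \<le> 13 * C / (c * sqrt c) * k powr (d - 1/4)"
      using C e kp by (subst abs_of_nonneg) auto
  qed
  have "subgauss M (6 * (C * k powr (d - 1)) / sqrt e) ?E"
    by (rule subgauss_velocity_error[OF \<alpha> k]) (use drift flux C kp e e1 in \<open>auto simp: e_def\<close>)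
  then show "subgauss M (13 * C / (c * sqrt c) * k powr (d - 3/4)) ?E"
  proof (rule subgauss_mono)
    have "6 * (C * k powr (d - 1)) / sqrt e = 6 * C * k powr (d - 1) * (1 / sqrt e)" by simp
    also have "\<dots> = 6 * C / sqrt c * (k powr (d - 1) * k powr (1/4))" unfolding se by simp
    also have "k powr (d - 1) * k powr (1/4) = k powr (d - 3/4)" by (simp flip: powr_add)
    also have "6 * C / sqrt c * k powr (d - 3/4) \<le> 13 * C / (c * sqrt c) * k powr (d - 3/4)"
      using C c cc cp by (intro mult_right_mono frac_le) auto
    finally show "\<bar>6 * (C * k powr (d - 1)) / sqrt e\<bar> \<le> 13 * C / (c * sqrt c) * k powr (d - 3/4)"
      using C e kp by (subst abs_of_nonneg) auto
  qed
qed

text \<open>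
The threshold exceeds the standard deviation by the factor \<open>k powr (\<eta> - d)\<close>, whose square is at least
\<open>k powr \<eta>\<close>.
\<close>

lemma (in prob_space) subgauss_powr_tail:
  assumes Y: "subgauss M (K * real k powr (d - r)) Y" and K: "K > 0" and k: "k \<ge> 1"
    and \<mu>: "\<mu> > 0" and d: "2 * d \<le> \<eta>"
  shows "prob {\<omega> \<in> space M. \<bar>Y \<omega>\<bar> > \<mu> * real k powr (- (r - \<eta>)) / 2} \<le> 2 * exp (- (\<mu>\<^sup>2 / (8 * K\<^sup>2)) * real k powr \<eta>)"
proof -
  have kp: "real k > 0" "real k \<ge> 1" using k by auto
  let ?a = "\<mu> * real k powr (- (r - \<eta>)) / 2" and ?s = "K * real k powr (d - r)"
  have expo: "- ?a\<^sup>2 / (2 * ?s\<^sup>2) = - (\<mu>\<^sup>2 / (8 * K\<^sup>2) * real k powr (2 * (\<eta> - d)))"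
  proof -
    have "?a\<^sup>2 / (2 * ?s\<^sup>2) = \<mu>\<^sup>2 / (8 * K\<^sup>2) * (real k powr (- (r - \<eta>)) / real k powr (d - r))\<^sup>2"
      by (simp add: power_divide power_mult_distrib)
    also have "real k powr (- (r - \<eta>)) / real k powr (d - r) = real k powr (\<eta> - d)"
      by (simp flip: powr_diff)
    also have "(real k powr (\<eta> - d))\<^sup>2 = real k powr (2 * (\<eta> - d))"
      using kp by (simp add: powr_power mult.commute)
    finally show ?thesis by simp
  qed
  have "prob {\<omega> \<in> space M. \<bar>Y \<omega>\<bar> > ?a} \<le> 2 * exp (- ?a\<^sup>2 / (2 * ?s\<^sup>2))"
    using K \<mu> kp by (intro subgauss_tail[OF Y]) auto
  also have "\<dots> = 2 * exp (- (\<mu>\<^sup>2 / (8 * K\<^sup>2) * real k powr (2 * (\<eta> - d))))"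
    unfolding expo ..
  also have "\<dots> \<le> 2 * exp (- (\<mu>\<^sup>2 / (8 * K\<^sup>2)) * real k powr \<eta>)"
  proof -
    have "real k powr \<eta> \<le> real k powr (2 * (\<eta> - d))" using kp d by (intro powr_mono) auto
    then have "\<mu>\<^sup>2 / (8 * K\<^sup>2) * real k powr \<eta> \<le> \<mu>\<^sup>2 / (8 * K\<^sup>2) * real k powr (2 * (\<eta> - d))"
      by (intro mult_left_mono) auto
    then show ?thesis by simp
  qed
  finally show ?thesis .
qed

theorem theorem2:
  fixes M :: "'w measure" and W :: "real \<Rightarrow> 'w \<Rightarrow> real ^ 2"
    and \<alpha> \<mu> \<epsilon> \<eta> :: real
  assumes "standard_brownian_motion M W"
    and "0 < \<alpha>" and "\<alpha> < 1"
    and "\<mu> > 0" and "\<epsilon> > 0" and "\<eta> > 0"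
  shows "limsup (\<lambda>n. B_event M W \<alpha> \<mu> \<eta> \<epsilon> n) \<in> null_sets (completion M)"
proof -
  interpret standard_brownian_motion M W by (rule assms(1))
  note \<alpha> = assms(2,3)
  have "AE \<omega> in M. W 0 \<omega> = 0 \<and> continuous_on {0..} (\<lambda>t. W t \<omega>)"
    using W_zero continuous_paths by eventually_elim auto
  then obtain N where N: "N \<in> null_sets M" "{\<omega> \<in> space M. \<not> (W 0 \<omega> = 0 \<and> continuous_on {0..} (\<lambda>t. W t \<omega>))} \<subseteq> N"
    by (auto simp: eventually_ae_filter)
  define G where "G = space M - N"
  have G: "G \<in> sets M" using N by (auto simp: G_def)
  have G_AE: "AE \<omega> in M. \<omega> \<in> G"
    using AE_not_in[OF N(1)] AE_space by eventually_elim (auto simp: G_def)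
  have G_zero: "W 0 \<omega> = 0" and G_cont: "continuous_on {0..} (\<lambda>t. W t \<omega>)" if "\<omega> \<in> G" for \<omega>
    using that N(2) by (auto simp: G_def)
  define b where "b = coordinate G W"
  have gp: "gaussian_path M (b i)" for i
    unfolding b_def by (rule gaussian_path_coordinate[OF G G_AE G_zero G_cont])
  have path_b: "path W \<omega> t $ i = b i t \<omega>" if "\<omega> \<in> G" for \<omega> t i
    using that by (simp add: path_def b_def coordinate_def)
  have path_cont: "path W \<omega> \<in> borel_measurable borel" if "\<omega> \<in> G" for \<omega>
  proof -
    have "continuous_on UNIV (\<lambda>t. \<chi> i. b i t \<omega>)"
      by (intro continuous_on_vec_lambda gaussian_path.b_continuous[OF gp])
    moreover have "(\<lambda>t. \<chi> i. b i t \<omega>) = path W \<omega>"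
      using path_b[OF that] by (auto simp: vec_eq_iff)
    ultimately have "continuous_on UNIV (path W \<omega>)" by (simp only:)
    then show ?thesis by (rule borel_measurable_continuous_onI)
  qed
  define D where "D k n i \<omega> = (\<Sum>m\<le>n. delay_prob \<alpha> k (int m) * b i (real n - real m) \<omega>)
        - (LINT u|lborel. heat_kernel \<alpha> k (n - k / \<alpha> - u) * b i u \<omega>)" for k n :: nat and i \<omega>
  define E where "E k n i \<omega> = - (\<Sum>m\<le>n. delay_prob \<alpha> (Suc k) (int m) * (b i (real n + 1 - real m) \<omega> - b i (real n - real m) \<omega>)) / \<alpha>
        - (LINT u|lborel. drift_kernel \<alpha> k (n - k / \<alpha> - u) * b i u \<omega>)" for k n :: nat and i \<omega>
  have weights: "AE \<omega> in M. \<forall>k::nat. \<forall>i. k \<ge> 1 \<longrightarrow> integrable lborel (\<lambda>u. exp (- (1 / (2 * real k)) * \<bar>u\<bar>) * b i u \<omega>)"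
    unfolding AE_all_countable
  proof (intro allI)
    fix k :: nat and i
    show "AE \<omega> in M. k \<ge> 1 \<longrightarrow> integrable lborel (\<lambda>u. exp (- (1 / (2 * real k)) * \<bar>u\<bar>) * b i u \<omega>)"
    proof (cases "k \<ge> 1")
      case True
      have "AE \<omega> in M. integrable lborel (\<lambda>u. exp (- (1 / (2 * real k)) * \<bar>u\<bar>) * b i u \<omega>)"
        by (rule gaussian_path.AE_integrable_exp_weight[OF gp]) (use True in auto)
      then show ?thesis by eventually_elim simp
    qed simp
  qed
  obtain N' where N': "N' \<in> null_sets M" and good: "\<And>\<omega>. \<omega> \<in> space M - N' \<Longrightarrow> \<omega> \<in> G \<and>
      (\<forall>k::nat. \<forall>i. k \<ge> 1 \<longrightarrow> integrable lborel (\<lambda>u. exp (- (1 / (2 * real k)) * \<bar>u\<bar>) * b i u \<omega>))"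
  proof -
    have "AE \<omega> in M. \<omega> \<in> G \<and> (\<forall>k::nat. \<forall>i. k \<ge> 1 \<longrightarrow> integrable lborel (\<lambda>u. exp (- (1 / (2 * real k)) * \<bar>u\<bar>) * b i u \<omega>))"
      using G_AE weights by eventually_elim auto
    then show ?thesis using that by (auto simp: eventually_ae_filter) blast
  qed
  have errors: "(conga \<alpha> (path W \<omega>) (k + 1) n - ubar \<alpha> (path W \<omega>) (real k) (real n)) $ i = D k n i \<omega>"
    "((conga \<alpha> (path W \<omega>) (k + 2) n - conga \<alpha> (path W \<omega>) (k + 1) n) - dx_ubar \<alpha> (path W \<omega>) (real k) (real n)) $ i = E k n i \<omega>"
    if \<omega>: "\<omega> \<in> space M - N'" and k: "k \<ge> 1" for \<omega> k n i
  proof -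
    have \<omega>G: "\<omega> \<in> G" using good[OF \<omega>] by simp
    note pb = path_b[OF \<omega>G]
    have wi: "integrable lborel (\<lambda>u. exp (- (1 / (2 * real k)) * \<bar>u\<bar>) *\<^sub>R path W \<omega> u)"
      by (rule integrable_vecI) (use good[OF \<omega>] k pb in auto)
    note ker = ubar_dx_ubar_kernels[OF \<alpha> k of_nat_0_le_iff path_cont[OF \<omega>G] wi, of n]
    have p0: "path W \<omega> 0 = 0" by (simp add: path_def)
    show "(conga \<alpha> (path W \<omega>) (k + 1) n - ubar \<alpha> (path W \<omega>) (real k) (real n)) $ i = D k n i \<omega>"
      unfolding ubar_eq_heat_integral[OF path_cont[OF \<omega>G]] D_def
      using conga_eq_sum_delay_prob[of \<alpha> "path W \<omega>" k n] integral_vec_nth[OF ker(1), of i]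
      by (simp add: pb)
    show "((conga \<alpha> (path W \<omega>) (k + 2) n - conga \<alpha> (path W \<omega>) (k + 1) n) - dx_ubar \<alpha> (path W \<omega>) (real k) (real n)) $ i = E k n i \<omega>"
      unfolding conga_speed[of \<alpha> "path W \<omega>", OF less_imp_neq[OF \<alpha>(1), symmetric] p0] ker(3) E_def
      using integral_vec_nth[OF ker(2), of i] by (simp add: pb)
  qed
  \<comment> \<open>The loss allowed in the interpolation must leave half of the margin \<open>\<eta>\<close> to the tail bound.\<close>
  define d where "d = min (\<eta> / 2) (1 / 2)"
  have d: "0 < d" "d < 1" "2 * d \<le> \<eta>" using assms(6) by (auto simp: d_def)
  obtain C c where Cc: "C > 0" "0 < c" "c \<le> 1"
    and env: "\<And>(k::nat) y. k \<ge> 1 \<Longrightarrow> heat_kernel \<alpha> k y \<le> C / sqrt k * exp (- (c / sqrt k) * \<bar>y\<bar>)"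
    "\<And>(k::nat) y. k \<ge> 1 \<Longrightarrow> \<bar>drift_kernel \<alpha> k y\<bar> \<le> C * k powr (d - 1) * exp (- (c / sqrt k) * \<bar>y\<bar>)"
    "\<And>(k::nat) m y. k \<ge> 1 \<Longrightarrow> \<bar>m - k / \<alpha> - y\<bar> \<le> 1 \<Longrightarrow>
       \<bar>delay_prob \<alpha> k m - heat_kernel \<alpha> k y\<bar> \<le> C * k powr (d - 1) * exp (- (c / sqrt k) * \<bar>y\<bar>)"
    "\<And>(k::nat) m. k \<ge> 1 \<Longrightarrow>
       \<bar>delay_prob \<alpha> (Suc k) m / \<alpha> - flux_kernel \<alpha> k (m - k / \<alpha>)\<bar>
          \<le> C * k powr (d - 1) * exp (- (c / sqrt k) * \<bar>m - k / \<alpha>\<bar>)"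
    by (rule lattice_envelopes[OF \<alpha> d(1,2)]) blast
  define K where "K = 13 * C / (c * sqrt c)"
  have K: "K > 0" using Cc by (simp add: K_def)
  have subD: "subgauss M (K * real k powr (d - 1/4)) (D k n i)" and subE: "subgauss M (K * real k powr (d - 3/4)) (E k n i)"
    if k: "k \<ge> 1" for k n i
    unfolding D_def [abs_def] E_def [abs_def] K_def
    using gaussian_path.subgauss_conga_errors[OF gp \<alpha> Cc d(1,2), of k] env k by auto
  define A where "A k n = (\<Union>i. {\<omega> \<in> space M. \<bar>D k n i \<omega>\<bar> > \<mu> * real k powr (- (1/4 - \<eta>)) / 2})
     \<union> (\<Union>i. {\<omega> \<in> space M. \<bar>E k n i \<omega>\<bar> > \<mu> * real k powr (- (3/4 - \<eta>)) / 2})" for k n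
  define I where "I n = {k. real n powr \<epsilon> \<le> real k \<and> k \<le> n}" for n :: nat
  \<comment> \<open>For \<open>n = 0\<close> the union would include \<open>k = 0\<close>, for which the kernels are degenerate.\<close>
  define B where "B n = (if n = 0 then {} else \<Union>k\<in>I n. A k n)" for n
  have finI: "finite (I n)" for n by (rule finite_subset[of _ "{..n}"]) (auto simp: I_def)
  have I1: "k \<ge> 1" if "k \<in> I n" "n \<ge> 1" for k n
  proof -
    have "1 \<le> real n powr \<epsilon>" using that assms(5) by (intro ge_one_powr_ge_zero) auto
    then show ?thesis using that by (simp add: I_def)
  qed
  have Am: "A k n \<in> sets M" if "k \<ge> 1" for k n
  proof -
    have [measurable]: "D k n i \<in> borel_measurable M" "E k n i \<in> borel_measurable M" for i
      using subgauss_measurable[OF subD[OF that]] subgauss_measurable[OF subE[OF that]] by auto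
    show ?thesis unfolding A_def by measurable
  qed
  have Bm: "B n \<in> sets M" for n
    unfolding B_def using finI Am I1 by (auto intro!: sets.finite_UN)
  define \<kappa> where "\<kappa> = \<mu>\<^sup>2 / (8 * K\<^sup>2)"
  have \<kappa>: "\<kappa> > 0" using assms(4) K by (simp add: \<kappa>_def)
  have Ap: "prob (A k n) \<le> 8 * exp (- \<kappa> * real k powr \<eta>)" if k: "k \<ge> 1" for k n
  proof -
    let ?AD = "\<lambda>i. {\<omega> \<in> space M. \<bar>D k n i \<omega>\<bar> > \<mu> * real k powr (- (1/4 - \<eta>)) / 2}"
    let ?AE = "\<lambda>i. {\<omega> \<in> space M. \<bar>E k n i \<omega>\<bar> > \<mu> * real k powr (- (3/4 - \<eta>)) / 2}"
    have [measurable]: "D k n i \<in> borel_measurable M" "E k n i \<in> borel_measurable M" for i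
      using subgauss_measurable[OF subD[OF k]] subgauss_measurable[OF subE[OF k]] by auto
    have "prob (A k n) \<le> prob (\<Union>i. ?AD i) + prob (\<Union>i. ?AE i)"
      unfolding A_def by (rule measure_Un_le) measurable
    also have "\<dots> \<le> (\<Sum>i\<in>UNIV. prob (?AD i)) + (\<Sum>i\<in>UNIV. prob (?AE i))"
      by (intro add_mono measure_UNION_le) auto
    also have "\<dots> \<le> (\<Sum>i\<in>(UNIV :: 2 set). 2 * exp (- \<kappa> * real k powr \<eta>)) + (\<Sum>i\<in>(UNIV :: 2 set). 2 * exp (- \<kappa> * real k powr \<eta>))"
      unfolding \<kappa>_def
      by (intro add_mono sum_mono subgauss_powr_tail[OF subD K] subgauss_powr_tail[OF subE K] k assms(4) d(3))
    finally show ?thesis by simp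
  qed
  have Bp: "prob (B n) \<le> 8 * (real n * exp (- \<kappa> * real n powr (\<epsilon> * \<eta>)))" for n
  proof (cases "n = 0")
    case False
    then have n: "n \<ge> 1" by simp
    have "prob (B n) \<le> (\<Sum>k\<in>I n. prob (A k n))"
      unfolding B_def using False Am I1[OF _ n] finI by (auto intro!: measure_UNION_le)
    also have "\<dots> \<le> (\<Sum>k\<in>I n. 8 * exp (- \<kappa> * real n powr (\<epsilon> * \<eta>)))"
    proof (rule sum_mono)
      fix k assume k: "k \<in> I n"
      have "real n powr (\<epsilon> * \<eta>) = (real n powr \<epsilon>) powr \<eta>" by (simp add: powr_powr)
      also have "\<dots> \<le> real k powr \<eta>" using k assms(6) by (intro powr_mono2) (auto simp: I_def)
      finally have "\<kappa> * real n powr (\<epsilon> * \<eta>) \<le> \<kappa> * real k powr \<eta>" using \<kappa> by (intro mult_left_mono) auto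
      then show "prob (A k n) \<le> 8 * exp (- \<kappa> * real n powr (\<epsilon> * \<eta>))"
        using Ap[OF I1[OF k n], of n] by (smt (verit) exp_le_cancel_iff mult_minus_left)
    qed
    also have "\<dots> = real (card (I n)) * (8 * exp (- \<kappa> * real n powr (\<epsilon> * \<eta>)))" by simp
    also have "\<dots> \<le> real n * (8 * exp (- \<kappa> * real n powr (\<epsilon> * \<eta>)))"
    proof (intro mult_right_mono)
      have "I n \<subseteq> {1..n}" using I1[OF _ n] by (auto simp: I_def)
      then have "card (I n) \<le> n" using card_mono[of "{1..n}" "I n"] by simp
      then show "real (card (I n)) \<le> real n" by simp
    qed auto
    finally show ?thesis by simp
  qed (simp add: B_def)
  have "limsup B \<in> null_sets M"
  proof (rule borel_cantelli_limsup1)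
    show "summable (\<lambda>n. prob (B n))"
    proof (rule summable_comparison_test')
      show "summable (\<lambda>n. 8 * (real n * exp (- \<kappa> * real n powr (\<epsilon> * \<eta>))))"
        using summable_stretched_exp[OF \<kappa>, of "\<epsilon> * \<eta>"] assms(5,6) by (intro summable_mult) auto
      show "norm (prob (B n)) \<le> 8 * (real n * exp (- \<kappa> * real n powr (\<epsilon> * \<eta>)))" if "n \<ge> 0" for n
        using Bp[of n] by simp
    qed
  qed (use Bm in \<open>auto simp: emeasure_eq_measure\<close>)
  then have null: "limsup B \<union> N' \<in> null_sets M" using N' by auto
  have incl: "B_event M W \<alpha> \<mu> \<eta> \<epsilon> n - N' \<subseteq> B n" if n: "n \<ge> 1" for n
  proof
    fix \<omega> assume "\<omega> \<in> B_event M W \<alpha> \<mu> \<eta> \<epsilon> n - N'"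
    then obtain k where k: "k \<in> I n" and \<omega>: "\<omega> \<in> A_event M W \<alpha> \<mu> \<eta> k n" "\<omega> \<in> space M - N'"
      by (auto simp: B_event_def I_def A_event_def)
    note err = errors[OF \<omega>(2) I1[OF k n], of n]
    have "\<omega> \<in> A k n"
      using \<omega>(1) unfolding A_event_def
    proof (clarify, elim disjE)
      assume "norm (conga \<alpha> (path W \<omega>) (k + 1) n - ubar \<alpha> (path W \<omega>) (real k) (real n)) > \<mu> * real k powr (- (1/4 - \<eta>))"
      from norm_gt_imp_component[OF this] show "\<omega> \<in> A k n" using \<omega>(2) unfolding err A_def by auto
    next
      assume "norm ((conga \<alpha> (path W \<omega>) (k + 2) n - conga \<alpha> (path W \<omega>) (k + 1) n) - dx_ubar \<alpha> (path W \<omega>) (real k) (real n)) > \<mu> * real k powr (- (3/4 - \<eta>))"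
      from norm_gt_imp_component[OF this] show "\<omega> \<in> A k n" using \<omega>(2) unfolding err A_def by auto
    qed
    then show "\<omega> \<in> B n" using k n by (auto simp: B_def)
  qed
  have "limsup (\<lambda>n. B_event M W \<alpha> \<mu> \<eta> \<epsilon> n) \<subseteq> limsup B \<union> N'"
  proof
    fix \<omega> assume \<omega>: "\<omega> \<in> limsup (\<lambda>n. B_event M W \<alpha> \<mu> \<eta> \<epsilon> n)"
    show "\<omega> \<in> limsup B \<union> N'"
    proof (cases "\<omega> \<in> N'")
      case False
      have "\<exists>m\<ge>n. \<omega> \<in> B m" for n
      proof -
        obtain m where m: "m \<ge> max n 1" "\<omega> \<in> B_event M W \<alpha> \<mu> \<eta> \<epsilon> m"
          using \<omega> unfolding limsup_INF_SUP by (auto simp del: max.bounded_iff)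
        then show ?thesis using incl[of m] False by (intro exI[of _ m]) auto
      qed
      then show ?thesis unfolding limsup_INF_SUP by auto
    qed simp
  qed
  with null show ?thesis
    by (rule null_sets_completion_subset[rotated, OF null_sets_completionI])
qed

end
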